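(* Let $X=V(f)\subset\mathbb P^N$ be an irreducible cubic hypersurface with vanishing hessian, not a cone, such that $\operatorname{codim}(Z)=1$, where $Z$ is the polar image of $X$, and let $\sigma$ be an integer. For $w\in W=Z^*$ general, let $\mathbb P^{N-\dim(Z^* )}_w=\overline{\mathcal P_X^{-1}(w)}$ be the corresponding fiber of the Perazzo map. The following conditions are equivalent: (i) $X$ is a Special Perazzo Cubic Hypersurface with $\dim(Z^* )+1=\sigma$ and with $L=\bigcap_{w\in W\ \mathrm{general}}\mathbb P^{N-\dim(Z^* )}_w$ a linear space of dimension $N-\sigma$; (ii) $\dim(Z^* )=\sigma-1$ and the polar quadric $Q_p$ of a general point $p\in\mathbb P^N$ is tangent to a fixed linear space $L=\mathbb P^{N-\sigma}$ along a common generator $M=\mathbb P^\sigma$ of $Q_p$, with $\bigcap_{m\in M\setminus\operatorname{Vert}(Q_p)}T_mQ_p=L$. Moreover, if these conditions hold, $X\subset\mathbb P^N$ is projectively equivalent to $$V\Big(\sum_{i=0}^{\sigma}x_iC^i(x_{N-\sigma+1},\dots,x_N)+D(x_{\sigma+1},\dots,x_N)\Big)\subset\mathbb P^N,$$ with $C^i$ quadratic forms and $D$ a cubic form.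
   Context: The ground field $\mathbb K$ is algebraically closed of characteristic zero; hypersurfaces $X=V(f)\subset\mathbb P^N$ are reduced. $X$ has vanishing hessian if $\det\left[\frac{\partial^2f}{\partial x_i\partial x_j}\right]\equiv0$. $X$ is a cone if there is $p\in X$ with $\langle p,q\rangle\subset X$ for all $q\in X$, $q\ne p$. The polar map is $\Phi_X:\mathbb P^N\dashrightarrow(\mathbb P^N)^*$, $p\mapsto(\frac{\partial f}{\partial x_0}(p):\dots:\frac{\partial f}{\partial x_N}(p))$, and the polar image is $Z=\overline{\Phi_X(\mathbb P^N)}\subsetneq(\mathbb P^N)^*$. For a linear space $\Lambda\subset(\mathbb P^N)^*$, $\Lambda^*\subset\mathbb P^N$ is the linear space of points corresponding to hyperplanes containing $\Lambda$; $T_zZ$ is the projective tangent space at a smooth point, and $Z^*=\overline{\bigcup_{z\in Z_{\rm reg}}(T_zZ)^*}\subset\mathbb P^N$ ($Z_{\rm reg}$ the smooth locus). The Perazzo map is $\mathcal P_X:\mathbb P^N\dashrightarrow\mathbb G(\operatorname{codim}(Z)-1,N)$, $p\mapsto(T_{\Phi_X(p)}Z)^*$; $W$ is the closure of its image and $\mu=\dim W$. When $\operatorname{codim}(Z)=1$ one has $\mathbb G(0,N)=\mathbb P^N$ and $W=Z^*$. For cubics the closure of a general fiber of $\mathcal P_X$ is a linear space of dimension $N-\mu$. A Special Perazzo Cubic Hypersurface is an irreducible cubic hypersurface with vanishing hessian, not a cone, such that the closures of the general fibers of $\mathcal P_X$ all contain one fixed linear space of dimension $N-\mu-1$. $Q_p$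 is the polar quadric of $p$, with symmetric matrix the Hessian matrix of $f$ at $p$. For a quadric $Q\subset\mathbb P^N$ of rank at least 3, $\operatorname{Vert}(Q)=\operatorname{Sing}Q$; a linear space $M$ of positive dimension is a generator of $Q$ if $\operatorname{Vert}(Q)\subsetneq M\subset Q$. If $L$ is a linear space containing a generator $M$, $Q$ is tangent to $L$ along $M$ if $L\subseteq T_mQ$ for all $m\in M$ (with $T_mQ=\mathbb P^N$ for $m\in\operatorname{Vert}(Q)$). "Common" generator means that the same $M$ (and $L$) works for general $p$. *)

theory Defs
  imports
    "HOL-Analysis.Analysis"
    "HOL-Library.Poly_Mapping"
    "HOL-Computational_Algebra.Computational_Algebra"
begin

section \<open>Polynomials with variables indexed by a finite type\<close>

type_synonym ('n, 'k) mpoly = "('n \<Rightarrow>\<^sub>0 nat) \<Rightarrow>\<^sub>0 'k"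

definition Var :: "'n \<Rightarrow> ('n, 'k::field) mpoly" where
  "Var i = Poly_Mapping.single (Poly_Mapping.single i 1) 1"

definition peval :: "('n::finite, 'k::field) mpoly \<Rightarrow> 'k^'n \<Rightarrow> 'k" where
  "peval F v =
    (\<Sum>m\<in>Poly_Mapping.keys F. Poly_Mapping.lookup F m * (\<Prod>i\<in>UNIV. v $ i ^ Poly_Mapping.lookup m i))"

definition pd :: "'n \<Rightarrow> ('n::finite, 'k::field) mpoly \<Rightarrow> ('n, 'k) mpoly" where
  "pd i F = (\<Sum>m\<in>Poly_Mapping.keys F.
     Poly_Mapping.single (m - Poly_Mapping.single i 1)
       (of_nat (Poly_Mapping.lookup m i) * Poly_Mapping.lookup F m))"

definition homogeneous :: "nat \<Rightarrow> ('n::finite, 'k::field) mpoly \<Rightarrow> bool" where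
  "homogeneous d F \<longleftrightarrow> (\<forall>m\<in>Poly_Mapping.keys F. (\<Sum>i\<in>UNIV. Poly_Mapping.lookup m i) = d)"

text \<open>A form of degree \<open>d\<close> in the variables from \<open>S\<close> only; zero is allowed.\<close>

definition form_in :: "'n set \<Rightarrow> nat \<Rightarrow> ('n::finite, 'k::field) mpoly \<Rightarrow> bool" where
  "form_in S d F \<longleftrightarrow> homogeneous d F \<and> (\<forall>m\<in>Poly_Mapping.keys F. Poly_Mapping.keys m \<subseteq> S)"

definition gradient :: "('n::finite, 'k::field) mpoly \<Rightarrow> 'k^'n \<Rightarrow> 'k^'n" where
  "gradient F v = (\<chi> i. peval (pd i F) v)"

definition hessian_at :: "('n::finite, 'k::field) mpoly \<Rightarrow> 'k^'n \<Rightarrow> 'k^'n^'n" where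
  "hessian_at F v = (\<chi> i j. peval (pd j (pd i F)) v)"

definition vanishing_hessian :: "('n::finite, 'k::field) mpoly \<Rightarrow> bool" where
  "vanishing_hessian F \<longleftrightarrow> det (\<chi> i j. pd j (pd i F)) = 0"


section \<open>Projective space\<close>

text \<open>
  With \<open>CARD('n) = N + 1\<close>, a point of projective \<open>N\<close>-space is a line through the origin of
  \<open>'k^'n\<close>, and a linear space is given by a linear subspace \<open>U\<close> of \<open>'k^'n\<close>; its set of points
  is \<open>proj_pts U\<close>, its dimension \<open>proj_dim U\<close> (which is \<open>-1\<close> for the empty linear space).
  The dual projective space is modelled by the same type: \<open>u\<close> stands for the hyperplane
  \<open>dotp u v = 0\<close>.
\<close>

definition dotp :: "'k::field^'n::finite \<Rightarrow> 'k^'n \<Rightarrow> 'k" where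
  "dotp u v = (\<Sum>i\<in>UNIV. u $ i * v $ i)"

definition proj_pts :: "('k::field^'n::finite) set \<Rightarrow> ('k^'n) set set" where
  "proj_pts U = {vec.span {v} | v. v \<in> U \<and> v \<noteq> 0}"

abbreviation PN :: "('k::field^'n::finite) set set" where
  "PN \<equiv> proj_pts UNIV"

definition proj_dim :: "('k::field^'n::finite) set \<Rightarrow> int" where
  "proj_dim U = int (vec.dim U) - 1"

definition annihilator :: "('k::field^'n::finite) set \<Rightarrow> ('k^'n) set" where
  "annihilator U = {v. \<forall>u\<in>U. dotp u v = 0}"

definition vanishes_at :: "('n::finite, 'k::field) mpoly \<Rightarrow> ('k^'n) set \<Rightarrow> bool" where
  "vanishes_at F p \<longleftrightarrow> (\<forall>v\<in>p. peval F v = 0)"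

definition hypersurface :: "('n::finite, 'k::field) mpoly \<Rightarrow> ('k^'n) set set" where
  "hypersurface F = {p \<in> PN. vanishes_at F p}"

definition zariski :: "('k::field^'n::finite) set topology" where
  "zariski = topology_generated_by {PN - hypersurface F | F. \<exists>d. homogeneous d F}"

definition irreducible_set :: "'a topology \<Rightarrow> 'a set \<Rightarrow> bool" where
  "irreducible_set T S \<longleftrightarrow> S \<subseteq> topspace T \<and> S \<noteq> {} \<and>
     (\<forall>A B. closedin T A \<and> closedin T B \<and> S \<subseteq> A \<union> B \<longrightarrow> S \<subseteq> A \<or> S \<subseteq> B)"

text \<open>
  Krull dimension of a closed set \<open>S\<close>: the supremum of the lengths of strict chains of
  irreducible closed subsets (these lengths are bounded by \<open>N\<close>).
\<close>

definition variety_dim :: "('k::field^'n::finite) set set \<Rightarrow> nat" where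
  "variety_dim S = Sup {d. \<exists>C. (\<forall>i\<le>d. closedin zariski (C i) \<and> irreducible_set zariski (C i) \<and> C i \<subseteq> S)
                             \<and> (\<forall>i<d. C i \<subset> C (Suc i))}"

text \<open>The property \<open>P\<close> holds for a general point of the irreducible variety \<open>V\<close>.\<close>

definition generally :: "('k::field^'n::finite) set set \<Rightarrow> (('k^'n) set \<Rightarrow> bool) \<Rightarrow> bool" where
  "generally V P \<longleftrightarrow> (\<exists>U. openin zariski U \<and> U \<inter> V \<noteq> {} \<and> (\<forall>p\<in>U \<inter> V. P p))"

text \<open>
  \<open>I\<close> is the intersection of the sets \<open>A w\<close> for \<open>w\<close> general in the irreducible variety \<open>V\<close>:
  it is the intersection over every sufficiently small nonempty open subset of \<open>V\<close>.
\<close>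

definition is_general_Inter ::
  "('k::field^'n::finite) set set \<Rightarrow> (('k^'n) set \<Rightarrow> ('k^'n) set set) \<Rightarrow> ('k^'n) set set \<Rightarrow> bool" where
  "is_general_Inter V A I \<longleftrightarrow>
     (\<exists>U. openin zariski U \<and> U \<inter> V \<noteq> {} \<and>
        (\<forall>U'. openin zariski U' \<and> U' \<subseteq> U \<and> U' \<inter> V \<noteq> {} \<longrightarrow> (\<Inter>w\<in>U' \<inter> V. A w) = I))"

text \<open>For distinct points \<open>p\<close>, \<open>q\<close>, the subspace \<open>vec.span (p \<union> q)\<close> gives the line joining them.\<close>

definition is_cone :: "('k::field^'n::finite) set set \<Rightarrow> bool" where
  "is_cone X \<longleftrightarrow> (\<exists>p\<in>X. \<forall>q\<in>X. q \<noteq> p \<longrightarrow> proj_pts (vec.span (p \<union> q)) \<subseteq> X)"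

definition proj_equivalent :: "('k::field^'n::finite) set set \<Rightarrow> ('k^'n) set set \<Rightarrow> bool" where
  "proj_equivalent X Y \<longleftrightarrow> (\<exists>A::'k^'n^'n. invertible A \<and> (\<lambda>p. (*v) A ` p) ` X = Y)"


section \<open>Tangent spaces and duality\<close>

text \<open>The projective tangent space at a point \<open>z\<close> of a closed set \<open>Z\<close>, as a linear subspace.\<close>

definition tangent_space :: "('k::field^'n::finite) set set \<Rightarrow> ('k^'n) set \<Rightarrow> ('k^'n) set" where
  "tangent_space Z z =
     {v. \<forall>F d. homogeneous d F \<and> (\<forall>p\<in>Z. vanishes_at F p) \<longrightarrow> (\<forall>u\<in>z. dotp (gradient F u) v = 0)}"

text \<open>The smooth locus of an irreducible closed set.\<close>

definition smooth_locus :: "('k::field^'n::finite) set set \<Rightarrow> ('k^'n) set set" where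
  "smooth_locus Z = {z \<in> Z. proj_dim (tangent_space Z z) = int (variety_dim Z)}"

definition dual_variety :: "('k::field^'n::finite) set set \<Rightarrow> ('k^'n) set set" where
  "dual_variety Z =
     zariski closure_of (\<Union>z\<in>smooth_locus Z. proj_pts (annihilator (tangent_space Z z)))"


section \<open>Polar map and Perazzo map\<close>

text \<open>
  For a form \<open>f\<close> and a point \<open>p\<close>, the set \<open>polar_map f p\<close> is the line spanned by the gradient of
  \<open>f\<close> at any representative of \<open>p\<close>, or \<open>{0}\<close> (not a point) where the polar map is undefined.
\<close>

definition polar_map :: "('n::finite, 'k::field) mpoly \<Rightarrow> ('k^'n) set \<Rightarrow> ('k^'n) set" where
  "polar_map f p = vec.span (gradient f ` p)"

definition polar_image :: "('n::finite, 'k::field) mpoly \<Rightarrow> ('k^'n) set set" where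
  "polar_image f = zariski closure_of (polar_map f ` {p \<in> PN. polar_map f p \<in> PN})"

definition perazzo_dom :: "('n::finite, 'k::field) mpoly \<Rightarrow> ('k^'n) set set" where
  "perazzo_dom f = {p \<in> PN. polar_map f p \<in> smooth_locus (polar_image f)}"

text \<open>
  The values of the Perazzo map are linear spaces of projective dimension \<open>codim Z - 1\<close>, given as
  linear subspaces. If \<open>codim Z = 1\<close> they are lines through the origin, i.e. literally points.
  The closure of the image below is taken in projective space, so \<open>perazzo_image\<close> and what
  depends on it are meant for \<open>codim Z = 1\<close> only.
\<close>

definition perazzo_map :: "('n::finite, 'k::field) mpoly \<Rightarrow> ('k^'n) set \<Rightarrow> ('k^'n) set" where
  "perazzo_map f p = annihilator (tangent_space (polar_image f) (polar_map f p))"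

definition perazzo_image :: "('n::finite, 'k::field) mpoly \<Rightarrow> ('k^'n) set set" where
  "perazzo_image f = zariski closure_of (perazzo_map f ` perazzo_dom f)"

definition perazzo_fiber :: "('n::finite, 'k::field) mpoly \<Rightarrow> ('k^'n) set \<Rightarrow> ('k^'n) set set" where
  "perazzo_fiber f w = zariski closure_of {p \<in> perazzo_dom f. perazzo_map f p = w}"

definition special_perazzo_cubic :: "('n::finite, 'k::field) mpoly \<Rightarrow> bool" where
  "special_perazzo_cubic f \<longleftrightarrow>
     homogeneous 3 f \<and> irreducible f \<and> vanishing_hessian f \<and> \<not> is_cone (hypersurface f) \<and>
     (\<exists>\<Lambda>::('k^'n) set. vec.subspace \<Lambda> \<and>
        proj_dim \<Lambda> = proj_dim (UNIV :: ('k^'n) set) - int (variety_dim (perazzo_image f)) - 1 \<and>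
        generally (perazzo_image f) (\<lambda>w. proj_pts \<Lambda> \<subseteq> perazzo_fiber f w))"


section \<open>Quadrics\<close>

text \<open>A quadric is given by its symmetric matrix \<open>A\<close>; linear spaces are linear subspaces.\<close>

definition quadric_cone :: "'k::field^'n^'n::finite \<Rightarrow> ('k^'n) set" where
  "quadric_cone A = {v. dotp v (A *v v) = 0}"

definition Vert :: "'k::field^'n^'n::finite \<Rightarrow> ('k^'n) set" where
  "Vert A = {v. A *v v = 0}"

definition quadric_tangent :: "'k::field^'n^'n::finite \<Rightarrow> 'k^'n \<Rightarrow> ('k^'n) set" where
  "quadric_tangent A m = {v. dotp (A *v m) v = 0}"

definition generator :: "'k::field^'n^'n::finite \<Rightarrow> ('k^'n) set \<Rightarrow> bool" where
  "generator A M \<longleftrightarrow> rank A \<ge> 3 \<and> vec.subspace M \<and> proj_dim M > 0 \<and>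
     Vert A \<subset> M \<and> M \<subseteq> quadric_cone A"

definition tangent_along :: "'k::field^'n^'n::finite \<Rightarrow> ('k^'n) set \<Rightarrow> ('k^'n) set \<Rightarrow> bool" where
  "tangent_along A L M \<longleftrightarrow> vec.subspace L \<and> generator A M \<and> M \<subseteq> L \<and>
     (\<forall>m\<in>M. L \<subseteq> quadric_tangent A m)"

end

theory Submission
  imports Defs "HOL-Library.Function_Algebras"
begin

text \<open>
  Let \<open>B u v\<close> be the symmetric bilinear map with \<open>dotp (B u v) w\<close> the polarization of \<open>f\<close>, so that
  \<open>gradient f v = B v v / 2\<close> and \<open>B v\<close> is the Hessian at \<open>v\<close>. As \<open>Z\<close> is a hypersurface, the general
  Hessian has a one-dimensional kernel; for a form \<open>g\<close> of minimal degree vanishing on \<open>Z\<close> it is spanned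
  by \<open>w v = gradient g (gradient f v)\<close>, which represents the Perazzo map. Since \<open>B v (w v) = 0\<close>, a general
  fibre of the Perazzo map is the kernel of \<open>B (w v)\<close>, and its dimension is the codimension of \<open>W = Z*\<close>
  because \<open>w\<close> restricted to a suitable linear space is birational onto \<open>W\<close>.

  The general intersection of the fibres is \<open>{u. \<forall>v. B u (w v) = 0}\<close>, which is at least one dimension
  smaller than a fibre because \<open>X\<close> is not a cone. If it is exactly one dimension smaller,
  differentiating \<open>B v (w v) = 0\<close> and the fibre relation \<open>w v \<in> L + k v\<close> shows that \<open>M\<close>, the span of
  the values of \<open>w\<close>, lies in \<open>L\<close> and has dimension \<open>\<sigma>\<close>, and \<open>B\<close> vanishes on \<open>M \<times> L\<close>. This gives (ii) and,
  in coordinates adapted to \<open>M \<subseteq> L\<close>, the normal form. Conversely (ii) forces \<open>w v \<in> M\<close>, so \<open>L\<close> lies in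
  the general intersection and equals it by dimension.
\<close>


section \<open>Polynomial functions\<close>

text \<open>\<open>variety_dim\<close> counts chains of irreducible closed sets, while the varieties
  at hand are known only as closures of images of polynomial maps. Their dimensions are squeezed
  between two elementary bounds: too long a chain would contradict the algebraic dependence of too
  many forms on the parameter space, and a flag of linear subspaces on which the parametrization has
  a rational inverse gives a chain that is long enough. Hence parameter spaces are cut down by
  complements of kernels. Tangent vectors enter only through polynomial curves, so the derivative of
  \<open>w\<close> is never computed, only constrained by differentiating identities. A general
  point is one where some fixed form does not vanish, and what holds at general points is turned
  into an identity valid everywhere before it is differentiated. The dimension of \<open>M\<close>
  is forced from two sides: from above because the Hessian maps \<open>L\<close> into the orthogonal
  space of \<open>M\<close>, from below because a smaller \<open>M\<close> would make the
  derivatives of \<open>f\<close> in the directions of \<open>M\<close> vanish, and \<open>X\<close>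
  would be a cone.\<close>

abbreviation mon :: "('n::finite \<Rightarrow>\<^sub>0 nat) \<Rightarrow> 'k::field^'n \<Rightarrow> 'k" where
  "mon m v \<equiv> (\<Prod>i\<in>UNIV. v $ i ^ Poly_Mapping.lookup m i)"

lemma mon_add: "mon (a + b) v = mon a v * mon b v"
  by (simp add: lookup_add power_add prod.distrib)

lemma peval_superset:
  assumes "finite A" "Poly_Mapping.keys F \<subseteq> A"
  shows "peval F v = (\<Sum>m\<in>A. Poly_Mapping.lookup F m * mon m v)"
  unfolding peval_def
  by (rule sum.mono_neutral_left) (use assms in \<open>auto simp: in_keys_iff\<close>)

lemma peval_0 [simp]: "peval 0 v = 0"
  by (simp add: peval_def)

lemma peval_add [simp]: "peval (F + G) v = peval F v + peval G v"
proof -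
  let ?A = "Poly_Mapping.keys F \<union> Poly_Mapping.keys G"
  have "peval (F + G) v = (\<Sum>m\<in>?A. Poly_Mapping.lookup (F + G) m * mon m v)"
    by (rule peval_superset) (simp_all add: keys_add)
  also have "\<dots> = peval F v + peval G v"
    by (simp add: peval_superset[of ?A F] peval_superset[of ?A G] lookup_add ring_distribs sum.distrib)
  finally show ?thesis .
qed

lemma peval_sum [simp]: "peval (\<Sum>a\<in>A. F a) v = (\<Sum>a\<in>A. peval (F a) v)"
  by (induction A rule: infinite_finite_induct) simp_all

lemma peval_single [simp]: "peval (Poly_Mapping.single m c) v = c * mon m v"
  by (subst peval_superset[of "{m}"]) auto

lemma peval_1 [simp]: "peval 1 v = 1"
  using peval_single[of 0 1 v] by simp

lemma mpoly_decompose: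
  "F = (\<Sum>m\<in>Poly_Mapping.keys F. Poly_Mapping.single m (Poly_Mapping.lookup F m))"
proof (rule poly_mapping_eqI)
  fix k
  show "Poly_Mapping.lookup F k = Poly_Mapping.lookup (\<Sum>m\<in>Poly_Mapping.keys F. Poly_Mapping.single m (Poly_Mapping.lookup F m)) k"
    by (cases "k \<in> Poly_Mapping.keys F")
       (auto simp: lookup_sum lookup_single when_def in_keys_iff sum.delta')
qed

lemma peval_mult [simp]: "peval (F * G) v = peval F v * peval G v"
proof -
  have "F * G = (\<Sum>a\<in>Poly_Mapping.keys F. \<Sum>b\<in>Poly_Mapping.keys G.
      Poly_Mapping.single (a + b) (Poly_Mapping.lookup F a * Poly_Mapping.lookup G b))"
    by (subst mpoly_decompose[of F], subst mpoly_decompose[of G]) (simp add: sum_product mult_single)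
  then have "peval (F * G) v = (\<Sum>a\<in>Poly_Mapping.keys F. \<Sum>b\<in>Poly_Mapping.keys G.
      (Poly_Mapping.lookup F a * mon a v) * (Poly_Mapping.lookup G b * mon b v))"
    by (simp add: mon_add mult_ac)
  then show ?thesis
    by (simp add: peval_def sum_product)
qed

lemma peval_uminus [simp]: "peval (- F) v = - peval F v"
  using peval_add[of F "- F" v] by (simp add: eq_neg_iff_add_eq_0 add.commute)

lemma peval_of_int [simp]: "peval (of_int c) v = of_int c"
proof (cases c)
  case (nonneg n)
  have "peval (of_nat n) v = of_nat n" for n by (induction n) auto
  then show ?thesis using nonneg by simp
next
  case (neg n)
  have "peval (of_nat n) v = of_nat n" for n by (induction n) auto
  from this[of "Suc n"] show ?thesis using neg by (simp del: of_nat_Suc)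
qed

lemma peval_prod [simp]: "peval (\<Prod>a\<in>A. F a) v = (\<Prod>a\<in>A. peval (F a) v)"
  by (induction A rule: infinite_finite_induct) simp_all

lemma peval_det: "peval (det M) v = det (\<chi> i j. peval (M $ i $ j) v)"
  by (simp add: det_def)

lemma peval_Var [simp]: "peval (Var i) v = v $ i"
proof -
  have "mon (Poly_Mapping.single i 1) v = v $ i"
    by (subst prod.remove[of UNIV i]) (auto simp: lookup_single when_def intro!: prod.neutral)
  then show ?thesis by (simp add: Var_def)
qed

lemma homogeneous_0 [simp]: "homogeneous d 0"
  by (simp add: homogeneous_def)

lemma homogeneous_add: "homogeneous d F \<Longrightarrow> homogeneous d G \<Longrightarrow> homogeneous d (F + G)"
  using keys_add[of F G] unfolding homogeneous_def by blast

lemma homogeneous_mult: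
  assumes "homogeneous d F" "homogeneous e G"
  shows "homogeneous (d + e) (F * G)"
proof -
  have "(\<Sum>i\<in>UNIV. Poly_Mapping.lookup m i) = d + e" if m: "m \<in> Poly_Mapping.keys (F * G)" for m
  proof -
    obtain a b where "m = a + b" "a \<in> Poly_Mapping.keys F" "b \<in> Poly_Mapping.keys G"
      using m keys_mult[of F G] by fast
    then show ?thesis
      using assms by (simp add: homogeneous_def lookup_add sum.distrib)
  qed
  then show ?thesis by (simp add: homogeneous_def)
qed

lemma homogeneous_single:
  "(\<Sum>i\<in>UNIV. Poly_Mapping.lookup m i) = d \<Longrightarrow> homogeneous d (Poly_Mapping.single m c)"
  by (simp add: homogeneous_def)

lemma homogeneous_const: "homogeneous 0 (Poly_Mapping.single 0 c)"
  by (rule homogeneous_single) simp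

lemma homogeneous_Var: "homogeneous 1 (Var i)"
  unfolding Var_def
  by (rule homogeneous_single) (simp add: lookup_single when_def)

lemma lookup_pd:
  "Poly_Mapping.lookup (pd i F) m =
     of_nat (Suc (Poly_Mapping.lookup m i)) * Poly_Mapping.lookup F (m + Poly_Mapping.single i 1)"
proof -
  let ?e = "Poly_Mapping.single i (1::nat)"
  \<comment> \<open>Subtraction of exponents truncates, so \<open>m' - ?e\<close> determines
    \<open>m'\<close> only if \<open>i\<close> occurs in \<open>m'\<close>; the remaining terms
    carry the coefficient 0.\<close>
  have eq: "m' = m + ?e" if "m' - ?e = m" "Poly_Mapping.lookup m' i \<noteq> 0" for m'
  proof (rule poly_mapping_eqI)
    fix j
    show "Poly_Mapping.lookup m' j = Poly_Mapping.lookup (m + ?e) j"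
      using that by (auto simp: lookup_add lookup_minus lookup_single when_def)
  qed
  have "Poly_Mapping.lookup (pd i F) m =
      (\<Sum>m'\<in>Poly_Mapping.keys F. of_nat (Poly_Mapping.lookup m' i) * Poly_Mapping.lookup F m' when m' - ?e = m)"
    by (simp add: pd_def lookup_sum lookup_single)
  also have "\<dots> = (\<Sum>m'\<in>Poly_Mapping.keys F. if m' = m + ?e
      then of_nat (Poly_Mapping.lookup m' i) * Poly_Mapping.lookup F m' else 0)"
  proof (rule sum.cong[OF refl])
    fix m' assume "m' \<in> Poly_Mapping.keys F"
    show "(of_nat (Poly_Mapping.lookup m' i) * Poly_Mapping.lookup F m' when m' - ?e = m) =
      (if m' = m + ?e then of_nat (Poly_Mapping.lookup m' i) * Poly_Mapping.lookup F m' else 0)"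
    proof (cases "Poly_Mapping.lookup m' i = 0")
      case False
      have "m' - ?e = m \<longleftrightarrow> m' = m + ?e" using eq[OF _ False] by auto
      then show ?thesis by (simp only: when_def)
    next
      case True
      then show ?thesis by (simp only: of_nat_0 mult_zero_left zero_when if_cancel)
    qed
  qed
  also have "\<dots> = of_nat (Poly_Mapping.lookup (m + ?e) i) * Poly_Mapping.lookup F (m + ?e)"
    by (auto simp: sum.delta' in_keys_iff)
  also have "Poly_Mapping.lookup (m + ?e) i = Suc (Poly_Mapping.lookup m i)"
    by (simp add: lookup_add)
  finally show ?thesis .
qed

lemma pd_commute: "pd i (pd j F) = pd j (pd i F)"
proof (rule poly_mapping_eqI)
  fix m
  show "Poly_Mapping.lookup (pd i (pd j F)) m = Poly_Mapping.lookup (pd j (pd i F)) m"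
    by (cases "i = j") (simp_all add: lookup_pd lookup_add lookup_single add_ac when_def)
qed

lemma homogeneous_pd:
  assumes "homogeneous d F"
  shows "homogeneous (d - 1) (pd i F)"
proof -
  have "(\<Sum>j\<in>UNIV. Poly_Mapping.lookup m j) = d - 1" if "m \<in> Poly_Mapping.keys (pd i F)" for m
  proof -
    have "m + Poly_Mapping.single i 1 \<in> Poly_Mapping.keys F"
      using that by (auto simp: in_keys_iff lookup_pd)
    then have "(\<Sum>j\<in>UNIV. Poly_Mapping.lookup (m + Poly_Mapping.single i 1) j) = d"
      using assms by (simp add: homogeneous_def)
    then show ?thesis
      by (simp add: lookup_add sum.distrib lookup_single when_def)
  qed
  then show ?thesis by (simp add: homogeneous_def)
qed

lemma homogeneous_0D:
  assumes "homogeneous 0 F"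
  shows "peval F v = peval F 0"
proof -
  have "mon m v = mon m 0" if "m \<in> Poly_Mapping.keys F" for m
    using assms that by (simp add: homogeneous_def)
  then show ?thesis by (simp add: peval_def)
qed

lemma peval_scale:
  assumes "homogeneous d F"
  shows "peval F (c *s v) = c ^ d * peval F v"
proof -
  have "mon m (c *s v) = c ^ d * mon m v" if "m \<in> Poly_Mapping.keys F" for m
  proof -
    have "mon m (c *s v) = (\<Prod>i\<in>UNIV. c ^ Poly_Mapping.lookup m i) * mon m v"
      by (simp add: power_mult_distrib prod.distrib)
    also have "(\<Prod>i\<in>UNIV. c ^ Poly_Mapping.lookup m i) = c ^ d"
      using assms that by (simp add: homogeneous_def power_sum[symmetric])
    finally show ?thesis .
  qed
  then show ?thesis by (simp add: peval_def sum_distrib_left mult_ac)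
qed

text \<open>Forms are handled as functions, so that closure rules apply directly to expressions in
  \<open>v\<close>. The degree is a relation, not a function: the zero function is a form of every
  degree.\<close>

definition hfun :: "nat \<Rightarrow> ('k::field^'n::finite \<Rightarrow> 'k) \<Rightarrow> bool" where
  "hfun d g \<longleftrightarrow> (\<exists>F. homogeneous d F \<and> g = peval F)"

lemma hfun_peval: "homogeneous d F \<Longrightarrow> hfun d (peval F)"
  by (auto simp: hfun_def)

lemma hfun_zero: "hfun d (\<lambda>v. 0)"
  unfolding hfun_def by (rule exI[of _ 0]) auto

lemma hfun_const: "hfun 0 (\<lambda>v. c)"
  unfolding hfun_def by (rule exI[of _ "Poly_Mapping.single 0 c"]) (auto simp: homogeneous_const)

lemma hfun_nth: "hfun 1 (\<lambda>v. v $ i)"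
  unfolding hfun_def by (rule exI[of _ "Var i"]) (use homogeneous_Var in auto)

lemma hfun_add: "hfun d f \<Longrightarrow> hfun d g \<Longrightarrow> hfun d (\<lambda>v. f v + g v)"
proof -
  assume "hfun d f" "hfun d g"
  then obtain F G where "homogeneous d F" "f = peval F" "homogeneous d G" "g = peval G"
    by (auto simp: hfun_def)
  then show ?thesis
    unfolding hfun_def by (intro exI[of _ "F + G"]) (auto simp: homogeneous_add)
qed

lemma hfun_mult: "hfun d f \<Longrightarrow> hfun e g \<Longrightarrow> hfun (d + e) (\<lambda>v. f v * g v)"
proof -
  assume "hfun d f" "hfun e g"
  then obtain F G where "homogeneous d F" "f = peval F" "homogeneous e G" "g = peval G"
    by (auto simp: hfun_def)
  then show ?thesis
    unfolding hfun_def by (intro exI[of _ "F * G"]) (auto simp: homogeneous_mult)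
qed

lemma hfun_cmult: "hfun d f \<Longrightarrow> hfun d (\<lambda>v. c * f v)"
  using hfun_mult[OF hfun_const, of d f c] by simp

lemma hfun_multc: "hfun d f \<Longrightarrow> hfun d (\<lambda>v. f v * c)"
  using hfun_mult[OF _ hfun_const, of d f c] by simp

lemma hfun_uminus: "hfun d f \<Longrightarrow> hfun d (\<lambda>v. - f v)"
  using hfun_cmult[of d f "-1"] by simp

lemma hfun_diff: "hfun d f \<Longrightarrow> hfun d g \<Longrightarrow> hfun d (\<lambda>v. f v - g v)"
  using hfun_add[of d f "\<lambda>v. - g v"] by (simp add: hfun_uminus)

lemma hfun_sum: "(\<And>a. a \<in> A \<Longrightarrow> hfun d (f a)) \<Longrightarrow> hfun d (\<lambda>v. \<Sum>a\<in>A. f a v)"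
  by (induction A rule: infinite_finite_induct) (simp_all add: hfun_zero hfun_add)

lemma hfun_prod: "(\<And>a. a \<in> A \<Longrightarrow> hfun (d a) (f a)) \<Longrightarrow> hfun (\<Sum>a\<in>A. d a) (\<lambda>v. \<Prod>a\<in>A. f a v)"
  by (induction A rule: infinite_finite_induct) (simp_all add: hfun_const hfun_mult)

lemma hfun_power: "hfun d f \<Longrightarrow> hfun (k * d) (\<lambda>v. f v ^ k)"
  by (induction k) (simp_all add: hfun_const hfun_mult)

lemma hfun_det:
  fixes M :: "'k::field^'n::finite \<Rightarrow> 'k^'m^'m::finite"
  assumes "\<And>i j. hfun d (\<lambda>v. M v $ i $ j)"
  shows "hfun (CARD('m) * d) (\<lambda>v. det (M v))"
  unfolding det_def
proof (intro hfun_sum hfun_cmult)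
  fix p
  show "hfun (CARD('m) * d) (\<lambda>v. \<Prod>i\<in>UNIV. M v $ i $ p i)"
    using hfun_prod[of UNIV "\<lambda>_. d" "\<lambda>i v. M v $ i $ p i"] assms by simp
qed

lemma hfun_scale: "hfun d f \<Longrightarrow> f (c *s v) = c ^ d * f v"
  by (auto simp: hfun_def peval_scale)

lemma hfun_at_0: "hfun d f \<Longrightarrow> d \<noteq> 0 \<Longrightarrow> f 0 = 0"
  using hfun_scale[of d f 0 0] by (simp add: power_0_left)

lemma hfun_degree_0: "hfun 0 f \<Longrightarrow> f v = f u"
  unfolding hfun_def using homogeneous_0D by metis

definition hmap :: "nat \<Rightarrow> ('k::field^'n::finite \<Rightarrow> 'k^'m) \<Rightarrow> bool" where
  "hmap d \<phi> \<longleftrightarrow> (\<forall>i. hfun d (\<lambda>v. \<phi> v $ i))"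

lemma hmapD: "hmap d \<phi> \<Longrightarrow> hfun d (\<lambda>v. \<phi> v $ i)"
  by (simp add: hmap_def)

lemma hmap_ident: "hmap 1 (\<lambda>v. v)"
  unfolding hmap_def using hfun_nth by blast

lemma hmap_scale: "hmap d \<phi> \<Longrightarrow> \<phi> (c *s v) = c ^ d *s \<phi> v"
  by (simp add: vec_eq_iff hfun_scale[OF hmapD])

lemma hfun_compose:
  assumes "hfun d g" "hmap e \<phi>"
  shows "hfun (d * e) (\<lambda>v. g (\<phi> v))"
proof -
  obtain F where F: "homogeneous d F" "g = peval F"
    using assms(1) by (auto simp: hfun_def)
  have "hfun (d * e) (\<lambda>v. Poly_Mapping.lookup F m * mon m (\<phi> v))" if "m \<in> Poly_Mapping.keys F" for m
  proof (rule hfun_cmult)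
    have "hfun (\<Sum>i\<in>UNIV. Poly_Mapping.lookup m i * e) (\<lambda>v. mon m (\<phi> v))"
      by (rule hfun_prod) (rule hfun_power[OF hmapD[OF assms(2)]])
    then show "hfun (d * e) (\<lambda>v. mon m (\<phi> v))"
      using F(1) that by (simp add: homogeneous_def sum_distrib_right[symmetric])
  qed
  then show ?thesis
    unfolding F(2) peval_def by (rule hfun_sum)
qed

lemma hmap_compose: "hmap d \<psi> \<Longrightarrow> hmap e \<phi> \<Longrightarrow> hmap (d * e) (\<lambda>v. \<psi> (\<phi> v))"
  unfolding hmap_def[of "d * e"] by (auto intro: hfun_compose hmapD)

lemma hfun_dotp_const: "hmap e \<psi> \<Longrightarrow> hfun e (\<lambda>v. dotp c (\<psi> v))"
  unfolding dotp_def by (intro hfun_sum hfun_cmult hmapD)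

lemma hmap_gradient: "homogeneous d F \<Longrightarrow> hmap (d - 1) (gradient F)"
  unfolding hmap_def gradient_def by (auto intro!: hfun_peval dest: homogeneous_pd)


text \<open>Derivatives without limits: a curve is a polynomial function of the parameter, with
  value \<open>a\<close> and formal derivative \<open>b\<close> at parameter 0.\<close>

definition jet :: "('k::field_char_0 \<Rightarrow> 'k) \<Rightarrow> 'k \<Rightarrow> 'k \<Rightarrow> bool" where
  "jet c a b \<longleftrightarrow> (\<exists>p. c = poly p \<and> poly p 0 = a \<and> poly (pderiv p) 0 = b)"

lemma jet_const: "jet (\<lambda>t. a) a 0"
  unfolding jet_def by (rule exI[of _ "[:a:]"]) auto

lemma jet_id: "jet (\<lambda>t. t) 0 1"
  unfolding jet_def by (rule exI[of _ "[:0, 1:]"]) (auto simp: pderiv_pCons)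

lemma jet_add: "jet c a b \<Longrightarrow> jet c' a' b' \<Longrightarrow> jet (\<lambda>t. c t + c' t) (a + a') (b + b')"
proof -
  assume "jet c a b" "jet c' a' b'"
  then obtain p q where "c = poly p" "poly p 0 = a" "poly (pderiv p) 0 = b"
    "c' = poly q" "poly q 0 = a'" "poly (pderiv q) 0 = b'"
    by (auto simp: jet_def)
  then show ?thesis
    unfolding jet_def by (intro exI[of _ "p + q"]) (auto simp: pderiv_add)
qed

lemma jet_mult: "jet c a b \<Longrightarrow> jet c' a' b' \<Longrightarrow> jet (\<lambda>t. c t * c' t) (a * a') (a * b' + b * a')"
proof -
  assume "jet c a b" "jet c' a' b'"
  then obtain p q where "c = poly p" "poly p 0 = a" "poly (pderiv p) 0 = b"
    "c' = poly q" "poly q 0 = a'" "poly (pderiv q) 0 = b'"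
    by (auto simp: jet_def)
  then show ?thesis
    unfolding jet_def by (intro exI[of _ "p * q"]) (auto simp: pderiv_mult mult_ac)
qed

lemma jet_sum: "(\<And>i. i \<in> A \<Longrightarrow> jet (c i) (a i) (b i)) \<Longrightarrow> jet (\<lambda>t. \<Sum>i\<in>A. c i t) (\<Sum>i\<in>A. a i) (\<Sum>i\<in>A. b i)"
proof (induction A rule: infinite_finite_induct)
  case (insert x A)
  then show ?case using jet_add[of "c x" "a x" "b x"] by simp
qed (use jet_const[of 0] in simp_all)

text \<open>In characteristic 0 a polynomial function determines its polynomial. This is what allows
  an identity along a curve to be differentiated.\<close>

lemma jet_zero:
  assumes "jet (\<lambda>t. 0) a b"
  shows "b = 0"
proof -
  obtain p where "(\<lambda>t. 0) = poly p" and b: "poly (pderiv p) 0 = b"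
    using assms by (auto simp: jet_def)
  then have "poly p = poly 0" by (metis poly_0 ext)
  then show ?thesis using b by (simp add: poly_eq_poly_eq_iff)
qed

lemma jet_unique: "jet c a b \<Longrightarrow> jet c a' b' \<Longrightarrow> b = b'"
proof -
  assume "jet c a b" "jet c a' b'"
  then have "jet (\<lambda>t. c t + - 1 * c t) (a + - 1 * a') (b + (- 1 * b' + 0 * a'))"
    using jet_add[OF _ jet_mult[OF jet_const[of "-1"]]] by blast
  then have "b + (- 1 * b' + 0 * a') = 0" by (intro jet_zero) simp
  then show ?thesis by simp
qed

definition vjet :: "('k::field_char_0 \<Rightarrow> 'k^'n) \<Rightarrow> 'k^'n \<Rightarrow> 'k^'n \<Rightarrow> bool" where
  "vjet c a b \<longleftrightarrow> (\<forall>i. jet (\<lambda>t. c t $ i) (a $ i) (b $ i))"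

lemma vjet_line: "vjet (\<lambda>t. v + t *s u) v u"
  unfolding vjet_def
proof
  fix i
  have "jet (\<lambda>t. v $ i + t * u $ i) (v $ i + 0 * u $ i) (0 + (0 * 0 + 1 * u $ i))"
    by (intro jet_add jet_mult jet_const jet_id)
  then show "jet (\<lambda>t. (v + t *s u) $ i) (v $ i) (u $ i)" by simp
qed

lemma vjet_zero: "vjet (\<lambda>t. 0) a b \<Longrightarrow> b = 0"
  unfolding vjet_def by (auto simp: vec_eq_iff dest: jet_zero)

lemma jet_dotp: "vjet c a b \<Longrightarrow> vjet c' a' b' \<Longrightarrow> jet (\<lambda>t. dotp (c t) (c' t)) (dotp a a') (dotp a b' + dotp b a')"
  unfolding dotp_def vjet_def sum.distrib[symmetric] by (intro jet_sum jet_mult) auto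

lemma jet_dotp_const: "vjet c a b \<Longrightarrow> jet (\<lambda>t. dotp u (c t)) (dotp u a) (dotp u b)"
  unfolding dotp_def vjet_def
  by (rule jet_sum) (use jet_mult[OF jet_const] in fastforce)

lemma jet_power: "jet c a b \<Longrightarrow> jet (\<lambda>t. c t ^ k) (a ^ k) (of_nat k * a ^ (k - 1) * b)"
proof (induction k)
  case 0
  then show ?case using jet_const[of 1] by simp
next
  case (Suc k)
  have "a * (of_nat k * a ^ (k - 1) * b) + b * a ^ k = of_nat (Suc k) * a ^ (Suc k - 1) * b"
    by (cases k) (simp_all add: algebra_simps)
  then show ?case
    using jet_mult[OF Suc.prems Suc.IH[OF Suc.prems]] by simp
qed

lemma jet_prod:
  "finite A \<Longrightarrow> (\<And>i. i \<in> A \<Longrightarrow> jet (c i) (a i) (b i)) \<Longrightarrow>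
    jet (\<lambda>t. \<Prod>i\<in>A. c i t) (\<Prod>i\<in>A. a i) (\<Sum>i\<in>A. (\<Prod>j\<in>A - {i}. a j) * b i)"
proof (induction A rule: finite_induct)
  case empty
  then show ?case using jet_const[of 1] by simp
next
  case (insert x A)
  have "(\<Sum>i\<in>A. (\<Prod>j\<in>insert x A - {i}. a j) * b i) = a x * (\<Sum>i\<in>A. (\<Prod>j\<in>A - {i}. a j) * b i)"
    unfolding sum_distrib_left
  proof (rule sum.cong[OF refl])
    fix i assume "i \<in> A"
    then have "insert x A - {i} = insert x (A - {i})" using insert.hyps by auto
    then show "(\<Prod>j\<in>insert x A - {i}. a j) * b i = a x * ((\<Prod>j\<in>A - {i}. a j) * b i)"
      using insert.hyps by (simp add: mult_ac)
  qed
  moreover have "insert x A - {x} = A" using insert.hyps by auto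
  moreover have "jet (\<lambda>t. c x t * (\<Prod>i\<in>A. c i t)) (a x * (\<Prod>i\<in>A. a i))
      (a x * (\<Sum>i\<in>A. (\<Prod>j\<in>A - {i}. a j) * b i) + b x * (\<Prod>i\<in>A. a i))"
    by (rule jet_mult) (use insert in auto)
  ultimately show ?case
    using insert.hyps by (simp add: algebra_simps)
qed

lemma peval_pd:
  "peval (pd i F) v = (\<Sum>m\<in>Poly_Mapping.keys F. Poly_Mapping.lookup F m *
     ((\<Prod>j\<in>UNIV - {i}. v $ j ^ Poly_Mapping.lookup m j) *
      (of_nat (Poly_Mapping.lookup m i) * v $ i ^ (Poly_Mapping.lookup m i - 1))))"
  unfolding pd_def peval_sum
proof (rule sum.cong[OF refl])
  fix m
  have "mon (m - Poly_Mapping.single i 1) v =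
      v $ i ^ (Poly_Mapping.lookup m i - 1) * (\<Prod>j\<in>UNIV - {i}. v $ j ^ Poly_Mapping.lookup m j)"
    by (subst prod.remove[of UNIV i]) (auto simp: lookup_minus lookup_single when_def intro!: prod.cong)
  then show "peval (Poly_Mapping.single (m - Poly_Mapping.single i 1)
        (of_nat (Poly_Mapping.lookup m i) * Poly_Mapping.lookup F m)) v =
      Poly_Mapping.lookup F m * ((\<Prod>j\<in>UNIV - {i}. v $ j ^ Poly_Mapping.lookup m j) *
      (of_nat (Poly_Mapping.lookup m i) * v $ i ^ (Poly_Mapping.lookup m i - 1)))"
    by (simp add: mult_ac)
qed

lemma jet_peval:
  assumes "vjet c a b"
  shows "jet (\<lambda>t. peval F (c t)) (peval F a) (dotp (gradient F a) b)"
proof -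
  let ?D = "\<lambda>m. \<Sum>i\<in>UNIV. (\<Prod>j\<in>UNIV - {i}. a $ j ^ Poly_Mapping.lookup m j) *
      (of_nat (Poly_Mapping.lookup m i) * a $ i ^ (Poly_Mapping.lookup m i - 1) * b $ i)"
  have "jet (\<lambda>t. peval F (c t)) (peval F a)
      (\<Sum>m\<in>Poly_Mapping.keys F. Poly_Mapping.lookup F m * ?D m + 0 * mon m a)"
    unfolding peval_def
    by (intro jet_sum jet_mult jet_const jet_prod jet_power)
       (use assms in \<open>auto simp: vjet_def\<close>)
  also have "(\<Sum>m\<in>Poly_Mapping.keys F. Poly_Mapping.lookup F m * ?D m + 0 * mon m a) =
      dotp (gradient F a) b"
    unfolding dotp_def gradient_def peval_pd
    by (simp add: sum_distrib_left sum_distrib_right mult_ac sum.swap[of _ UNIV])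
  finally show ?thesis .
qed

text \<open>The derivative of \<open>F\<close> along the curve \<open>v + t *s v\<close> is computed
  twice, by homogeneity and by the chain rule.\<close>

lemma euler:
  fixes F :: "('n::finite, 'k::field_char_0) mpoly"
  assumes "homogeneous d F"
  shows "dotp (gradient F v) v = of_nat d * peval F v"
proof -
  have "jet (\<lambda>t. (1 + t) ^ d * peval F v) ((1 + 0) ^ d * peval F v)
      ((1 + 0) ^ d * 0 + of_nat d * (1 + 0) ^ (d - 1) * (0 + 1) * peval F v)"
    by (intro jet_mult jet_power jet_add jet_const jet_id)
  moreover have "(1 + t) ^ d * peval F v = peval F (v + t *s v)" for t
    using peval_scale[OF assms, of "1 + t" v] by (simp add: vec.scale_left_distrib)
  ultimately have "jet (\<lambda>t. peval F (v + t *s v)) (peval F v) (of_nat d * peval F v)"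
    by simp
  then show ?thesis
    using jet_unique jet_peval[OF vjet_line] by blast
qed

text \<open>Only the existence of a derivative is recorded; the relations it satisfies are found
  later by differentiating identities.\<close>

lemma vjet_hmap:
  assumes "hmap d \<phi>" "vjet c a b"
  obtains b' where "vjet (\<lambda>t. \<phi> (c t)) (\<phi> a) b'"
proof -
  have "\<exists>b'. jet (\<lambda>t. \<phi> (c t) $ i) (\<phi> a $ i) b'" for i
  proof -
    obtain F where F: "(\<lambda>v. \<phi> v $ i) = peval F"
      using hmapD[OF assms(1), of i] by (auto simp: hfun_def)
    show ?thesis
      using jet_peval[OF assms(2), of F] by (auto simp: F[symmetric])
  qed
  then obtain b' where "\<And>i. jet (\<lambda>t. \<phi> (c t) $ i) (\<phi> a $ i) (b' i)" by metis
  then show ?thesis using that[of "\<chi> i. b' i"] by (simp add: vjet_def)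
qed

text \<open>Linear subspaces are irreducible, since a line over an infinite field is.\<close>

lemma hfun_prod_zero:
  fixes f g :: "'k::field_char_0^'n::finite \<Rightarrow> 'k"
  assumes "hfun d f" "hfun e g" "vec.subspace S" "\<forall>v\<in>S. f v * g v = 0"
  shows "(\<forall>v\<in>S. f v = 0) \<or> (\<forall>v\<in>S. g v = 0)"
proof (rule ccontr)
  assume "\<not> ?thesis"
  then obtain a b where ab: "a \<in> S" "b \<in> S" "f a \<noteq> 0" "g b \<noteq> 0" by blast
  obtain F G where "f = peval F" "g = peval G" using assms by (auto simp: hfun_def)
  then have "\<exists>x y. jet (\<lambda>t. f (a + t *s (b - a))) x y" "\<exists>x y. jet (\<lambda>t. g (a + t *s (b - a))) x y"
    using jet_peval[OF vjet_line] by blast+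
  then obtain p q where pq: "(\<lambda>t. f (a + t *s (b - a))) = poly p" "(\<lambda>t. g (a + t *s (b - a))) = poly q"
    by (auto simp: jet_def)
  have "poly (p * q) t = 0" for t
    using assms(4) ab vec.subspace_add[OF assms(3)] vec.subspace_diff[OF assms(3)] vec.subspace_scale[OF assms(3)]
    by (simp add: pq[symmetric] fun_cong[OF pq(1), symmetric] fun_cong[OF pq(2), symmetric])
  then have "p * q = 0" using poly_all_0_iff_0 by blast
  moreover have "poly p 0 \<noteq> 0" "poly q 1 \<noteq> 0"
    using ab by (simp_all add: fun_cong[OF pq(1), symmetric] fun_cong[OF pq(2), symmetric])
  ultimately show False by auto
qed

text \<open>Multiplication by \<open>\<delta>\<close> turns a condition on a nonempty open part of
  \<open>S\<close> into an identity on \<open>S\<close>, and irreducibility cancels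
  \<open>\<delta>\<close>. Arguments about general points end here.\<close>

lemma hfun_zero_generic:
  fixes f \<delta> :: "'k::field_char_0^'n::finite \<Rightarrow> 'k"
  assumes "hfun d f" "hfun e \<delta>" "vec.subspace S" "a \<in> S" "\<delta> a \<noteq> 0"
    and "\<And>v. v \<in> S \<Longrightarrow> \<delta> v \<noteq> 0 \<Longrightarrow> f v = 0" and "v \<in> S"
  shows "f v = 0"
proof -
  have "\<forall>v\<in>S. f v * \<delta> v = 0" using assms(6) by auto
  with hfun_prod_zero[OF assms(1,2,3)] assms(4,5,7) show ?thesis by blast
qed


section \<open>The Zariski topology\<close>

abbreviation pt :: "'k::field^'n::finite \<Rightarrow> ('k^'n) set" where
  "pt v \<equiv> vec.span {v}"

lemma pt_in_PN [simp]: "pt v \<in> PN \<longleftrightarrow> v \<noteq> 0"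
proof
  assume "pt v \<in> PN"
  then obtain u where "pt v = pt u" "u \<noteq> 0" by (auto simp: proj_pts_def)
  then have "u \<in> pt v" by (simp add: vec.span_base)
  then show "v \<noteq> 0" using \<open>u \<noteq> 0\<close> by (auto simp: vec.span_singleton)
qed (auto simp: proj_pts_def)

lemma PN_cases: "p \<in> PN \<Longrightarrow> (\<And>v. v \<noteq> 0 \<Longrightarrow> p = pt v \<Longrightarrow> thesis) \<Longrightarrow> thesis"
  by (auto simp: proj_pts_def)

lemma proj_pts_subset_PN: "proj_pts U \<subseteq> PN"
  by (auto simp: proj_pts_def)

lemma pt_scale: "c \<noteq> 0 \<Longrightarrow> pt (c *s v) = pt v"
  using vec.span_image_scale[of "{v}" "\<lambda>_. c"] by simp

lemma pt_memD: "u \<in> pt v \<Longrightarrow> u \<noteq> 0 \<Longrightarrow> pt u = pt v \<and> v \<noteq> 0 \<and> (\<exists>c. c \<noteq> 0 \<and> u = c *s v)"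
  by (auto simp: vec.span_singleton[of v] pt_scale)

lemma pt_in_proj_pts:
  assumes "vec.subspace U" "v \<noteq> 0"
  shows "pt v \<in> proj_pts U \<longleftrightarrow> v \<in> U"
proof
  assume "pt v \<in> proj_pts U"
  then obtain u where "pt v = pt u" "u \<in> U" by (auto simp: proj_pts_def)
  then have "v \<in> pt u" by (metis singletonI vec.span_base)
  then show "v \<in> U" using \<open>u \<in> U\<close> assms(1) by (auto simp: vec.span_singleton vec.subspace_scale)
qed (use assms in \<open>auto simp: proj_pts_def\<close>)

lemma vanishes_at_pt: "homogeneous d F \<Longrightarrow> vanishes_at F (pt v) \<longleftrightarrow> peval F v = 0"
  unfolding vanishes_at_def
proof
  assume "\<forall>v\<in>pt v. peval F v = 0"
  then show "peval F v = 0" by (simp add: vec.span_base)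
next
  assume "homogeneous d F" "peval F v = 0"
  then show "\<forall>v\<in>pt v. peval F v = 0"
    by (auto simp: vec.span_singleton peval_scale)
qed

lemma vanishes_at_mult:
  assumes "homogeneous d F" "homogeneous e G" "p \<in> PN"
  shows "vanishes_at (F * G) p \<longleftrightarrow> vanishes_at F p \<or> vanishes_at G p"
  using assms by (auto elim!: PN_cases simp: vanishes_at_pt homogeneous_mult[of d F e G]
    vanishes_at_pt[OF homogeneous_mult[of d F e G]])

lemma topspace_zariski [simp]: "topspace zariski = (PN :: ('k::field^'n::finite) set set)"
proof -
  have "homogeneous 0 (1 :: ('n, 'k) mpoly)"
    using homogeneous_const[of 1] by simp
  moreover have "hypersurface (1 :: ('n, 'k) mpoly) = {}"
    by (auto simp: hypersurface_def vanishes_at_pt[OF \<open>homogeneous 0 1\<close>] elim!: PN_cases)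
  ultimately have "PN \<in> {PN - hypersurface F |F. \<exists>d. homogeneous d (F :: ('n, 'k) mpoly)}"
    by (intro CollectI exI[of _ 1]) auto
  then show ?thesis
    unfolding zariski_def by (auto simp del: Collect_mem_eq)
qed

text \<open>The topology is generated from a subbasis; since a product of forms vanishes exactly
  where a factor does, the subbasic sets are stable under intersection and form a basis.\<close>

lemma openin_zariski:
  fixes U :: "('k::field^'n::finite) set set"
  shows "openin zariski U \<longleftrightarrow> U \<subseteq> PN \<and>
    (\<forall>p\<in>U. \<exists>F d. homogeneous d F \<and> \<not> vanishes_at F p \<and> (\<forall>q\<in>PN. \<not> vanishes_at F q \<longrightarrow> q \<in> U))"
    (is "_ \<longleftrightarrow> _ \<and> (\<forall>p\<in>U. ?Q U p)")
proof
  assume "openin zariski U"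
  then have "generate_topology_on {PN - hypersurface F |F. \<exists>d. homogeneous d (F :: ('n, 'k) mpoly)} U"
    unfolding zariski_def by (rule openin_topology_generated_by)
  then show "U \<subseteq> PN \<and> (\<forall>p\<in>U. ?Q U p)"
  proof induction
    case (Int a b)
    have "?Q (a \<inter> b) p" if p: "p \<in> a \<inter> b" for p
    proof -
      obtain F d G e where FG: "homogeneous d F" "\<not> vanishes_at F p" "\<forall>q\<in>PN. \<not> vanishes_at F q \<longrightarrow> q \<in> a"
        "homogeneous e G" "\<not> vanishes_at G p" "\<forall>q\<in>PN. \<not> vanishes_at G q \<longrightarrow> q \<in> b"
        using Int.IH p by blast
      have "p \<in> PN" using Int.IH p by blast
      then show ?thesis
        using FG by (intro exI[of _ "F * G"] exI[of _ "d + e"])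
          (auto simp: homogeneous_mult vanishes_at_mult[OF FG(1,4)])
    qed
    with Int.IH show ?case by blast
  next
    case (UN K)
    have "?Q (\<Union>K) p" if kp: "k \<in> K" "p \<in> k" for k p
    proof -
      obtain F d where "homogeneous d F" "\<not> vanishes_at F p" "\<forall>q\<in>PN. \<not> vanishes_at F q \<longrightarrow> q \<in> k"
        using UN.IH[OF kp(1)] kp(2) by blast
      then show ?thesis using kp(1) by (intro exI[of _ F] exI[of _ d]) auto
    qed
    moreover have "\<Union>K \<subseteq> PN" using UN.IH by blast
    ultimately show ?case by blast
  next
    case (Basis s)
    then show ?case by (auto simp: hypersurface_def)
  qed auto
next
  assume U: "U \<subseteq> PN \<and> (\<forall>p\<in>U. ?Q U p)"
  have "U = \<Union>{PN - hypersurface F |F. (\<exists>d. homogeneous d F) \<and> PN - hypersurface F \<subseteq> U}" (is "_ = \<Union>?S")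
  proof
    show "U \<subseteq> \<Union>?S"
    proof
      fix p assume p: "p \<in> U"
      then obtain F d where "homogeneous d F" "\<not> vanishes_at F p" "\<forall>q\<in>PN. \<not> vanishes_at F q \<longrightarrow> q \<in> U"
        using U by blast
      then show "p \<in> \<Union>?S"
        using p U by (intro UnionI[of "PN - hypersurface F"]) (auto simp: hypersurface_def)
    qed
  qed auto
  moreover have "openin zariski (\<Union>?S)"
    unfolding zariski_def by (rule openin_Union) (auto intro!: topology_generated_by_Basis)
  ultimately show "openin zariski U" by simp
qed

lemma openin_nonvanishing: "homogeneous d F \<Longrightarrow> openin zariski {p \<in> PN. \<not> vanishes_at F p}"
  unfolding openin_zariski by blast

lemma closedin_zariski:
  "closedin zariski C \<longleftrightarrow> C \<subseteq> PN \<and>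
    (\<forall>p\<in>PN - C. \<exists>F d. homogeneous d F \<and> (\<forall>q\<in>C. vanishes_at F q) \<and> \<not> vanishes_at F p)"
  unfolding closedin_def topspace_zariski openin_zariski by (safe; blast)

lemma in_closure_zariski:
  assumes "A \<subseteq> PN"
  shows "p \<in> zariski closure_of A \<longleftrightarrow> p \<in> PN \<and>
    (\<forall>F d. homogeneous d F \<and> (\<forall>a\<in>A. vanishes_at F a) \<longrightarrow> vanishes_at F p)"
proof
  assume p: "p \<in> zariski closure_of A"
  have "vanishes_at F p" if F: "homogeneous d F" "\<forall>a\<in>A. vanishes_at F a" for F d
  proof (rule ccontr)
    assume "\<not> vanishes_at F p"
    then have "p \<in> {p \<in> PN. \<not> vanishes_at F p}" using p by (simp add: in_closure_of)
    then obtain y where "y \<in> A" "y \<in> {p \<in> PN. \<not> vanishes_at F p}"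
      using p openin_nonvanishing[OF F(1)] unfolding in_closure_of by meson
    then show False using F(2) by blast
  qed
  then show "p \<in> PN \<and> (\<forall>F d. homogeneous d F \<and> (\<forall>a\<in>A. vanishes_at F a) \<longrightarrow> vanishes_at F p)"
    using p unfolding in_closure_of by auto
next
  assume p: "p \<in> PN \<and> (\<forall>F d. homogeneous d F \<and> (\<forall>a\<in>A. vanishes_at F a) \<longrightarrow> vanishes_at F p)"
  show "p \<in> zariski closure_of A"
    unfolding in_closure_of
  proof (intro conjI allI impI)
    show "p \<in> topspace zariski" using p by simp
    fix T assume T: "p \<in> T \<and> openin zariski T"
    then obtain F d where F: "homogeneous d F" "\<not> vanishes_at F p" "\<forall>q\<in>PN. \<not> vanishes_at F q \<longrightarrow> q \<in> T"
      unfolding openin_zariski by blast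
    then obtain a where "a \<in> A" "\<not> vanishes_at F a" using p by blast
    with F(3) assms show "\<exists>y. y \<in> A \<and> y \<in> T" by blast
  qed
qed

lemma closedin_hypersurface: "homogeneous d F \<Longrightarrow> closedin zariski (hypersurface F)"
  unfolding closedin_zariski hypersurface_def by blast

lemma irreducible_zariskiD:
  assumes "irreducible_set zariski C" "homogeneous d F" "homogeneous e G"
    and "\<forall>p\<in>C. vanishes_at F p \<or> vanishes_at G p"
  shows "(\<forall>p\<in>C. vanishes_at F p) \<or> (\<forall>p\<in>C. vanishes_at G p)"
proof -
  have "C \<subseteq> PN" using assms(1) by (simp add: irreducible_set_def)
  then have "C \<subseteq> hypersurface F \<union> hypersurface G"
    using assms(4) by (auto simp: hypersurface_def)
  then have "C \<subseteq> hypersurface F \<or> C \<subseteq> hypersurface G"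
    using assms(1) closedin_hypersurface[OF assms(2)] closedin_hypersurface[OF assms(3)]
    unfolding irreducible_set_def by blast
  then show ?thesis by (auto simp: hypersurface_def)
qed

text \<open>The closure of the projective image of the linear subspace \<open>S\<close> under a polynomial map.\<close>

definition image_closure :: "('k::field^'n::finite \<Rightarrow> 'k^'n) \<Rightarrow> ('k^'n) set \<Rightarrow> ('k^'n) set set" where
  "image_closure \<phi> S =
    {p \<in> PN. \<forall>F d. homogeneous d F \<and> (\<forall>s\<in>S. peval F (\<phi> s) = 0) \<longrightarrow> vanishes_at F p}"

lemma image_closure_subset_PN: "image_closure \<phi> S \<subseteq> PN"
  by (auto simp: image_closure_def)

lemma pt_in_image_closure: "s \<in> S \<Longrightarrow> \<phi> s \<noteq> 0 \<Longrightarrow> pt (\<phi> s) \<in> image_closure \<phi> S"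
  by (auto simp: image_closure_def vanishes_at_pt)

lemma image_closureD:
  "pt x \<in> image_closure \<phi> S \<Longrightarrow> homogeneous d F \<Longrightarrow> \<forall>s\<in>S. peval F (\<phi> s) = 0 \<Longrightarrow> peval F x = 0"
  by (auto simp: image_closure_def vanishes_at_pt)

lemma image_closure_hfun:
  "pt x \<in> image_closure \<phi> S \<Longrightarrow> hfun d f \<Longrightarrow> (\<And>s. s \<in> S \<Longrightarrow> f (\<phi> s) = 0) \<Longrightarrow> f x = 0"
  by (auto simp: hfun_def image_closureD)

lemma closedin_image_closure: "closedin zariski (image_closure \<phi> S)"
proof -
  have "\<exists>F d. homogeneous d F \<and> (\<forall>q\<in>image_closure \<phi> S. vanishes_at F q) \<and> \<not> vanishes_at F p"
    if p: "p \<in> PN - image_closure \<phi> S" for p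
  proof -
    obtain F d where "homogeneous d F" "\<forall>s\<in>S. peval F (\<phi> s) = 0" "\<not> vanishes_at F p"
      using p by (auto simp: image_closure_def)
    then show ?thesis
      by (intro exI[of _ F] exI[of _ d]) (auto simp: image_closure_def)
  qed
  then show ?thesis
    unfolding closedin_zariski using image_closure_subset_PN by blast
qed

lemma image_closure_mono: "S \<subseteq> T \<Longrightarrow> image_closure \<phi> S \<subseteq> image_closure \<phi> T"
  by (auto simp: image_closure_def)

text \<open>Closures of differently described sets are compared with one parametrized closure: it
  suffices that \<open>A\<close> lies in it and contains the values of \<open>\<phi>\<close> at
  general parameters.\<close>

lemma closure_eq_image_closure:
  fixes \<phi> :: "'k::field_char_0^'n::finite \<Rightarrow> 'k^'n"
  assumes \<phi>: "hmap e \<phi>" and S: "vec.subspace S" and \<delta>: "hfun d \<delta>" "s0 \<in> S" "\<delta> s0 \<noteq> 0" "\<phi> s0 \<noteq> 0"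
    and A: "A \<subseteq> image_closure \<phi> S"
    and dense: "\<And>s. s \<in> S \<Longrightarrow> \<delta> s \<noteq> 0 \<Longrightarrow> \<phi> s \<noteq> 0 \<Longrightarrow> pt (\<phi> s) \<in> A"
  shows "zariski closure_of A = image_closure \<phi> S"
proof
  have APN: "A \<subseteq> PN" using A image_closure_subset_PN by blast
  show "image_closure \<phi> S \<subseteq> zariski closure_of A"
  proof
    fix p assume p: "p \<in> image_closure \<phi> S"
    have "vanishes_at F p" if F: "homogeneous d' F" "\<forall>a\<in>A. vanishes_at F a" for F d'
    proof -
      have "peval F (\<phi> s) = 0" if "s \<in> S" for s
      proof (rule hfun_zero_generic[OF hfun_compose[OF hfun_peval[OF F(1)] \<phi>] \<delta>(1) S \<delta>(2,3)])
        fix v assume v: "v \<in> S" "\<delta> v \<noteq> 0"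
        have 1: "peval F (\<phi> v) = 0" if "v \<in> S" "\<delta> v \<noteq> 0" "\<phi> v \<noteq> 0" for v
          using F dense[OF that] by (auto simp: vanishes_at_pt)
        \<comment> \<open>Where \<open>\<phi>\<close> vanishes there is no point to test. A form of
          positive degree is 0 there; one of degree 0 is constant and can be read off at
          \<open>s0\<close>.\<close>
        show "peval F (\<phi> v) = 0"
        proof (cases "\<phi> v = 0 \<and> d' \<noteq> 0")
          case True
          then show ?thesis using hfun_at_0[OF hfun_peval[OF F(1)]] by simp
        next
          case False
          then show ?thesis
            using 1[OF v] 1[OF \<delta>(2-4)] hfun_degree_0[OF hfun_peval, of F "\<phi> v" "\<phi> s0"] F(1) by auto
        qed
      qed (use that in auto)
      then show ?thesis using p F(1) by (auto simp: image_closure_def)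
    qed
    then show "p \<in> zariski closure_of A"
      unfolding in_closure_zariski[OF APN] using p image_closure_subset_PN by blast
  qed
  show "zariski closure_of A \<subseteq> image_closure \<phi> S"
    using A closedin_image_closure by (rule closure_of_minimal)
qed

lemma irreducible_image_closure:
  fixes \<phi> :: "'k::field_char_0^'n::finite \<Rightarrow> 'k^'n"
  assumes \<phi>: "hmap e \<phi>" and S: "vec.subspace S" and s0: "s0 \<in> S" "\<phi> s0 \<noteq> 0"
  shows "irreducible_set zariski (image_closure \<phi> S)"
  unfolding irreducible_set_def
proof (intro conjI allI impI)
  show "image_closure \<phi> S \<subseteq> topspace zariski" by (simp add: image_closure_subset_PN)
  show "image_closure \<phi> S \<noteq> {}" using pt_in_image_closure s0 by blast
  fix A B assume AB: "closedin zariski A \<and> closedin zariski B \<and> image_closure \<phi> S \<subseteq> A \<union> B"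
  show "image_closure \<phi> S \<subseteq> A \<or> image_closure \<phi> S \<subseteq> B"
  proof (rule ccontr)
    assume "\<not> ?thesis"
    then obtain p q where p: "p \<in> image_closure \<phi> S" "p \<notin> A" and q: "q \<in> image_closure \<phi> S" "q \<notin> B"
      by blast
    obtain F d where F: "homogeneous d F" "\<forall>q\<in>A. vanishes_at F q" "\<not> vanishes_at F p"
      using AB p image_closure_subset_PN unfolding closedin_zariski by blast
    obtain G d' where G: "homogeneous d' G" "\<forall>q\<in>B. vanishes_at G q" "\<not> vanishes_at G q"
      using AB q image_closure_subset_PN unfolding closedin_zariski by blast
    have "peval F (\<phi> s) * peval G (\<phi> s) = 0" if "s \<in> S" "\<phi> s \<noteq> 0" for s
    proof -
      have "pt (\<phi> s) \<in> A \<union> B" using pt_in_image_closure[of s S \<phi>, OF that] AB by blast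
      then have "vanishes_at F (pt (\<phi> s)) \<or> vanishes_at G (pt (\<phi> s))" using F G by blast
      then show ?thesis by (simp add: vanishes_at_pt[OF F(1)] vanishes_at_pt[OF G(1)])
    qed
    note nonzero = this
    \<comment> \<open>A coordinate of \<open>\<phi>\<close> that is nonzero at \<open>s0\<close>
      serves as the form whose nonvanishing avoids the base points of \<open>\<phi>\<close>.\<close>
    obtain i where i: "\<phi> s0 $ i \<noteq> 0" using s0(2) by (auto simp: vec_eq_iff)
    have "peval F (\<phi> s) * peval G (\<phi> s) = 0" if s: "s \<in> S" for s
    proof (rule hfun_zero_generic[OF hfun_mult[OF hfun_compose[OF hfun_peval[OF F(1)] \<phi>]
          hfun_compose[OF hfun_peval[OF G(1)] \<phi>]] hmapD[OF \<phi>, of i] S s0(1) i _ s])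
      fix v assume v: "v \<in> S" "\<phi> v $ i \<noteq> 0"
      then have "\<phi> v \<noteq> 0" by auto
      then show "peval F (\<phi> v) * peval G (\<phi> v) = 0" by (rule nonzero[OF v(1)])
    qed
    then have "(\<forall>s\<in>S. peval F (\<phi> s) = 0) \<or> (\<forall>s\<in>S. peval G (\<phi> s) = 0)"
      by (intro hfun_prod_zero[OF hfun_compose[OF hfun_peval[OF F(1)] \<phi>]
          hfun_compose[OF hfun_peval[OF G(1)] \<phi>] S]) blast
    then show False using p q F G unfolding image_closure_def by blast
  qed
qed


section \<open>Dimension of parametrized varieties\<close>

text \<open>Irreducibility stated through forms on vectors, so that it covers both linear subspaces
  and the cones over irreducible closed sets.\<close>

definition hirreducible :: "('k::field^'n::finite) set \<Rightarrow> bool" where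
  "hirreducible D \<longleftrightarrow> (\<forall>d e f g. hfun d f \<and> hfun e g \<and> (\<forall>v\<in>D. f v * g v = 0) \<longrightarrow>
     (\<forall>v\<in>D. f v = 0) \<or> (\<forall>v\<in>D. g v = 0))"

lemma hirreducible_subspace: "vec.subspace (S :: ('k::field_char_0^'n::finite) set) \<Longrightarrow> hirreducible S"
  unfolding hirreducible_def using hfun_prod_zero by blast

lemma hirreducible_cone:
  assumes "irreducible_set zariski C"
  shows "hirreducible {v. v \<noteq> 0 \<and> pt v \<in> C}"
  unfolding hirreducible_def
proof (intro allI impI)
  fix d e f g assume fg: "hfun d f \<and> hfun e g \<and> (\<forall>v\<in>{v. v \<noteq> 0 \<and> pt v \<in> C}. f v * g v = 0)"
  then obtain F G where FG: "homogeneous d F" "f = peval F" "homogeneous e G" "g = peval G"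
    by (auto simp: hfun_def)
  have CPN: "C \<subseteq> PN" using assms by (simp add: irreducible_set_def)
  have "\<forall>p\<in>C. vanishes_at F p \<or> vanishes_at G p"
  proof
    fix p assume p: "p \<in> C"
    with CPN obtain v where "v \<noteq> 0" "p = pt v" by (metis PN_cases subsetD)
    then show "vanishes_at F p \<or> vanishes_at G p"
      using p fg FG by (auto simp: vanishes_at_pt[OF FG(1)] vanishes_at_pt[OF FG(3)])
  qed
  then have "(\<forall>p\<in>C. vanishes_at F p) \<or> (\<forall>p\<in>C. vanishes_at G p)"
    using irreducible_zariskiD[OF assms FG(1,3)] by blast
  then show "(\<forall>v\<in>{v. v \<noteq> 0 \<and> pt v \<in> C}. f v = 0) \<or> (\<forall>v\<in>{v. v \<noteq> 0 \<and> pt v \<in> C}. g v = 0)"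
    using FG by (auto simp: vanishes_at_pt[OF FG(1)] vanishes_at_pt[OF FG(3)])
qed

text \<open>
  Forms that separate the members of a chain of irreducible sets are algebraically independent
  on its top member: setting the last form to zero restricts a relation to the previous member.
\<close>

lemma chain_monomials_independent:
  fixes F :: "nat \<Rightarrow> 'k::field_char_0^'n::finite \<Rightarrow> 'k"
  assumes "\<And>i. i \<le> d \<Longrightarrow> hfun e (F i)" "\<And>i. i \<le> d \<Longrightarrow> hirreducible (D i)"
    and "\<And>i. i \<le> d \<Longrightarrow> \<exists>v\<in>D i. F i v \<noteq> 0" "\<And>i. i < d \<Longrightarrow> \<forall>v\<in>D i. F (Suc i) v = 0"
    and "\<And>i. i < d \<Longrightarrow> D i \<subseteq> D (Suc i)"
    and "finite E" "\<And>a. a \<in> E \<Longrightarrow> (\<forall>i>d. a i = 0) \<and> (\<Sum>i\<le>d. a i) = t"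
    and "\<And>v. v \<in> D d \<Longrightarrow> (\<Sum>a\<in>E. c a * (\<Prod>i\<le>d. F i v ^ a i)) = 0" and "a \<in> E"
  shows "c a = 0"
  using assms
proof (induction d arbitrary: t E c a)
  case 0
  obtain v where v: "v \<in> D 0" "F 0 v \<noteq> 0" using "0.prems"(3) by blast
  have "b = a" if "b \<in> E" for b
  proof
    fix i
    have "b 0 = t" "a 0 = t" "0 < i \<Longrightarrow> b i = 0" "0 < i \<Longrightarrow> a i = 0"
      using "0.prems"(7)[OF that] "0.prems"(7)[OF "0.prems"(9)] by simp_all
    then show "b i = a i" by (cases "i = 0") simp_all
  qed
  then have "E = {a}" using "0.prems"(9) by blast
  then show ?case using "0.prems"(8)[OF v(1)] v(2) by simp
next
  case (Suc d)
  note chain = Suc.prems(1-5)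
  from Suc.prems(6-9) show ?case
  \<comment> \<open>Inner induction on the degree: once the terms free of the last form are gone,
    that form factors out and the degree drops.\<close>
  proof (induction t arbitrary: E c a rule: less_induct)
    case (less t)
    let ?E0 = "{b \<in> E. b (Suc d) = 0}" and ?E1 = "{b \<in> E. b (Suc d) \<noteq> 0}"
    have split: "(\<Sum>b\<in>E. c b * (\<Prod>i\<le>Suc d. F i v ^ b i)) =
        (\<Sum>b\<in>?E0. c b * (\<Prod>i\<le>d. F i v ^ b i)) + (\<Sum>b\<in>?E1. c b * (\<Prod>i\<le>Suc d. F i v ^ b i))" for v
    proof -
      have "(\<Sum>b\<in>E. c b * (\<Prod>i\<le>Suc d. F i v ^ b i)) =
        (\<Sum>b\<in>?E0. c b * (\<Prod>i\<le>Suc d. F i v ^ b i)) + (\<Sum>b\<in>?E1. c b * (\<Prod>i\<le>Suc d. F i v ^ b i))"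
        using less.prems(1) by (subst sum.union_disjoint[symmetric]) (auto intro!: sum.cong)
      then show ?thesis by simp
    qed
    \<comment> \<open>On \<open>D d\<close> the last form is 0, so only the terms without it survive
      and the outer induction hypothesis applies to them.\<close>
    have E0: "c b = 0" if "b \<in> ?E0" for b
    proof (rule Suc.IH[of ?E0 t c b])
      fix v assume v: "v \<in> D d"
      then have "F (Suc d) v = 0" "v \<in> D (Suc d)" using chain(4,5)[of d] by auto
      moreover have "(\<Sum>b\<in>?E1. c b * (\<Prod>i\<le>Suc d. F i v ^ b i)) = 0"
        using \<open>F (Suc d) v = 0\<close> by (intro sum.neutral) (auto simp: power_0_left)
      ultimately show "(\<Sum>b\<in>?E0. c b * (\<Prod>i\<le>d. F i v ^ b i)) = 0"
        using less.prems(3)[of v] split[of v] by simp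
    next
      fix b assume b: "b \<in> ?E0"
      then have b: "\<forall>i>Suc d. b i = 0" "(\<Sum>i\<le>Suc d. b i) = t" "b (Suc d) = 0"
        using less.prems(2)[of b] by simp_all
      have "b i = 0" if "i > d" for i
        using that b by (cases "i = Suc d") auto
      then show "(\<forall>i>d. b i = 0) \<and> (\<Sum>i\<le>d. b i) = t" using b by simp
    qed (use chain less.prems(1) that in auto)
    show ?case
    proof (cases "a (Suc d) = 0")
      case True
      then show ?thesis using E0 less.prems(4) by auto
    next
      case False
      \<comment> \<open>\<open>dn\<close> removes one factor of the last form from a monomial and
        \<open>up\<close> restores it; irreducibility of \<open>D (Suc d)\<close> then cancels the
        extracted factor.\<close>
      define up where "up = (\<lambda>b::nat\<Rightarrow>nat. b(Suc d := Suc (b (Suc d))))"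
      define dn where "dn = (\<lambda>b::nat\<Rightarrow>nat. b(Suc d := b (Suc d) - 1))"
      have up_dn: "up (dn b) = b" if "b (Suc d) \<noteq> 0" for b
        using that by (auto simp: up_def dn_def)
      have dn_up: "dn (up b) = b" for b by (auto simp: up_def dn_def)
      let ?E' = "dn ` ?E1"
      have reindex: "(\<Sum>b\<in>?E1. c b * (\<Prod>i\<le>Suc d. F i v ^ b i)) =
          F (Suc d) v * (\<Sum>b\<in>?E'. c (up b) * (\<Prod>i\<le>Suc d. F i v ^ b i))" for v
      proof -
        have "inj_on dn ?E1" by (rule inj_on_inverseI[of _ up]) (simp add: up_dn)
        then have A: "(\<Sum>b\<in>?E'. c (up b) * (\<Prod>i\<le>Suc d. F i v ^ b i)) =
          (\<Sum>b\<in>?E1. c b * (\<Prod>i\<le>Suc d. F i v ^ dn b i))"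
          by (subst sum.reindex) (auto simp: up_dn)
        have B: "(\<Prod>i\<le>Suc d. F i v ^ b i) = F (Suc d) v * (\<Prod>i\<le>Suc d. F i v ^ dn b i)"
          if "b \<in> ?E1" for b
        proof -
          have "(\<Prod>i\<le>d. F i v ^ dn b i) = (\<Prod>i\<le>d. F i v ^ b i)"
            by (rule prod.cong) (auto simp: dn_def)
          moreover have "F (Suc d) v ^ b (Suc d) = F (Suc d) v * F (Suc d) v ^ dn b (Suc d)"
            using that by (cases "b (Suc d)") (auto simp: dn_def)
          ultimately show ?thesis by (simp add: mult_ac)
        qed
        show ?thesis
          unfolding A sum_distrib_left
        proof (rule sum.cong[OF refl])
          fix b assume "b \<in> ?E1"
          show "c b * (\<Prod>i\<le>Suc d. F i v ^ b i) = F (Suc d) v * (c b * (\<Prod>i\<le>Suc d. F i v ^ dn b i))"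
            unfolding B[OF \<open>b \<in> ?E1\<close>] by (rule mult.left_commute)
        qed
      qed
      have dn_sum: "(\<forall>i>Suc d. dn b i = 0) \<and> (\<Sum>i\<le>Suc d. dn b i) = t - 1 \<and> t > 0" if "b \<in> ?E1" for b
      proof -
        have "(\<Sum>i\<le>d. dn b i) = (\<Sum>i\<le>d. b i)" by (rule sum.cong) (auto simp: dn_def)
        then show ?thesis using less.prems(2)[of b] that by (auto simp: dn_def)
      qed
      let ?g = "\<lambda>v. \<Sum>b\<in>?E'. c (up b) * (\<Prod>i\<le>Suc d. F i v ^ b i)"
      have "hfun ((t - 1) * e) ?g"
      proof (intro hfun_sum hfun_cmult)
        fix b assume "b \<in> ?E'"
        then have "(\<Sum>i\<le>Suc d. b i) = t - 1" using dn_sum by blast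
        moreover have "hfun (\<Sum>i\<le>Suc d. b i * e) (\<lambda>v. \<Prod>i\<le>Suc d. F i v ^ b i)"
          by (intro hfun_prod hfun_power chain(1)) simp
        ultimately show "hfun ((t - 1) * e) (\<lambda>v. \<Prod>i\<le>Suc d. F i v ^ b i)"
          by (simp only: sum_distrib_right[symmetric])
      qed
      moreover have "\<forall>v\<in>D (Suc d). F (Suc d) v * ?g v = 0"
        using less.prems(3) split reindex E0 by simp
      ultimately have "(\<forall>v\<in>D (Suc d). F (Suc d) v = 0) \<or> (\<forall>v\<in>D (Suc d). ?g v = 0)"
        using chain(1,2)[of "Suc d"] unfolding hirreducible_def by blast
      then have g0: "?g v = 0" if "v \<in> D (Suc d)" for v using chain(3)[of "Suc d"] that by auto
      have aE1: "a \<in> ?E1" using False less.prems(4) by simp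
      have "c (up (dn a)) = 0"
      proof (rule less.IH[of "t - 1" ?E' "\<lambda>b. c (up b)"])
        show "t - 1 < t" using dn_sum[OF aE1] by simp
      qed (use g0 dn_sum aE1 less.prems(1) in auto)
      then show ?thesis using up_dn False by simp
    qed
  qed
qed


section \<open>Algebraic dependence by counting monomials\<close>

interpretation fun_space: vector_space "\<lambda>(c::'k::field) (f::'a \<Rightarrow> 'k) x. c * f x"
  by unfold_locales (auto simp: fun_eq_iff algebra_simps)

lemma fun_sum_apply: "(\<Sum>a\<in>A. f a) x = (\<Sum>a\<in>A. f a x)" for f :: "'a \<Rightarrow> 'b \<Rightarrow> 'c::comm_monoid_add"
  by (induction A rule: infinite_finite_induct) simp_all

text \<open>The family is indexed because equal members must count as dependent: if \<open>g\<close>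
  is not injective on \<open>E\<close>, the difference of two equal members is already a
  relation.\<close>

lemma (in vector_space) linear_relation_exists:
  assumes "finite E" "finite B" "g ` E \<subseteq> span B" "card B < card E"
  obtains c where "\<exists>a\<in>E. c a \<noteq> 0" "(\<Sum>a\<in>E. scale (c a) (g a)) = 0"
proof (cases "inj_on g E")
  case True
  have "dependent (g ` E)"
    using independent_span_bound[OF assms(2) _ assms(3)] card_image[OF True] assms(4) by auto
  then obtain u where u: "\<exists>v\<in>g ` E. u v \<noteq> 0" "(\<Sum>v\<in>g ` E. scale (u v) v) = 0"
    using dependent_finite[of "g ` E"] assms(1) by auto
  show ?thesis
  proof (rule that[of "\<lambda>a. u (g a)"])
    show "\<exists>a\<in>E. u (g a) \<noteq> 0" using u(1) by auto
    show "(\<Sum>a\<in>E. scale (u (g a)) (g a)) = 0" using u(2) by (simp add: sum.reindex[OF True])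
  qed
next
  case False
  then obtain a b where ab: "a \<in> E" "b \<in> E" "a \<noteq> b" "g a = g b" by (auto simp: inj_on_def)
  let ?c = "\<lambda>x. if x = a then (1::'a) else if x = b then - 1 else 0"
  have "(\<Sum>x\<in>E. scale (?c x) (g x)) = (\<Sum>x\<in>{a, b}. scale (?c x) (g x))"
    by (rule sum.mono_neutral_right) (use assms(1) ab in auto)
  moreover have "\<exists>x\<in>E. ?c x \<noteq> 0" by (rule bexI[of _ a]) (use ab in auto)
  ultimately show ?thesis using ab by (intro that[of ?c]) auto
qed

text \<open>Exponents beyond \<open>r\<close> are required to be 0 so that each monomial comes from
  one of finitely many exponent vectors.\<close>

definition monomials :: "nat \<Rightarrow> nat \<Rightarrow> ((nat \<Rightarrow> 'k::field) \<Rightarrow> 'k) set" where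
  "monomials r D = (\<lambda>\<beta> y. \<Prod>i<r. y i ^ \<beta> i) ` {\<beta>. (\<forall>i\<ge>r. \<beta> i = 0) \<and> (\<Sum>i<r. \<beta> i) = D}"

text \<open>The last exponent is determined by the others, each of which is at most
  \<open>D\<close>. The crude bound suffices, since only the order of growth in \<open>D\<close>
  matters.\<close>

lemma card_monomials:
  assumes "r > 0"
  shows "finite (monomials r D)" "card (monomials r D) \<le> (D + 1) ^ (r - 1)"
proof -
  let ?A = "{\<beta>::nat\<Rightarrow>nat. (\<forall>i\<ge>r. \<beta> i = 0) \<and> (\<Sum>i<r. \<beta> i) = D}"
  let ?P = "PiE {..<r - 1} (\<lambda>_. {..D})"
  let ?h = "\<lambda>\<beta>::nat\<Rightarrow>nat. restrict \<beta> {..<r - 1}"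
  obtain q where q: "r = Suc q" using assms by (cases r) auto
  have inj: "inj_on ?h ?A"
  proof (rule inj_onI)
    fix \<beta> \<gamma> assume bg: "\<beta> \<in> ?A" "\<gamma> \<in> ?A" "?h \<beta> = ?h \<gamma>"
    then have eq: "\<beta> i = \<gamma> i" if "i < q" for i
    proof -
      have "?h \<beta> i = ?h \<gamma> i" using bg(3) by simp
      then show ?thesis using that q by simp
    qed
    then have "(\<Sum>i<q. \<beta> i) = (\<Sum>i<q. \<gamma> i)" by simp
    then have "\<beta> q = \<gamma> q" using bg(1,2) q by auto
    show "\<beta> = \<gamma>"
    proof
      fix i show "\<beta> i = \<gamma> i"
        using eq[of i] \<open>\<beta> q = \<gamma> q\<close> bg(1,2) q by (cases i q rule: linorder_cases) auto
    qed
  qed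
  have sub: "?h ` ?A \<subseteq> ?P"
  proof -
    have "\<beta> i \<le> D" if "\<beta> \<in> ?A" "i < r - 1" for \<beta> i
      using that member_le_sum[of i "{..<r}" \<beta>] by auto
    then show ?thesis by (auto simp: PiE_def)
  qed
  have fin: "finite ?A"
    using inj sub by (meson finite_PiE finite_atMost finite_imageD finite_lessThan finite_subset)
  then show "finite (monomials r D)" unfolding monomials_def by simp
  have "card (monomials r D) \<le> card ?A"
    unfolding monomials_def by (rule card_image_le[OF fin])
  also have "\<dots> \<le> card ?P"
    using card_inj_on_le[OF inj sub] by (simp add: finite_PiE)
  also have "\<dots> = (D + 1) ^ (r - 1)" by (simp add: card_PiE)
  finally show "card (monomials r D) \<le> (D + 1) ^ (r - 1)" .
qed

abbreviation form_on :: "nat \<Rightarrow> nat \<Rightarrow> ((nat \<Rightarrow> 'k::field) \<Rightarrow> 'k) \<Rightarrow> bool" where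
  "form_on r D f \<equiv> f \<in> fun_space.span (monomials r D)"

lemma form_on_mult:
  assumes "form_on r D f" "form_on r D' g"
  shows "form_on r (D + D') (\<lambda>y. f y * g y)"
proof -
  have mono: "form_on r (D + D') (\<lambda>y. f y * g y)"
    if fg: "f \<in> monomials r D" "g \<in> monomials r D'" for f g :: "(nat \<Rightarrow> 'a) \<Rightarrow> 'a"
  proof (rule fun_space.span_base)
    obtain \<beta> \<gamma> where "f = (\<lambda>y. \<Prod>i<r. y i ^ \<beta> i)" "\<forall>i\<ge>r. \<beta> i = 0" "(\<Sum>i<r. \<beta> i) = D"
      "g = (\<lambda>y. \<Prod>i<r. y i ^ \<gamma> i)" "\<forall>i\<ge>r. \<gamma> i = 0" "(\<Sum>i<r. \<gamma> i) = D'"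
      using fg unfolding monomials_def by blast
    then show "(\<lambda>y. f y * g y) \<in> monomials r (D + D')"
      unfolding monomials_def
      by (intro image_eqI[of _ _ "\<lambda>i. \<beta> i + \<gamma> i"]) (auto simp: power_add prod.distrib sum.distrib)
  qed
  have left: "form_on r (D + D') (\<lambda>y. f y * g y)" if "g \<in> monomials r D'" for g
    using assms(1)
  proof (induction rule: fun_space.span_induct_alt)
    case base
    then show ?case using fun_space.span_zero by (simp add: zero_fun_def)
  next
    case (step c x y)
    then show ?case
      using fun_space.span_add[OF fun_space.span_scale[OF mono[OF step(1) that], of c] step(2)]
      by (simp add: algebra_simps plus_fun_def)
  qed
  show ?thesis
    using assms(2)
  proof (induction rule: fun_space.span_induct_alt)
    case base
    then show ?case using fun_space.span_zero by (simp add: zero_fun_def)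
  next
    case (step c x y)
    then show ?case
      using fun_space.span_add[OF fun_space.span_scale[OF left[OF step(1)], of c] step(2)]
      by (simp add: algebra_simps plus_fun_def)
  qed
qed

lemma form_on_sum: "(\<And>a. a \<in> A \<Longrightarrow> form_on r D (f a)) \<Longrightarrow> form_on r D (\<lambda>y. \<Sum>a\<in>A. f a y)"
  using fun_space.span_sum[of A f "monomials r D"] by (simp add: fun_sum_apply[abs_def])

lemma form_on_cmult: "form_on r D f \<Longrightarrow> form_on r D (\<lambda>y. c * f y)"
  by (rule fun_space.span_scale)

lemma form_on_1: "form_on r 0 (\<lambda>y. 1)"
  by (rule fun_space.span_base) (auto simp: monomials_def image_iff intro!: exI[of _ "\<lambda>_. 0"])

lemma form_on_power: "form_on r D f \<Longrightarrow> form_on r (k * D) (\<lambda>y. f y ^ k)"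
  by (induction k) (simp_all add: form_on_1 form_on_mult)

lemma form_on_prod:
  "(\<And>a. a \<in> A \<Longrightarrow> form_on r (D a) (f a)) \<Longrightarrow> form_on r (\<Sum>a\<in>A. D a) (\<lambda>y. \<Prod>a\<in>A. f a y)"
  by (induction A rule: infinite_finite_induct) (simp_all add: form_on_1 form_on_mult)

lemma form_on_nth:
  assumes "i < r"
  shows "form_on r 1 (\<lambda>y. y i)"
proof (rule fun_space.span_base)
  have "(\<Prod>j<r. y j ^ (if j = i then 1 else 0)) = y i" for y :: "nat \<Rightarrow> 'a"
    using assms by (subst prod.remove[of _ i]) (auto intro!: prod.neutral)
  then have "(\<lambda>y::nat \<Rightarrow> 'a. y i) = (\<lambda>y. \<Prod>j<r. y j ^ (if j = i then 1 else 0))" by (intro ext) (rule sym)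
  then show "(\<lambda>y::nat \<Rightarrow> 'a. y i) \<in> monomials r 1"
    unfolding monomials_def using assms
    by (intro image_eqI[of _ _ "\<lambda>j. if j = i then 1 else 0"]) auto
qed

lemma form_on_hfun:
  assumes "hfun d g"
  shows "form_on r d (\<lambda>y. g (\<Sum>i<r. y i *s b i))"
proof -
  obtain F where F: "homogeneous d F" "g = peval F" using assms by (auto simp: hfun_def)
  show ?thesis
    unfolding F(2) peval_def
  proof (intro form_on_sum form_on_cmult)
    fix m assume "m \<in> Poly_Mapping.keys F"
    then have d: "(\<Sum>j\<in>UNIV. Poly_Mapping.lookup m j * 1) = d" using F(1) by (simp add: homogeneous_def)
    have lin: "form_on r 1 (\<lambda>y. \<Sum>i<r. b i $ j * y i)" for j
      by (intro form_on_sum form_on_cmult form_on_nth) simp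
    have "form_on r (\<Sum>j\<in>UNIV. Poly_Mapping.lookup m j * 1)
        (\<lambda>y. \<Prod>j\<in>UNIV. (\<Sum>i<r. b i $ j * y i) ^ Poly_Mapping.lookup m j)"
      by (intro form_on_prod form_on_power lin)
    then show "form_on r d (\<lambda>y. mon m (\<Sum>i<r. y i *s b i))"
      unfolding d by (simp add: mult.commute)
  qed
qed

lemma subspace_coordinates:
  fixes S :: "('k::field^'n::finite) set"
  assumes "vec.subspace S"
  obtains b where "S = range (\<lambda>y. \<Sum>i<vec.dim S. y i *s b i)"
proof -
  obtain B where B: "B \<subseteq> S" "vec.independent B" "S \<subseteq> vec.span B" "card B = vec.dim S"
    using vec.basis_exists[of S] by blast
  then have fin: "finite B" using vec.finiteI_independent by blast
  obtain b where b: "bij_betw b {0..<card B} B" using ex_bij_betw_nat_finite[OF fin] by blast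
  have S: "S = vec.span B" using B assms by (metis vec.span_minimal subset_antisym)
  have "vec.span B = range (\<lambda>u. \<Sum>v\<in>B. u v *s v)" by (rule vec.span_finite[OF fin])
  also have "\<dots> = range (\<lambda>y. \<Sum>i<card B. y i *s b i)"
  proof -
    have 1: "(\<Sum>v\<in>B. u v *s v) = (\<Sum>i<card B. (u \<circ> b) i *s b i)" for u :: "'k^'n \<Rightarrow> 'k"
      using sum.reindex_bij_betw[OF b, of "\<lambda>v. u v *s v"] by (simp add: atLeast0LessThan)
    have 2: "(\<Sum>i<card B. y i *s b i) = (\<Sum>v\<in>B. y (the_inv_into {0..<card B} b v) *s v)" for y :: "nat \<Rightarrow> 'k"
      using sum.reindex_bij_betw[OF b, of "\<lambda>v. y (the_inv_into {0..<card B} b v) *s v"] b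
      by (simp add: atLeast0LessThan the_inv_into_f_f bij_betw_def)
    show ?thesis
    proof (intro subset_antisym image_subsetI)
      show "(\<Sum>v\<in>B. u v *s v) \<in> range (\<lambda>y. \<Sum>i<card B. y i *s b i)" for u
        unfolding 1 by (rule rangeI)
      show "(\<Sum>i<card B. y i *s b i) \<in> range (\<lambda>u. \<Sum>v\<in>B. u v *s v)" for y
        unfolding 2 by (rule rangeI)
    qed
  qed
  finally have "S = range (\<lambda>y. \<Sum>i<vec.dim S. y i *s b i)" by (simp only: S[symmetric] B(4))
  then show ?thesis by (rule that)
qed

text \<open>
  More than \<open>r\<close> forms on an \<open>r\<close>-dimensional space are algebraically dependent, because the number
  of monomials in them grows faster than the dimension of the space of forms.
\<close>

lemma forms_dependent:
  fixes \<Phi> :: "nat \<Rightarrow> 'k::field^'n::finite \<Rightarrow> 'k"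
  assumes S: "vec.subspace S" "vec.dim S = r" "r > 0" and \<Phi>: "\<And>i. i \<le> r \<Longrightarrow> hfun e (\<Phi> i)"
  obtains E t c where "finite E" "\<And>a. a \<in> E \<Longrightarrow> (\<forall>i>r. a i = 0) \<and> (\<Sum>i\<le>r. a i) = t"
    "\<exists>a\<in>E. c a \<noteq> 0" "\<And>s. s \<in> S \<Longrightarrow> (\<Sum>a\<in>E. c a * (\<Prod>i\<le>r. \<Phi> i s ^ a i)) = 0"
proof -
  \<comment> \<open>The first \<open>r\<close> exponents range freely below \<open>m\<close>, and
    \<open>ex\<close> fills up the last one to total degree \<open>r * m\<close>, giving
    \<open>m ^ r\<close> products. They live among forms of degree \<open>e * r * m\<close>, where
    at most \<open>((e * r + 1) * m) ^ (r - 1)\<close> monomials exist; the choice of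
    \<open>m\<close> makes this smaller than \<open>m ^ r\<close>.\<close>
  define m where "m = (e * r + 1) ^ (r - 1) + 1"
  define ex where "ex = (\<lambda>(h::nat\<Rightarrow>nat) i. if i < r then h i else if i = r then r * m - (\<Sum>i<r. h i) else 0)"
  define P where "P = PiE {..<r} (\<lambda>_. {..<m})"
  define E where "E = ex ` P"
  have finP: "finite P" by (simp add: P_def finite_PiE)
  have "inj_on ex P"
  proof (rule inj_onI)
    fix h h' assume h: "h \<in> P" "h' \<in> P" "ex h = ex h'"
    show "h = h'"
    proof (rule PiE_ext)
      show "h \<in> PiE {..<r} (\<lambda>_. {..<m})" "h' \<in> PiE {..<r} (\<lambda>_. {..<m})" using h by (simp_all add: P_def)
      fix i assume "i \<in> {..<r}"
      then show "h i = h' i" using fun_cong[OF h(3), of i] by (simp add: ex_def)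
    qed
  qed
  then have cardE: "card E = m ^ r"
    by (simp add: E_def card_image P_def card_PiE)
  have E: "(\<forall>i>r. a i = 0) \<and> (\<Sum>i\<le>r. a i) = r * m" if aE: "a \<in> E" for a
  proof -
    obtain h where h: "h \<in> P" "a = ex h" using aE by (auto simp: E_def)
    have "(\<Sum>i<r. h i) \<le> (\<Sum>i<r. m)"
      using h(1) by (intro sum_mono) (auto simp: P_def PiE_def Pi_def less_imp_le)
    then have le: "(\<Sum>i<r. h i) \<le> r * m" by simp
    have "(\<Sum>i\<le>r. a i) = (\<Sum>i<r. a i) + a r" by (simp add: lessThan_Suc_atMost[symmetric])
    also have "(\<Sum>i<r. a i) = (\<Sum>i<r. h i)" by (rule sum.cong) (auto simp: h ex_def)
    also have "a r = r * m - (\<Sum>i<r. h i)" by (simp add: h ex_def)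
    finally show ?thesis using le by (simp add: h ex_def)
  qed
  obtain b where b: "S = range (\<lambda>y. \<Sum>i<r. y i *s b i)"
    by (rule subspace_coordinates[OF S(1), unfolded S(2)])
  define g where "g = (\<lambda>a (y::nat \<Rightarrow> 'k). \<Prod>i\<le>r. \<Phi> i (\<Sum>i<r. y i *s b i) ^ a i)"
  let ?D = "e * r * m"
  have formg: "form_on r ?D (g a)" if "a \<in> E" for a
  proof -
    have "form_on r (\<Sum>i\<le>r. a i * e) (g a)"
      unfolding g_def by (intro form_on_prod form_on_power form_on_hfun \<Phi>) simp
    moreover have "(\<Sum>i\<le>r. a i * e) = ?D" using E[OF that] by (simp add: sum_distrib_right[symmetric])
    ultimately show ?thesis by simp
  qed
  have small: "card (monomials r ?D :: ((nat \<Rightarrow> 'k) \<Rightarrow> 'k) set) < card E"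
  proof -
    obtain q where q: "r = Suc q" using S(3) by (cases r) auto
    have "m \<ge> 1" by (simp add: m_def)
    have "card (monomials r ?D :: ((nat \<Rightarrow> 'k) \<Rightarrow> 'k) set) \<le> (?D + 1) ^ q"
      using card_monomials(2)[OF S(3), of ?D] q by simp
    also have "\<dots> \<le> ((e * r + 1) * m) ^ q"
      using \<open>m \<ge> 1\<close> by (intro power_mono) (auto simp: algebra_simps)
    also have "\<dots> = (e * r + 1) ^ q * m ^ q" by (rule power_mult_distrib)
    also have "\<dots> < m * m ^ q"
      using \<open>m \<ge> 1\<close> by (intro mult_strict_right_mono) (auto simp: m_def q)
    finally show ?thesis by (simp add: cardE q)
  qed
  have "finite E" using finP by (simp add: E_def)
  moreover have "g ` E \<subseteq> fun_space.span (monomials r ?D)" using formg by blast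
  ultimately obtain c where c: "\<exists>a\<in>E. c a \<noteq> 0" "(\<Sum>a\<in>E. (\<lambda>y. c a * g a y)) = 0"
    by (rule fun_space.linear_relation_exists[OF _ card_monomials(1)[OF S(3)] _ small])
  show ?thesis
  proof (rule that[of E "r * m" c])
    fix s assume "s \<in> S"
    then obtain y where "s = (\<Sum>i<r. y i *s b i)" using b by blast
    then show "(\<Sum>a\<in>E. c a * (\<Prod>i\<le>r. \<Phi> i s ^ a i)) = 0"
      using fun_cong[OF c(2), of y] by (simp add: g_def fun_sum_apply)
  qed (use E c finP in \<open>auto simp: E_def\<close>)
qed

section \<open>Krull dimension of parametrized closures\<close>

definition variety_chain :: "('k::field^'n::finite) set set \<Rightarrow> nat \<Rightarrow> (nat \<Rightarrow> ('k^'n) set set) \<Rightarrow> bool" where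
  "variety_chain S d C \<longleftrightarrow>
    (\<forall>i\<le>d. closedin zariski (C i) \<and> irreducible_set zariski (C i) \<and> C i \<subseteq> S) \<and> (\<forall>i<d. C i \<subset> C (Suc i))"

lemma variety_dim_eq: "variety_dim S = Sup {d. \<exists>C. variety_chain S d C}"
  unfolding variety_dim_def variety_chain_def ..

text \<open>A chain of length \<open>r\<close> yields \<open>r + 1\<close> forms, one per member,
  independent on its top member. Pulled back along \<open>\<phi>\<close> they are
  \<open>r + 1\<close> forms on an \<open>r\<close>-dimensional space, hence dependent, and the
  relation passes to the closure.\<close>

lemma variety_chain_bound:
  fixes \<phi> :: "'k::field_char_0^'n::finite \<Rightarrow> 'k^'n"
  assumes \<phi>: "hmap e \<phi>" and S: "vec.subspace S" "vec.dim S = r" "r > 0"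
    and Y: "Y \<subseteq> image_closure \<phi> S" and C: "variety_chain Y d C"
  shows "d < r"
proof (rule ccontr)
  assume "\<not> d < r"
  then have "r \<le> d" by simp
  let ?D = "\<lambda>i. {v. v \<noteq> 0 \<and> pt v \<in> C i}"
  have C': "closedin zariski (C i)" "irreducible_set zariski (C i)" "C i \<subseteq> Y" if "i \<le> d" for i
    using C that by (auto simp: variety_chain_def)
  have CPN: "C i \<subseteq> PN" if "i \<le> d" for i using C'(3)[OF that] Y image_closure_subset_PN by blast
  \<comment> \<open>\<open>F\<close> is to vanish on the preceding member of the chain but not on
    the \<open>i\<close>-th. Positive degree is needed to bring all these forms to a common degree
    by powers.\<close>
  define Q where "Q i F k \<longleftrightarrow> k > 0 \<and> hfun k F \<and> (\<exists>v\<in>?D i. F v \<noteq> 0) \<and>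
    (\<forall>j. i = Suc j \<longrightarrow> (\<forall>v\<in>?D j. F v = 0))" for i F k
  have "\<exists>F k. Q i F k" if i: "i \<le> d" for i
  proof (cases i)
    case 0
    obtain p where "p \<in> C i" using C'(2)[OF i] by (auto simp: irreducible_set_def)
    then obtain v where v: "v \<noteq> 0" "pt v \<in> C i" using CPN[OF i] by (metis PN_cases subsetD)
    then obtain j where "v $ j \<noteq> 0" by (auto simp: vec_eq_iff)
    then show ?thesis
      unfolding Q_def using 0 v hfun_nth[of j] by (intro exI[of _ "\<lambda>v. v $ j"] exI[of _ 1]) auto
  next
    case (Suc j)
    then have "C j \<subset> C i" using C i by (auto simp: variety_chain_def)
    then obtain p where p: "p \<in> C i" "p \<notin> C j" by blast
    then obtain v where v: "v \<noteq> 0" "p = pt v" using CPN[OF i] by (metis PN_cases subsetD)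
    obtain F k where F: "homogeneous k F" "\<forall>q\<in>C j. vanishes_at F q" "\<not> vanishes_at F p"
    proof -
      have "p \<in> PN - C j" using p CPN[OF i] by blast
      moreover have "closedin zariski (C j)" using C'(1)[of j] Suc i by simp
      ultimately have "\<exists>F k. homogeneous k F \<and> (\<forall>q\<in>C j. vanishes_at F q) \<and> \<not> vanishes_at F p"
        unfolding closedin_zariski by blast
      then show ?thesis using that by blast
    qed
    have "k \<noteq> 0"
    proof
      assume "k = 0"
      obtain q where "q \<in> C j" using C'(2)[of j] Suc i by (auto simp: irreducible_set_def)
      moreover then obtain u where "q = pt u" using CPN[of j] Suc i by (metis PN_cases Suc_leD subsetD)
      ultimately have "peval F u = 0" using F by (auto simp: vanishes_at_pt)
      then have "peval F v = 0" using hfun_degree_0[of "peval F" v u] F(1) \<open>k = 0\<close> hfun_peval by metis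
      then show False using F(1,3) v by (simp add: vanishes_at_pt)
    qed
    then show ?thesis
      unfolding Q_def using F p v Suc \<open>k \<noteq> 0\<close> by (intro exI[of _ "peval F"] exI[of _ k])
        (auto simp: hfun_peval vanishes_at_pt[OF F(1)])
  qed
  then obtain F k where FQ: "\<And>i. i \<le> d \<Longrightarrow> Q i (F i) (k i)"
    by metis
  have F: "\<And>i. i \<le> d \<Longrightarrow> k i > 0" "\<And>i. i \<le> d \<Longrightarrow> hfun (k i) (F i)"
    "\<And>i. i \<le> d \<Longrightarrow> \<exists>v\<in>?D i. F i v \<noteq> 0" "\<And>i j. i \<le> d \<Longrightarrow> i = Suc j \<Longrightarrow> \<forall>v\<in>?D j. F i v = 0"
    using FQ unfolding Q_def by blast+
  \<comment> \<open>A common multiple of the degrees; raising each separating form to the power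
    \<open>K div k i\<close> does not change where it vanishes.\<close>
  define K where "K = (\<Prod>i\<le>d. k i)"
  define G where "G = (\<lambda>i v. F i v ^ (K div k i))"
  have div: "K div k i * k i = K" "K div k i > 0" if "i \<le> d" for i
  proof -
    have "k i dvd K" unfolding K_def using that by (intro dvd_prodI) auto
    moreover have "K > 0" unfolding K_def using F(1) by (intro prod_pos) auto
    ultimately show "K div k i * k i = K" "K div k i > 0" by (auto simp: div_greater_zero_iff dvd_imp_le F(1) that)
  qed
  have G: "hfun K (G i)" "\<exists>v\<in>?D i. G i v \<noteq> 0" if "i \<le> d" for i
    using hfun_power[OF F(2)[OF that], of "K div k i"] F(3)[OF that] div[OF that] by (auto simp: G_def)
  have G0: "\<forall>v\<in>?D i. G (Suc i) v = 0" if "i < d" for i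
    using F(4)[of "Suc i" i] div(2)[of "Suc i"] that by (auto simp: G_def power_0_left)
  obtain E t c where E: "finite E" "\<And>a. a \<in> E \<Longrightarrow> (\<forall>i>r. a i = 0) \<and> (\<Sum>i\<le>r. a i) = t"
    "\<exists>a\<in>E. c a \<noteq> 0" "\<And>s. s \<in> S \<Longrightarrow> (\<Sum>a\<in>E. c a * (\<Prod>i\<le>r. G i (\<phi> s) ^ a i)) = 0"
  proof (rule forms_dependent[OF S])
    show "hfun (K * e) (\<lambda>s. G i (\<phi> s))" if "i \<le> r" for i
      using hfun_compose[OF G(1) \<phi>] that \<open>r \<le> d\<close> by simp
  qed blast
  have hG: "hfun (t * K) (\<lambda>v. \<Sum>a\<in>E. c a * (\<Prod>i\<le>r. G i v ^ a i))"
  proof (intro hfun_sum hfun_cmult)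
    fix a assume "a \<in> E"
    have "hfun (\<Sum>i\<le>r. a i * K) (\<lambda>v. \<Prod>i\<le>r. G i v ^ a i)"
      using \<open>r \<le> d\<close> by (intro hfun_prod hfun_power G(1)) auto
    then show "hfun (t * K) (\<lambda>v. \<Prod>i\<le>r. G i v ^ a i)"
      using E(2)[OF \<open>a \<in> E\<close>] by (simp add: sum_distrib_right[symmetric])
  qed
  have "c a = 0" if "a \<in> E" for a
  proof (rule chain_monomials_independent[of r K G ?D E t c a])
    fix v assume v: "v \<in> ?D r"
    then have "pt v \<in> image_closure \<phi> S" using C'(3)[OF \<open>r \<le> d\<close>] Y by auto
    then show "(\<Sum>a\<in>E. c a * (\<Prod>i\<le>r. G i v ^ a i)) = 0"
      using image_closure_hfun[OF _ hG] E(4) by blast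
  next
    fix i assume "i < r"
    then have "C i \<subset> C (Suc i)" using C \<open>r \<le> d\<close> by (simp add: variety_chain_def)
    then show "?D i \<subseteq> ?D (Suc i)" by auto
  next
    fix i assume "i \<le> r"
    then show "hirreducible (?D i)" using C'(2) \<open>r \<le> d\<close> by (intro hirreducible_cone) auto
  qed (use G G0 E \<open>r \<le> d\<close> that in auto)
  then show False using E(3) by blast
qed

lemma variety_dim_le:
  fixes \<phi> :: "'k::field_char_0^'n::finite \<Rightarrow> 'k^'n"
  assumes "hmap e \<phi>" "vec.subspace S" "vec.dim S > 0" "Y \<subseteq> image_closure \<phi> S"
  shows "variety_dim Y < vec.dim S"
proof (cases "{d. \<exists>C. variety_chain Y d C} = {}")
  \<comment> \<open>Without any chain the dimension is the \<open>Sup\<close> of the empty set of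
    naturals, which is 0.\<close>
  case True
  then show ?thesis using assms(3) by (simp add: variety_dim_eq)
next
  case False
  have "d \<le> vec.dim S - 1" if "\<exists>C. variety_chain Y d C" for d
    using variety_chain_bound[OF assms(1,2) refl assms(3,4)] that by fastforce
  then have "variety_dim Y \<le> vec.dim S - 1"
    unfolding variety_dim_eq by (intro cSup_least False) auto
  then show ?thesis using assms(3) by simp
qed

text \<open>A \<open>Sup\<close> of naturals dominates its members only for bounded sets; the
  parametrization supplies the bound on chain lengths.\<close>

lemma variety_dim_ge:
  fixes \<phi> :: "'k::field_char_0^'n::finite \<Rightarrow> 'k^'n"
  assumes "hmap e \<phi>" "vec.subspace S" "vec.dim S > 0" "Y \<subseteq> image_closure \<phi> S" "variety_chain Y d C"
  shows "d \<le> variety_dim Y"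
proof -
  have "bdd_above {d. \<exists>C. variety_chain Y d C}"
    using variety_chain_bound[OF assms(1,2) refl assms(3,4)] by (auto intro!: bdd_aboveI[of _ "vec.dim S"] less_imp_le)
  then show ?thesis
    unfolding variety_dim_eq using assms(5) by (intro cSup_upper) auto
qed


section \<open>Linear algebra\<close>

lemma dotp_commute: "dotp u v = dotp v u"
  by (simp add: dotp_def mult.commute)

lemma dotp_add_left: "dotp (a + b) c = dotp a c + dotp b c"
  by (simp add: dotp_def ring_distribs sum.distrib)

lemma dotp_add_right: "dotp c (a + b) = dotp c a + dotp c b"
  by (simp add: dotp_def ring_distribs sum.distrib)

lemma dotp_scale_left: "dotp (k *s a) b = k * dotp a b"
  by (simp add: dotp_def sum_distrib_left mult_ac)

lemma dotp_scale_right: "dotp a (k *s b) = k * dotp a b"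
  by (simp add: dotp_def sum_distrib_left mult_ac)

lemma dotp_0 [simp]: "dotp 0 a = 0" "dotp a 0 = 0"
  by (simp_all add: dotp_def)

lemma dotp_diff_left: "dotp (a - b) c = dotp a c - dotp b c"
  by (simp add: dotp_def ring_distribs sum_subtractf)

lemma dotp_diff_right: "dotp c (a - b) = dotp c a - dotp c b"
  by (simp add: dotp_def ring_distribs sum_subtractf)

lemma dotp_axis: "dotp a (axis i 1) = a $ i" "dotp (axis i 1) a = a $ i"
  by (simp_all add: dotp_def axis_def if_distrib[of "\<lambda>x. _ * x"] if_distrib[of "\<lambda>x. x * _"] cong: if_cong)

lemma dotp_nondegenerate: "(\<And>v. dotp a v = 0) \<Longrightarrow> a = 0"
  by (metis dotp_axis(1) vec_eq_iff zero_index)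

lemmas dotp_simps = dotp_add_left dotp_add_right dotp_scale_left dotp_scale_right dotp_diff_left dotp_diff_right

lemma vec_dim_le_card: "vec.dim (S :: ('k::field^'n::finite) set) \<le> CARD('n)"
  using vec.dim_subset[OF subset_UNIV, of S] by (simp only: vec_dim_card)

lemma subspace_Vert: "vec.subspace (Vert A)"
  unfolding Vert_def by (rule vec.subspaceI) (auto simp: matrix_vector_right_distrib vec.scale)

lemma Vert_iff: "v \<in> Vert A \<longleftrightarrow> A *v v = 0"
  by (simp add: Vert_def)

definition complementary :: "('k::field^'n::finite) set \<Rightarrow> ('k^'n) set \<Rightarrow> bool" where
  "complementary K C \<longleftrightarrow> vec.subspace K \<and> vec.subspace C \<and> K \<inter> C = {0} \<and> (\<forall>v. \<exists>k\<in>K. v - k \<in> C)"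

lemma dim_direct_sum_le:
  fixes S T :: "('k::field^'n::finite) set"
  assumes "vec.subspace S" "vec.subspace T" "S \<inter> T = {0}"
  shows "vec.dim {x + y |x y. x \<in> S \<and> y \<in> T} = vec.dim S + vec.dim T"
  using vec.dim_sums_Int[OF assms(1,2)] assms(3) by simp

lemma complementaryI:
  fixes S T :: "('k::field^'n::finite) set"
  assumes "vec.subspace S" "vec.subspace T" "S \<inter> T = {0}" "CARD('n) \<le> vec.dim S + vec.dim T"
  shows "complementary S T"
proof -
  let ?A = "{x + y |x y. x \<in> S \<and> y \<in> T}"
  have "vec.dim (UNIV :: ('k^'n) set) \<le> vec.dim ?A"
    using dim_direct_sum_le[OF assms(1-3)] assms(4) by (simp add: card_cart_basis)
  then have "?A = UNIV"
    using vec.subspace_dim_equal[OF vec.subspace_sums[OF assms(1,2)] vec.subspace_UNIV] by auto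
  then have "\<exists>k\<in>S. v - k \<in> T" for v
  proof -
    obtain x y where "v = x + y" "x \<in> S" "y \<in> T" using \<open>?A = UNIV\<close> by blast
    then show ?thesis by (intro bexI[of _ x]) auto
  qed
  then show ?thesis using assms by (simp add: complementary_def)
qed

lemma complementary_dim:
  fixes S T :: "('k::field^'n::finite) set"
  assumes "complementary S T"
  shows "vec.dim S + vec.dim T = CARD('n)"
proof -
  have "\<exists>x y. v = x + y \<and> x \<in> S \<and> y \<in> T" for v
  proof -
    obtain k where "k \<in> S" "v - k \<in> T" using assms by (auto simp: complementary_def)
    then show ?thesis by (intro exI[of _ k] exI[of _ "v - k"]) auto
  qed
  then have "{x + y |x y. x \<in> S \<and> y \<in> T} = UNIV" by auto
  then show ?thesis
    using dim_direct_sum_le[of S T] assms by (simp add: complementary_def card_cart_basis)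
qed

lemma complement_exists:
  fixes K :: "('k::field^'n::finite) set"
  assumes "vec.subspace K"
  obtains C where "complementary K C"
proof -
  obtain B where B: "B \<subseteq> K" "vec.independent B" "K \<subseteq> vec.span B" "card B = vec.dim K"
    using vec.basis_exists[of K] by blast
  obtain B' where B': "B \<subseteq> B'" "vec.independent B'" "UNIV \<subseteq> vec.span B'"
    using vec.maximal_independent_subset_extend[OF subset_UNIV B(2)] by metis
  let ?C = "vec.span (B' - B)"
  have fin: "finite B'" using B'(2) vec.finiteI_independent by blast
  have K: "K = vec.span B" using B assms by (metis vec.span_minimal subset_antisym)
  have all: "{x + y |x y. x \<in> K \<and> y \<in> ?C} = UNIV"
    using B'(1,3) vec.span_Un[of B "B' - B"] unfolding K by (auto simp: Un_absorb1)
  have "vec.dim K + vec.dim ?C = CARD('n) + vec.dim (K \<inter> ?C)"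
    using vec.dim_sums_Int[OF assms vec.subspace_span, of "B' - B"] all by (simp add: card_cart_basis)
  moreover have "vec.dim K + vec.dim ?C \<le> CARD('n)"
  proof -
    have "vec.independent (B' - B)" using B'(2) vec.independent_mono by blast
    then have "vec.dim ?C = card (B' - B)" by (rule vec.dim_span_eq_card_independent)
    also have "\<dots> = card B' - card B" using B'(1) fin by (simp add: card_Diff_subset finite_subset)
    also have "card B' = CARD('n)"
    proof -
      have "vec.span B' = UNIV" using B'(3) by blast
      then show ?thesis
        using vec.dim_eq_card_independent[OF B'(2)] vec.dim_span[of B'] by (simp add: card_cart_basis)
    qed
    finally show ?thesis using B(4) vec_dim_le_card[of K] by simp
  qed
  ultimately have "vec.dim (K \<inter> ?C) = 0" by simp
  then have "K \<inter> ?C = {0}"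
    using vec.dim_eq_0[of "K \<inter> ?C"] vec.subspace_0[OF assms] vec.span_zero by blast
  then show ?thesis
    using that complementaryI[OF assms vec.subspace_span, of "B' - B"] \<open>vec.dim K + vec.dim ?C = _\<close> by simp
qed

lemma rank_nullity:
  fixes A :: "'k::field^'n^'n::finite"
  assumes S: "vec.subspace S"
  shows "vec.dim S = vec.dim ((*v) A ` S) + vec.dim (S \<inter> Vert A)"
proof -
  let ?K = "S \<inter> Vert A"
  have K: "vec.subspace ?K" by (rule vec.subspace_inter[OF S subspace_Vert])
  obtain C' where C': "complementary ?K C'" using complement_exists[OF K] by blast
  let ?C = "C' \<inter> S"
  have C: "vec.subspace ?C" using C' S by (auto simp: complementary_def intro: vec.subspace_inter)
  have 0: "?K \<inter> ?C = {0}" using C' vec.subspace_0[OF S] by (auto simp: complementary_def)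
  have dec: "\<exists>k\<in>?K. v - k \<in> ?C" if "v \<in> S" for v
  proof -
    obtain k where "k \<in> ?K" "v - k \<in> C'" using C' unfolding complementary_def by blast
    then show ?thesis using that vec.subspace_diff[OF S] by blast
  qed
  have "{x + y |x y. x \<in> ?K \<and> y \<in> ?C} = S"
  proof (intro subset_antisym subsetI)
    fix v assume "v \<in> S"
    then obtain k where "k \<in> ?K" "v - k \<in> ?C" using dec by blast
    then show "v \<in> {x + y |x y. x \<in> ?K \<and> y \<in> ?C}" by (intro CollectI exI[of _ k] exI[of _ "v - k"]) auto
  qed (use vec.subspace_add[OF S] in auto)
  then have "vec.dim S = vec.dim ?K + vec.dim ?C" using dim_direct_sum_le[OF K C 0] by simp
  moreover have "(*v) A ` S = (*v) A ` ?C"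
  proof (intro subset_antisym image_subsetI)
    fix v assume "v \<in> S"
    then obtain k where k: "k \<in> ?K" "v - k \<in> ?C" using dec by blast
    then have "A *v v = A *v (v - k)" by (simp add: Vert_iff matrix_vector_mult_diff_distrib)
    then show "A *v v \<in> (*v) A ` ?C" using k(2) by blast
  qed auto
  moreover have "vec.dim ((*v) A ` ?C) = vec.dim ?C"
  proof (rule vec.dim_image_eq)
    show "inj_on ((*v) A) (vec.span ?C)"
    proof (rule inj_onI, unfold vec.span_eq_iff[THEN iffD2, OF C])
      fix x y assume xy: "x \<in> ?C" "y \<in> ?C" and eq: "A *v x = A *v y"
      then have "x - y \<in> ?C" using vec.subspace_diff[OF C] by blast
      moreover have "x - y \<in> ?K"
        using xy eq vec.subspace_diff[OF S, of x y] by (simp add: Vert_iff matrix_vector_mult_diff_distrib)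
      ultimately have "x - y \<in> ?K \<inter> ?C" by blast
      then show "x = y" using 0 by simp
    qed
  qed (rule matrix_vector_mul_linear_gen)
  ultimately show ?thesis by simp
qed

text \<open>Extend a basis of \<open>U\<close> to one of the whole space and use it as the rows of a
  matrix. The matrix is injective, and on \<open>W\<close> all coordinates belonging to the basis of
  \<open>U\<close> vanish.\<close>

lemma dim_orthogonal_le:
  fixes U W :: "('k::field^'n::finite) set"
  assumes "\<And>u w. u \<in> U \<Longrightarrow> w \<in> W \<Longrightarrow> dotp u w = 0"
  shows "vec.dim U + vec.dim W \<le> CARD('n)"
proof -
  obtain B where B: "B \<subseteq> U" "vec.independent B" "U \<subseteq> vec.span B" "card B = vec.dim U"
    using vec.basis_exists[of U] by blast
  obtain B' where B': "B \<subseteq> B'" "vec.independent B'" "UNIV \<subseteq> vec.span B'"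
    using vec.maximal_independent_subset_extend[OF subset_UNIV B(2)] by metis
  have fin: "finite B'" using B'(2) vec.finiteI_independent by blast
  have "vec.span B' = UNIV" using B'(3) by blast
  then have "card B' = CARD('n)"
    using vec.dim_eq_card_independent[OF B'(2)] vec.dim_span[of B'] by (simp add: card_cart_basis)
  then obtain \<beta> :: "'n \<Rightarrow> 'k^'n" where \<beta>: "bij_betw \<beta> UNIV B'"
    using finite_same_card_bij[of "UNIV :: 'n set" B'] fin by auto
  define A :: "'k^'n^'n" where "A = (\<chi> j. \<beta> j)"
  have A: "(A *v v) $ j = dotp (\<beta> j) v" for v j
    by (simp add: A_def matrix_vector_mult_def dotp_def)
  have inj: "inj ((*v) A)"
    unfolding vec.inj_iff_eq_0
  proof (intro allI impI)
    fix v assume "A *v v = 0"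
    then have "dotp (\<beta> j) v = 0" for j using A[of v j] by simp
    then have "\<forall>b\<in>B'. dotp b v = 0" using \<beta> by (auto simp: bij_betw_def)
    moreover have "vec.subspace {b. dotp b v = 0}" by (rule vec.subspaceI) (auto simp: dotp_simps)
    ultimately have "vec.span B' \<subseteq> {b. dotp b v = 0}" by (intro vec.span_minimal) auto
    then show "v = 0" using B'(3) dotp_nondegenerate[of v] by (auto simp: dotp_commute)
  qed
  let ?J = "{j. \<beta> j \<notin> B}"
  have "(*v) A ` W \<subseteq> vec.span ((\<lambda>j. axis j 1) ` ?J)"
  proof (rule image_subsetI)
    fix w assume w: "w \<in> W"
    have "A *v w = (\<Sum>j\<in>UNIV. (A *v w) $ j *s axis j 1)" by (rule basis_expansion[symmetric])
    also have "\<dots> = (\<Sum>j\<in>?J. (A *v w) $ j *s axis j 1)"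
    proof (rule sum.mono_neutral_right)
      show "\<forall>j\<in>UNIV - ?J. (A *v w) $ j *s axis j 1 = 0"
        using assms[OF _ w] B(1) by (auto simp: A)
    qed auto
    also have "\<dots> \<in> vec.span ((\<lambda>j. axis j 1) ` ?J)"
      by (intro vec.span_sum vec.span_scale vec.span_base) auto
    finally show "A *v w \<in> vec.span ((\<lambda>j. axis j 1) ` ?J)" .
  qed
  then have "vec.dim ((*v) A ` W) \<le> card ((\<lambda>j. axis j (1::'k)) ` ?J)"
    by (rule vec.dim_le_card) simp
  also have "\<dots> \<le> card ?J" by (rule card_image_le) simp
  also have "card ?J = card (B' - B)"
  proof -
    have "bij_betw \<beta> ?J (B' - B)" using \<beta> by (auto simp: bij_betw_def inj_on_def)
    then show ?thesis by (rule bij_betw_same_card)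
  qed
  also have "\<dots> = CARD('n) - vec.dim U"
    using B'(1) fin \<open>card B' = _\<close> B(4) by (simp add: card_Diff_subset finite_subset)
  finally have "vec.dim ((*v) A ` W) \<le> CARD('n) - vec.dim U" .
  moreover have "vec.dim ((*v) A ` W) = vec.dim W"
    by (rule vec.dim_image_eq[OF matrix_vector_mul_linear_gen inj_on_subset[OF inj subset_UNIV]])
  moreover have "vec.dim U \<le> CARD('n)" by (rule vec_dim_le_card)
  ultimately show ?thesis by simp
qed

lemma hyperplane_dim:
  fixes c :: "'k::field^'n::finite"
  assumes "c \<noteq> 0"
  shows "vec.dim {v. dotp c v = 0} = CARD('n) - 1"
proof -
  have sub: "vec.subspace {v. dotp c v = 0}" by (rule vec.subspaceI) (auto simp: dotp_simps)
  obtain j where j: "c $ j \<noteq> 0" using assms by (auto simp: vec_eq_iff)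
  have "complementary {v. dotp c v = 0} (pt (axis j 1))"
    unfolding complementary_def
  proof (intro conjI allI)
    show "{v. dotp c v = 0} \<inter> pt (axis j 1) = {0}"
      using j by (auto simp: vec.span_singleton dotp_simps dotp_axis intro: exI[of _ 0])
    fix v
    show "\<exists>k\<in>{v. dotp c v = 0}. v - k \<in> pt (axis j 1)"
      using j by (intro bexI[of _ "v - (dotp c v / c $ j) *s axis j 1"])
        (auto simp: vec.span_singleton dotp_simps dotp_axis)
  qed (use sub in auto)
  then have "vec.dim {v. dotp c v = 0} + vec.dim (pt (axis j (1::'k))) = CARD('n)"
    by (rule complementary_dim)
  moreover have "vec.dim (pt (axis j (1::'k))) = 1"
    by (simp add: axis_eq_0_iff)
  ultimately show ?thesis by simp
qed

lemma orthogonal_hyperplane: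
  fixes c u :: "'k::field^'n::finite"
  assumes "c \<noteq> 0" "\<And>v. dotp c v = 0 \<Longrightarrow> dotp u v = 0"
  shows "u \<in> pt c"
proof -
  obtain j where j: "c $ j \<noteq> 0" using assms by (auto simp: vec_eq_iff)
  have "u $ i * c $ j = u $ j * c $ i" for i
  proof -
    have "dotp c (c $ j *s axis i 1 - c $ i *s axis j 1) = 0" by (simp add: dotp_simps dotp_axis)
    then have "dotp u (c $ j *s axis i 1 - c $ i *s axis j 1) = 0" by (rule assms(2))
    then show ?thesis by (simp add: dotp_simps dotp_axis mult.commute)
  qed
  then have "u = (u $ j / c $ j) *s c" using j by (simp add: vec_eq_iff field_simps)
  then show ?thesis unfolding vec.span_singleton by blast
qed

text \<open>Reduces membership in a linear subspace to the vanishing of scalar linear forms, to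
  which the identity principle and differentiation apply.\<close>

lemma separating_form:
  fixes U :: "('k::field^'n::finite) set"
  assumes "vec.subspace U" "x \<notin> U"
  obtains a where "\<And>u. u \<in> U \<Longrightarrow> dotp a u = 0" "dotp a x = 1"
proof -
  obtain B where B: "B \<subseteq> U" "vec.independent B" "U \<subseteq> vec.span B" "card B = vec.dim U"
    using vec.basis_exists[of U] by blast
  then have U: "U = vec.span B" using assms by (metis vec.span_minimal subset_antisym)
  have "vec.independent (insert x B)" using assms(2) U B(2) by (intro vec.independent_insertI) auto
  then obtain g :: "'k^'n \<Rightarrow> 'k^'n" where g: "Vector_Spaces.linear (*s) (*s) g"
      "\<forall>y\<in>insert x B. g y = (if y = x then axis undefined 1 else 0)"
    using vec.linear_independent_extend[of "insert x B" "\<lambda>y. if y = x then axis undefined 1 else 0"] by blast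
  have xB: "x \<notin> B" using assms(2) U vec.span_base by blast
  \<comment> \<open>\<open>undefined\<close> is merely some index: \<open>g\<close> kills
    \<open>B\<close> and sends \<open>x\<close> to that unit vector, so this row of its matrix is
    the desired form.\<close>
  define a where "a = row undefined (matrix g)"
  have a: "dotp a v = g v $ undefined" for v
  proof -
    have "dotp a v = (matrix g *v v) $ undefined"
      by (simp add: a_def dotp_def matrix_vector_mult_def row_def)
    then show ?thesis by (simp only: matrix_works[OF g(1)])
  qed
  have "vec.span B \<subseteq> {u. dotp a u = 0}"
  proof (rule vec.span_minimal)
    show "B \<subseteq> {u. dotp a u = 0}" using g(2) xB by (auto simp: a)
    show "vec.subspace {u. dotp a u = 0}" by (rule vec.subspaceI) (auto simp: dotp_simps)
  qed
  then show ?thesis using that[of a] U g(2) by (auto simp: a)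
qed

text \<open>\<open>B\<close> is the projection onto the kernel of \<open>A\<close> along
  \<open>S\<close>, followed by an isomorphism of that kernel onto a complement of the range of
  \<open>A\<close>. Then \<open>A\<close> and \<open>B\<close> cannot cancel each other.\<close>

lemma complementary_regularize:
  fixes A :: "'k::field^'n^'n::finite"
  assumes "complementary (Vert A) S"
  obtains B where "\<And>s. s \<in> S \<Longrightarrow> B *v s = 0" "\<And>v. (A + B) *v v = 0 \<Longrightarrow> v = 0"
proof -
  let ?K = "Vert A" and ?R = "range ((*v) A)"
  have S: "vec.subspace S" and 0: "?K \<inter> S = {0}" and dec: "\<And>v. \<exists>k\<in>?K. v - k \<in> S"
    using assms by (auto simp: complementary_def)
  note K = subspace_Vert[of A]
  have R: "vec.subspace ?R"
    using vec.linear_subspace_image[OF matrix_vector_mul_linear_gen vec.subspace_UNIV] .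
  obtain C where C: "complementary ?R C" using complement_exists[OF R] by blast
  then have C': "vec.subspace C" "?R \<inter> C = {0}" by (auto simp: complementary_def)
  have "vec.dim ?K = vec.dim C"
    using complementary_dim[OF C] rank_nullity[OF vec.subspace_UNIV, of A] by (simp add: card_cart_basis)
  then obtain h where h: "Vector_Spaces.linear (*s) (*s) h" "h ` ?K = C" "inj_on h ?K"
    using vec.subspace_isomorphism[OF K C'(1)] by blast
  define \<pi> where "\<pi> v = (SOME k. k \<in> ?K \<and> v - k \<in> S)" for v
  have \<pi>: "\<pi> v \<in> ?K" "v - \<pi> v \<in> S" for v
  proof -
    obtain k where "k \<in> ?K" "v - k \<in> S" using dec[of v] by (rule bexE)
    then have "\<pi> v \<in> ?K \<and> v - \<pi> v \<in> S"
      unfolding \<pi>_def by (rule someI[where P = "\<lambda>k. k \<in> ?K \<and> v - k \<in> S", OF conjI])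
    then show "\<pi> v \<in> ?K" "v - \<pi> v \<in> S" by simp_all
  qed
  have uniq: "\<pi> v = k" if "k \<in> ?K" "v - k \<in> S" for v k
  proof -
    have "\<pi> v - k \<in> ?K" using \<pi>(1) that(1) vec.subspace_diff[OF K] by blast
    moreover have "(v - k) - (v - \<pi> v) \<in> S" using \<pi>(2) that(2) vec.subspace_diff[OF S] by blast
    moreover have "(v - k) - (v - \<pi> v) = \<pi> v - k" by simp
    ultimately have "\<pi> v - k \<in> ?K \<inter> S" by simp
    then show ?thesis using 0 by simp
  qed
  have lin: "Vector_Spaces.linear (*s) (*s) \<pi>"
    unfolding Vector_Spaces.linear_iff
  proof (intro conjI allI)
    show "vector_space ((*s) :: 'k \<Rightarrow> 'k^'n \<Rightarrow> 'k^'n)" "vector_space ((*s) :: 'k \<Rightarrow> 'k^'n \<Rightarrow> 'k^'n)"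
      by (rule vec.vector_space_axioms)+
  next
    fix x y show "\<pi> (x + y) = \<pi> x + \<pi> y"
    proof (rule uniq)
      show "\<pi> x + \<pi> y \<in> ?K" using \<pi>(1) vec.subspace_add[OF K] by blast
      have "(x - \<pi> x) + (y - \<pi> y) \<in> S" using \<pi>(2) vec.subspace_add[OF S] by blast
      then show "x + y - (\<pi> x + \<pi> y) \<in> S" by (simp add: algebra_simps)
    qed
  next
    fix c x show "\<pi> (c *s x) = c *s \<pi> x"
    proof (rule uniq)
      show "c *s \<pi> x \<in> ?K" using \<pi>(1) vec.subspace_scale[OF K] by blast
      have "c *s (x - \<pi> x) \<in> S" using \<pi>(2) vec.subspace_scale[OF S] by blast
      then show "c *s x - c *s \<pi> x \<in> S" by (simp add: vec.scale_right_diff_distrib)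
    qed
  qed
  have hl: "Vector_Spaces.linear (*s) (*s) (h \<circ> \<pi>)" by (rule Vector_Spaces.linear_compose[OF lin h(1)])
  define B where "B = matrix (h \<circ> \<pi>)"
  have B: "B *v v = h (\<pi> v)" for v unfolding B_def by (simp add: matrix_works[OF hl])
  have h0: "h 0 = 0" using h(1) vec.linear_0 by blast
  show ?thesis
  proof (rule that[of B])
    fix s assume "s \<in> S"
    then have "\<pi> s = 0" by (intro uniq) (auto simp: vec.subspace_0[OF K])
    then show "B *v s = 0" by (simp add: B h0)
  next
    fix v assume "(A + B) *v v = 0"
    then have eq: "A *v v = - h (\<pi> v)" by (simp add: matrix_vector_mult_add_rdistrib B eq_neg_iff_add_eq_0)
    have "h (\<pi> v) \<in> C" using h(2) \<pi>(1) by blast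
    then have "- h (\<pi> v) \<in> C" using C'(1) vec.subspace_neg by blast
    then have "A *v v \<in> ?R \<inter> C" using eq by (metis IntI rangeI)
    then have Av: "A *v v = 0" using C'(2) by blast
    then have "h (\<pi> v) = h 0" using eq h0 by simp
    then have "\<pi> v = 0" using h(3) \<pi>(1) vec.subspace_0[OF K] by (meson inj_onD)
    moreover have "\<pi> v = v" using Av by (intro uniq) (auto simp: Vert_iff vec.subspace_0[OF S])
    ultimately show "v = 0" by simp
  qed
qed

text \<open>
  Near a point where the kernel of a matrix of linear forms has minimal dimension, kernel vectors
  extend polynomially: with \<open>B\<close> regularizing \<open>H x0\<close> as above and a linear form \<open>l\<close> normalized
  at \<open>x0\<close>, Cramer's rule solves \<open>(H x + l x B) y = \<delta> x l x B p\<close>.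
\<close>

lemma kernel_extension:
  fixes H :: "'k::field_char_0^'n::finite \<Rightarrow> 'k^'n^'n"
  assumes H: "\<And>i j. hfun 1 (\<lambda>x. H x $ i $ j)" and x0: "x0 \<noteq> 0" and S: "complementary (Vert (H x0)) S"
  obtains \<delta> where "hfun CARD('n) \<delta>" "\<delta> x0 \<noteq> 0"
    "\<And>x. \<delta> x \<noteq> 0 \<Longrightarrow> Vert (H x) \<inter> S = {0}"
    "\<And>p. \<exists>Y. hmap CARD('n) Y \<and> (\<forall>x. \<delta> x \<noteq> 0 \<and> vec.dim (Vert (H x0)) \<le> vec.dim (Vert (H x)) \<longrightarrow>
        H x *v Y x = 0 \<and> Y x - \<delta> x *s p \<in> S)"
proof -
  obtain B where B: "\<And>s. s \<in> S \<Longrightarrow> B *v s = 0" "\<And>v. (H x0 + B) *v v = 0 \<Longrightarrow> v = 0"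
    using complementary_regularize[OF S] by blast
  have S': "vec.subspace S" using S by (simp add: complementary_def)
  obtain j0 where j0: "x0 $ j0 \<noteq> 0" using x0 by (auto simp: vec_eq_iff)
  \<comment> \<open>Multiplying \<open>B\<close> by a linear form that is 1 at \<open>x0\<close>
    keeps the entries of \<open>R\<close> homogeneous of degree 1 and gives
    \<open>R x0 = H x0 + B\<close>.\<close>
  define l where "l x = (1 / x0 $ j0) * x $ j0" for x :: "'k^'n"
  define R where "R x = (\<chi> i j. H x $ i $ j + l x * B $ i $ j)" for x
  define \<delta> where "\<delta> x = det (R x)" for x
  define Y where "Y p x = (\<chi> k. det (\<chi> i j. if j = k then (l x *s (B *v p)) $ i else R x $ i $ j))" for p x
  have hl: "hfun 1 l" unfolding l_def by (intro hfun_cmult hfun_nth)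
  have hR: "hfun 1 (\<lambda>x. R x $ i $ j)" for i j
    unfolding R_def using hfun_add[OF H hfun_multc[OF hl]] by simp
  have Rv: "R x *v v = H x *v v + l x *s (B *v v)" for x v
    by (simp add: R_def vec_eq_iff matrix_vector_mult_def ring_distribs sum.distrib sum_distrib_left mult_ac)
  have inv: "v = 0" if "\<delta> x \<noteq> 0" "R x *v v = 0" for x v
    using that invertible_det_nz[of "R x"] matrix_left_invertible_ker[of "R x"]
    unfolding \<delta>_def invertible_def by blast
  have cramerY: "R x *v Y p x = \<delta> x *s (l x *s (B *v p))" if "\<delta> x \<noteq> 0" for x p
  proof -
    let ?y = "\<chi> k. Y p x $ k / \<delta> x"
    have "R x *v ?y = l x *s (B *v p)"
      using that unfolding \<delta>_def by (subst cramer) (simp_all add: Y_def)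
    moreover have "Y p x = \<delta> x *s ?y" using that by (simp add: vec_eq_iff)
    ultimately show ?thesis by (metis vec.scale)
  qed
  have VS: "Vert (H x) \<inter> S = {0}" if "\<delta> x \<noteq> 0" for x
  proof (intro subset_antisym subsetI)
    fix v assume "v \<in> Vert (H x) \<inter> S"
    then have "R x *v v = 0" using B(1) by (simp add: Rv Vert_iff)
    then show "v \<in> {0}" using inv[OF that] by simp
  qed (use vec.subspace_0[OF subspace_Vert] vec.subspace_0[OF S'] in auto)
  show ?thesis
  proof (rule that[of \<delta>])
    show "hfun CARD('n) \<delta>" unfolding \<delta>_def using hfun_det[of 1 R, OF hR] by simp
    have "l x0 = 1" using j0 by (simp add: l_def)
    then have "R x0 = H x0 + B" by (simp add: R_def vec_eq_iff)
    then show "\<delta> x0 \<noteq> 0"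
      unfolding \<delta>_def using B(2) invertible_det_nz[of "R x0"] matrix_left_invertible_ker[of "R x0"]
      by (metis invertible_left_inverse)
    show "Vert (H x) \<inter> S = {0}" if "\<delta> x \<noteq> 0" for x by (rule VS[OF that])
    fix p
    show "\<exists>Y. hmap CARD('n) Y \<and> (\<forall>x. \<delta> x \<noteq> 0 \<and> vec.dim (Vert (H x0)) \<le> vec.dim (Vert (H x)) \<longrightarrow>
        H x *v Y x = 0 \<and> Y x - \<delta> x *s p \<in> S)"
    proof (intro exI[of _ "Y p"] conjI allI impI)
      have "hfun (CARD('n) * 1) (\<lambda>x. det (\<chi> i j. if j = k then (l x *s (B *v p)) $ i else R x $ i $ j))" for k
      proof (rule hfun_det)
        fix i j
        show "hfun 1 (\<lambda>x. (\<chi> i j. if j = k then (l x *s (B *v p)) $ i else R x $ i $ j) $ i $ j)"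
          using hR[of i j] hfun_multc[OF hl, of "(B *v p) $ i"] by (cases "j = k") simp_all
      qed
      then show "hmap CARD('n) (Y p)" unfolding hmap_def Y_def by simp
      fix x assume x: "\<delta> x \<noteq> 0 \<and> vec.dim (Vert (H x0)) \<le> vec.dim (Vert (H x))"
      have "complementary (Vert (H x)) S"
        using complementary_dim[OF S] VS x by (intro complementaryI subspace_Vert S') auto
      then obtain k where k: "k \<in> Vert (H x)" "p - k \<in> S" by (auto simp: complementary_def)
      \<comment> \<open>With \<open>k\<close> the kernel component of \<open>p\<close> along
        \<open>S\<close>, one has \<open>R x *v k = l x *s (B *v p)\<close>. So Cramer's solution is
        \<open>\<delta> x *s k\<close>, a kernel vector.\<close>
      have "B *v p = B *v k" using B(1)[OF k(2)] by (simp add: matrix_vector_mult_diff_distrib)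
      then have "R x *v (Y p x - \<delta> x *s k) = 0"
        using cramerY x k(1)
        by (simp add: matrix_vector_mult_diff_distrib vec.scale Rv Vert_iff)
      then have Y: "Y p x = \<delta> x *s k" using inv x by (metis eq_iff_diff_eq_0)
      then show "H x *v Y p x = 0" using k(1) by (simp add: Vert_iff vec.scale)
      have "- (\<delta> x *s (p - k)) \<in> S" using k(2) S' vec.subspace_scale vec.subspace_neg by blast
      then show "Y p x - \<delta> x *s p \<in> S" by (simp add: Y vec.scale_right_diff_distrib)
    qed
  qed
qed


section \<open>Cubic forms\<close>

locale cubic =
  fixes f :: "('n::finite, 'k::field_char_0) mpoly"
  assumes cubic: "homogeneous 3 f"
begin

abbreviation "H \<equiv> hessian_at f"

abbreviation B :: "'k^'n \<Rightarrow> 'k^'n \<Rightarrow> 'k^'n" where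
  "B u v \<equiv> hessian_at f u *v v"

text \<open>The coefficients of the symmetric trilinear form of \<open>f\<close>: third derivatives
  of a cubic are constant, so evaluation at 0 is a mere choice.\<close>

definition tc :: "'n \<Rightarrow> 'n \<Rightarrow> 'n \<Rightarrow> 'k" where
  "tc i j k = peval (pd k (pd j (pd i f))) 0"

lemma tc_commute: "tc i j k = tc j i k" "tc i j k = tc i k j"
  unfolding tc_def by (simp_all add: pd_commute)

lemma H_nth: "H v $ i $ j = (\<Sum>k\<in>UNIV. tc i j k * v $ k)"
proof -
  let ?G = "pd j (pd i f)"
  have G: "homogeneous 1 ?G"
    using homogeneous_pd[OF homogeneous_pd[OF cubic, of i], of j] by (simp add: numeral_eq_Suc)
  have "peval (pd k ?G) v = tc i j k" for k
    unfolding tc_def using homogeneous_0D[of "pd k ?G" v] homogeneous_pd[OF G, of k] by simp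
  then show ?thesis
    using euler[OF G, of v] by (simp add: hessian_at_def gradient_def dotp_def)
qed

lemma hfun_H: "hfun 1 (\<lambda>v. H v $ i $ j)"
  unfolding H_nth by (intro hfun_sum hfun_cmult hfun_nth)

lemma B_nth: "B u v $ i = (\<Sum>j\<in>UNIV. \<Sum>k\<in>UNIV. tc i j k * u $ k * v $ j)"
  by (simp add: matrix_vector_mult_def H_nth sum_distrib_right)

lemma B_commute: "B u v = B v u"
proof -
  have "B u v $ i = B v u $ i" for i
  proof -
    have "B u v $ i = (\<Sum>j\<in>UNIV. \<Sum>k\<in>UNIV. tc i k j * v $ j * u $ k)"
      unfolding B_nth by (intro sum.cong refl) (simp add: tc_commute(2)[of i] mult_ac)
    also have "\<dots> = B v u $ i" unfolding B_nth by (rule sum.swap)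
    finally show ?thesis .
  qed
  then show ?thesis by (simp add: vec_eq_iff)
qed

lemma dotp_B_commute: "dotp (B u v) w = dotp (B u w) v"
proof -
  have "dotp (B u v) w = (\<Sum>i\<in>UNIV. \<Sum>j\<in>UNIV. H u $ i $ j * v $ j * w $ i)"
    by (simp add: dotp_def matrix_vector_mult_def sum_distrib_right)
  also have "\<dots> = (\<Sum>j\<in>UNIV. \<Sum>i\<in>UNIV. H u $ i $ j * v $ j * w $ i)" by (rule sum.swap)
  also have "\<dots> = (\<Sum>j\<in>UNIV. \<Sum>i\<in>UNIV. H u $ j $ i * w $ i * v $ j)"
  proof (intro sum.cong refl)
    fix i j
    have "H u $ i $ j = H u $ j $ i" unfolding H_nth using tc_commute(1)[of i j] by simp
    then show "H u $ i $ j * v $ j * w $ i = H u $ j $ i * w $ i * v $ j" by simp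
  qed
  also have "\<dots> = dotp (B u w) v"
    by (simp add: dotp_def matrix_vector_mult_def sum_distrib_right)
  finally show ?thesis .
qed

lemma B_add_right: "B u (a + b) = B u a + B u b"
  by (rule matrix_vector_right_distrib)

lemma B_scale_right: "B u (c *s a) = c *s B u a"
  by (rule vec.scale)

lemma B_diff_right: "B u (a - b) = B u a - B u b"
  by (rule matrix_vector_mult_diff_distrib)

lemma B_add_left: "B (a + b) u = B a u + B b u"
  by (simp add: B_commute[of _ u] B_add_right)

lemma B_scale_left: "B (c *s a) u = c *s B a u"
  by (simp add: B_commute[of _ u] B_scale_right)

lemma B_diff_left: "B (a - b) u = B a u - B b u"
  by (simp add: B_commute[of _ u] B_diff_right)

lemma B_0 [simp]: "B 0 u = 0" "B u 0 = 0"
  by (simp_all add: B_commute[of 0])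

lemmas B_simps = B_add_left B_add_right B_scale_left B_scale_right B_diff_left B_diff_right

text \<open>The hypothesis says that the derivative of \<open>f\<close> in direction
  \<open>a\<close> vanishes identically. Its values at \<open>u + v\<close>, \<open>u\<close> and
  \<open>v\<close> leave twice the mixed term.\<close>

lemma polarization:
  assumes "\<And>v. dotp (B v v) a = 0"
  shows "B a u = 0"
proof (rule dotp_nondegenerate)
  fix v
  have "dotp (B (u + v) (u + v)) a = 2 * dotp (B u v) a"
    using assms[of u] assms[of v] by (simp only: B_commute[of v u] B_add_left B_add_right dotp_add_left) simp
  then have "dotp (B u v) a = 0" using assms by simp
  then show "dotp (B a u) v = 0" using dotp_B_commute[of u v a] B_commute[of a u] by simp
qed

lemma gradient_eq: "2 *s gradient f v = B v v"
proof -
  have "dotp (gradient (pd i f) v) v = 2 * peval (pd i f) v" for i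
    using euler[OF homogeneous_pd[OF cubic], of i v] by simp
  moreover have "dotp (gradient (pd i f) v) v = B v v $ i" for i
    by (simp add: dotp_def gradient_def matrix_vector_mult_def hessian_at_def)
  ultimately show ?thesis by (simp add: vec_eq_iff gradient_def)
qed

lemma gradient_eq': "gradient f v = (1 / 2) *s B v v"
  by (simp add: gradient_eq[symmetric])

lemma peval_eq: "6 * peval f v = dotp (B v v) v"
  using euler[OF cubic, of v] by (simp add: gradient_eq[symmetric] dotp_simps)

lemma hmap_B: "hmap a \<phi> \<Longrightarrow> hmap b \<psi> \<Longrightarrow> hmap (a + b) (\<lambda>x. B (\<phi> x) (\<psi> x))"
  unfolding hmap_def B_nth using hfun_mult[OF hfun_cmult]
  by (intro allI hfun_sum) blast

lemma vjet_B:
  assumes c: "vjet c a b" and c': "vjet c' a' b'"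
  shows "vjet (\<lambda>t. B (c t) (c' t)) (B a a') (B a b' + B b a')"
  unfolding vjet_def
proof
  fix i
  have H: "H v $ i $ j = dotp (\<chi> k. tc i j k) v" for v j
    by (simp add: H_nth dotp_def)
  have "vjet (\<lambda>t. H (c t) $ i) (H a $ i) (H b $ i)"
    unfolding vjet_def H using jet_dotp_const[OF c] by blast
  from jet_dotp[OF this c'] show "jet (\<lambda>t. B (c t) (c' t) $ i) (B a a' $ i) ((B a b' + B b a') $ i)"
    by (simp add: matrix_vector_mult_def dotp_def)
qed

lemma vjet_gradient: "vjet c a b \<Longrightarrow> vjet (\<lambda>t. gradient f (c t)) (gradient f a) (B a b)"
proof -
  assume c: "vjet c a b"
  show ?thesis
    unfolding vjet_def
  proof
    fix i
    have D: "dotp (gradient (pd i f) a) b = B a b $ i"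
      by (simp add: dotp_def gradient_def matrix_vector_mult_def hessian_at_def)
    have e: "gradient f x $ i = peval (pd i f) x" for x by (simp add: gradient_def)
    show "jet (\<lambda>t. gradient f (c t) $ i) (gradient f a $ i) (B a b $ i)"
      unfolding e D[symmetric] by (rule jet_peval[OF c])
  qed
qed

lemma hmap_gradient_f: "hmap 2 (gradient f)"
  using hmap_gradient[OF cubic] by simp

lemma polar_map_pt: "polar_map f (pt v) = pt (gradient f v)"
proof
  show "polar_map f (pt v) \<subseteq> pt (gradient f v)"
    unfolding polar_map_def
  proof (rule vec.span_minimal[OF image_subsetI vec.subspace_span])
    fix u assume "u \<in> pt v"
    then show "gradient f u \<in> pt (gradient f v)"
      unfolding vec.span_singleton by (auto simp: hmap_scale[OF hmap_gradient_f])
  qed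
  show "pt (gradient f v) \<subseteq> polar_map f (pt v)"
    unfolding polar_map_def by (rule vec.span_mono) (auto intro: vec.span_base)
qed

end


section \<open>Cubics with vanishing hessian and polar image of codimension one\<close>

text \<open>\<open>nondegenerate\<close> is the algebraic consequence of \<open>X\<close> not being
  a cone, \<open>singular\<close> the pointwise form of the vanishing hessian, and
  \<open>codim_one\<close> says that \<open>Z\<close> has dimension \<open>N - 1\<close>, written
  with \<open>CARD('n) = N + 1\<close> and without subtraction.\<close>

locale polar_hypersurface = cubic f for f :: "('n::finite, 'k::field_char_0) mpoly" +
  assumes nondegenerate: "(\<And>v. B u v = 0) \<Longrightarrow> u = 0"
    and singular: "\<exists>u. u \<noteq> 0 \<and> B v u = 0"
    and codim_one: "variety_dim (polar_image f) + 2 = CARD('n)"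
begin

lemma gradient_nonzero: "\<exists>v. gradient f v \<noteq> 0"
proof (rule ccontr)
  assume "\<not> ?thesis"
  then have "dotp (B v v) a = 0" for v a by (simp add: gradient_eq[symmetric])
  then have "(axis undefined 1 :: 'k^'n) = 0" by (rule nondegenerate[OF polarization])
  then show False by (simp add: axis_eq_0_iff)
qed

lemma polar_image_eq: "polar_image f = image_closure (gradient f) UNIV"
proof -
  obtain v0 where v0: "gradient f v0 \<noteq> 0" using gradient_nonzero by blast
  show ?thesis
    unfolding polar_image_def
  proof (rule closure_eq_image_closure[OF hmap_gradient_f vec.subspace_UNIV hfun_const[of 1] UNIV_I _ v0])
    show "polar_map f ` {p \<in> PN. polar_map f p \<in> PN} \<subseteq> image_closure (gradient f) UNIV"
    proof (rule image_subsetI)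
      fix p assume "p \<in> {p \<in> PN. polar_map f p \<in> PN}"
      then have p: "p \<in> PN" "polar_map f p \<in> PN" by simp_all
      then obtain v where "p = pt v" by (rule_tac PN_cases)
      then show "polar_map f p \<in> image_closure (gradient f) UNIV"
        using p(2) pt_in_image_closure[of v UNIV "gradient f"] by (simp add: polar_map_pt)
    qed
    fix s assume "gradient f s \<noteq> 0"
    moreover then have "s \<noteq> 0" using hmap_scale[OF hmap_gradient_f, of 0 0] by auto
    ultimately show "pt (gradient f s) \<in> polar_map f ` {p \<in> PN. polar_map f p \<in> PN}"
      by (intro image_eqI[of _ _ "pt s"]) (simp_all add: polar_map_pt)
  qed simp
qed

lemma dim_kernel_pos: "vec.dim (Vert (H v)) > 0"
proof -
  obtain u where "u \<noteq> 0" "u \<in> Vert (H v)" using singular by (auto simp: Vert_iff)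
  then show ?thesis using vec.dim_eq_0[of "Vert (H v)"] by blast
qed

text \<open>Minimal corank of the Hessian replaces generality of \<open>v\<close>; such points exist
  without choosing an open set.\<close>

definition kernel_minimal :: "'k^'n \<Rightarrow> bool" where
  "kernel_minimal v \<longleftrightarrow> (\<forall>u. vec.dim (Vert (H v)) \<le> vec.dim (Vert (H u)))"

lemma kernel_minimal_exists: "\<exists>v. kernel_minimal v"
  unfolding kernel_minimal_def using ex_has_least_nat[of "\<lambda>_. True" _ "\<lambda>v. vec.dim (Vert (H v))"] by auto

lemma kernel_minimal_dim_less: "kernel_minimal v \<Longrightarrow> vec.dim (Vert (H v)) < CARD('n)"
proof (rule ccontr)
  assume v: "kernel_minimal v" "\<not> vec.dim (Vert (H v)) < CARD('n)"
  have "B u a = 0" for u a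
  proof -
    have "vec.dim (UNIV :: ('k^'n) set) \<le> vec.dim (Vert (H u))"
      using v unfolding kernel_minimal_def vec_dim_card by (metis leI le_trans not_less)
    then have "Vert (H u) = UNIV"
      using vec.subspace_dim_equal[OF subspace_Vert vec.subspace_UNIV] by blast
    then show ?thesis using Vert_iff by blast
  qed
  then have "(axis undefined 1 :: 'k^'n) = 0" by (rule nondegenerate)
  then show False by (simp add: axis_eq_0_iff)
qed

lemma kernel_minimal_nonzero: "kernel_minimal v \<Longrightarrow> v \<noteq> 0"
proof
  assume v: "kernel_minimal v" "v = 0"
  then have "Vert (H v) = UNIV" by (auto simp: Vert_iff)
  then show False using kernel_minimal_dim_less[OF v(1)] by (simp add: card_cart_basis)
qed

text \<open>Extend \<open>y\<close> to polynomial kernel vectors \<open>Y x\<close> and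
  differentiate \<open>B x (Y x) = 0\<close> at \<open>v\<close> in direction \<open>u\<close>.
  Pairing with \<open>y'\<close>, which the symmetric Hessian at \<open>v\<close> kills, removes the
  term with the unknown derivative of \<open>Y\<close>.\<close>

lemma kernel_isotropic:
  assumes v: "kernel_minimal v" and y: "y \<in> Vert (H v)" "y' \<in> Vert (H v)"
  shows "dotp (B u y) y' = 0"
proof -
  obtain S where S: "complementary (Vert (H v)) S" using complement_exists[OF subspace_Vert] by blast
  obtain \<delta> where \<delta>: "hfun CARD('n) \<delta>" "\<delta> v \<noteq> 0"
    and ext: "\<And>p. \<exists>Y. hmap CARD('n) Y \<and> (\<forall>x. \<delta> x \<noteq> 0 \<and> vec.dim (Vert (H v)) \<le> vec.dim (Vert (H x)) \<longrightarrow>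
        B x (Y x) = 0 \<and> Y x - \<delta> x *s p \<in> S)"
    using kernel_extension[of H, OF hfun_H kernel_minimal_nonzero[OF v] S] by metis
  obtain Y where Y: "hmap CARD('n) Y" "\<And>x. \<delta> x \<noteq> 0 \<Longrightarrow> B x (Y x) = 0 \<and> Y x - \<delta> x *s y \<in> S"
    using ext[of y] v unfolding kernel_minimal_def by blast
  have BY: "B x (Y x) = 0" for x
  proof -
    have "B x (Y x) $ i = 0" for i
      by (rule hfun_zero_generic[OF hmapD[OF hmap_B[OF hmap_ident Y(1)]] \<delta>(1) vec.subspace_UNIV UNIV_I \<delta>(2)])
        (use Y(2) in auto)
    then show ?thesis by (simp add: vec_eq_iff)
  qed
  have "Y v - \<delta> v *s y \<in> Vert (H v)"
    using BY[of v] y(1) by (simp add: Vert_iff B_simps)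
  then have "Y v - \<delta> v *s y \<in> Vert (H v) \<inter> S" using Y(2)[OF \<delta>(2)] by blast
  moreover have "Vert (H v) \<inter> S = {0}" using S by (simp only: complementary_def)
  ultimately have "Y v = \<delta> v *s y" by simp
  moreover obtain b where b: "vjet (\<lambda>t. Y (v + t *s u)) (Y v) b"
    using vjet_hmap[OF Y(1) vjet_line] by blast
  have "B v b + B u (Y v) = 0"
    using vjet_B[OF vjet_line[of v u] b] unfolding BY by (rule vjet_zero)
  then have "dotp (B v b) y' + dotp (B u (Y v)) y' = 0" by (simp add: dotp_add_left[symmetric])
  moreover have "dotp (B v b) y' = 0" using y(2) by (simp add: dotp_B_commute[of v b] Vert_iff)
  ultimately show ?thesis using \<delta>(2) by (simp add: B_simps dotp_simps)
qed

text \<open>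
  The polar map is constant along \<open>v + Vert (H v)\<close>, so its image is already swept out by a linear
  space complementary to a general kernel; this bounds the dimension of the polar image.
\<close>

lemma kernel_minimal_dim:
  assumes v1: "kernel_minimal v1"
  shows "vec.dim (Vert (H v1)) = 1"
    and "complementary (Vert (H v1)) S \<Longrightarrow> image_closure (gradient f) UNIV \<subseteq> image_closure (gradient f) S"
proof -
  show sub: "image_closure (gradient f) UNIV \<subseteq> image_closure (gradient f) S"
    if S: "complementary (Vert (H v1)) S" for S
  proof
    fix p assume p: "p \<in> image_closure (gradient f) UNIV"
    obtain \<delta> where \<delta>: "hfun CARD('n) \<delta>" "\<delta> v1 \<noteq> 0" "\<And>x. \<delta> x \<noteq> 0 \<Longrightarrow> Vert (H x) \<inter> S = {0}"
      using kernel_extension[of H, OF hfun_H kernel_minimal_nonzero[OF v1] S] by metis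
    have "vanishes_at F p" if F: "homogeneous d F" "\<forall>s\<in>S. peval F (gradient f s) = 0" for F d
    proof -
      have "peval F (gradient f v) = 0" for v
      proof (rule hfun_zero_generic[OF hfun_compose[OF hfun_peval[OF F(1)] hmap_gradient_f] \<delta>(1)
            vec.subspace_UNIV UNIV_I \<delta>(2)])
        fix v assume "\<delta> v \<noteq> 0"
        have le: "vec.dim (Vert (H v1)) \<le> vec.dim (Vert (H v))" using v1 by (simp add: kernel_minimal_def)
        have "complementary (Vert (H v)) S"
          using complementary_dim[OF S] \<delta>(3)[OF \<open>\<delta> v \<noteq> 0\<close>] S le
          by (intro complementaryI subspace_Vert) (auto simp: complementary_def)
        then have "kernel_minimal v"
          using complementary_dim[OF \<open>complementary (Vert (H v)) S\<close>] complementary_dim[OF S] v1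
          unfolding kernel_minimal_def by (metis add_right_cancel)
        obtain k where k: "k \<in> Vert (H v)" "v - k \<in> S"
          using \<open>complementary (Vert (H v)) S\<close> by (auto simp: complementary_def)
        \<comment> \<open>Isotropy with both kernel vectors equal to \<open>k\<close> makes the
          quadratic term in \<open>k\<close> vanish, and \<open>B v k = 0\<close> the linear one. So
          moving from \<open>v\<close> to \<open>v - k\<close> in \<open>S\<close> leaves the
          gradient unchanged.\<close>
        have "B k k = 0"
        proof (rule dotp_nondegenerate)
          fix u show "dotp (B k k) u = 0"
            using kernel_isotropic[OF \<open>kernel_minimal v\<close> k(1) k(1), of u] dotp_B_commute[of k k u] B_commute[of k u]
            by simp
        qed
        then have "B (v - k) (v - k) = B v v"
          using k(1) B_commute[of k v] by (simp add: B_simps Vert_iff)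
        then have "gradient f (v - k) = gradient f v" by (simp add: gradient_eq')
        then show "peval F (gradient f v) = 0" using F(2) k(2) by metis
      qed simp
      then show ?thesis using p F(1) by (auto simp: image_closure_def)
    qed
    then show "p \<in> image_closure (gradient f) S"
      using p by (auto simp: image_closure_def)
  qed
  obtain S where S: "complementary (Vert (H v1)) S" using complement_exists[OF subspace_Vert] by blast
  then have "vec.dim S > 0" using complementary_dim[OF S] kernel_minimal_dim_less[OF v1] by simp
  \<comment> \<open>As \<open>Z\<close> has dimension \<open>CARD('n) - 2\<close>, the bound leaves
    at most dimension 1 for the kernel, which is nonzero because the Hessian is singular.\<close>
  then have "variety_dim (polar_image f) < vec.dim S"
    using S sub[OF S] by (intro variety_dim_le[OF hmap_gradient_f]) (auto simp: complementary_def polar_image_eq)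
  then show "vec.dim (Vert (H v1)) = 1"
    using complementary_dim[OF S] codim_one dim_kernel_pos[of v1] by simp
qed

text \<open>The \<open>r + 1\<close> partial derivatives of \<open>f\<close> are forms on the
  \<open>r\<close>-dimensional space \<open>S\<close>, hence algebraically dependent. The relation
  extends from \<open>S\<close> because \<open>S\<close> already sweeps out
  \<open>Z\<close>.\<close>

lemma relation_exists:
  obtains d g where "homogeneous d g" "\<And>v. peval g (gradient f v) = 0" "\<exists>x. peval g x \<noteq> 0"
proof -
  obtain v1 where v1: "kernel_minimal v1" using kernel_minimal_exists by blast
  obtain S where S: "complementary (Vert (H v1)) S" using complement_exists[OF subspace_Vert] by blast
  define r where "r = vec.dim S"
  have r: "CARD('n) = Suc r" using complementary_dim[OF S] kernel_minimal_dim(1)[OF v1] by (simp add: r_def)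
  have r0: "r > 0" using codim_one r by simp
  obtain \<beta> :: "nat \<Rightarrow> 'n" where \<beta>: "bij_betw \<beta> {..r} UNIV"
    using finite_same_card_bij[of "{..r}" "UNIV :: 'n set"] r by auto
  obtain E t c where E: "finite E" "\<And>a. a \<in> E \<Longrightarrow> (\<forall>i>r. a i = 0) \<and> (\<Sum>i\<le>r. a i) = t"
    "\<exists>a\<in>E. c a \<noteq> 0" "\<And>s. s \<in> S \<Longrightarrow> (\<Sum>a\<in>E. c a * (\<Prod>i\<le>r. (gradient f s $ \<beta> i) ^ a i)) = 0"
  proof (rule forms_dependent[of S r 2 "\<lambda>i s. gradient f s $ \<beta> i"])
    show "hfun 2 (\<lambda>s. gradient f s $ \<beta> i)" for i by (rule hmapD[OF hmap_gradient_f])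
  qed (use S r0 in \<open>auto simp: complementary_def r_def\<close>)
  let ?G = "\<lambda>x. \<Sum>a\<in>E. c a * (\<Prod>i\<le>r. (x $ \<beta> i) ^ a i)"
  have "hfun t ?G"
  proof (intro hfun_sum hfun_cmult)
    fix a assume "a \<in> E"
    moreover have "hfun (\<Sum>i\<le>r. a i * 1) (\<lambda>x. \<Prod>i\<le>r. (x $ \<beta> i) ^ a i)"
      by (intro hfun_prod hfun_power hfun_nth)
    ultimately show "hfun t (\<lambda>x. \<Prod>i\<le>r. (x $ \<beta> i) ^ a i)" using E(2) by simp
  qed
  then obtain g where g: "homogeneous t g" "?G = peval g" by (auto simp: hfun_def)
  have gG: "peval g x = ?G x" for x using fun_cong[OF g(2), of x] by (rule sym)
  have gS: "peval g (gradient f s) = 0" if "s \<in> S" for s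
    unfolding gG by (rule E(4)[OF that])
  have "\<exists>x. peval g x \<noteq> 0"
  proof (rule ccontr)
    assume "\<nexists>x. peval g x \<noteq> 0"
    then have zero: "?G x = 0" for x using gG[of x] by simp
    have inj: "\<beta> i = \<beta> j \<longleftrightarrow> i = j" if "i \<le> r" "j \<le> r" for i j
      using that \<beta> by (auto simp: bij_betw_def inj_on_def)
    \<comment> \<open>These coordinate subspaces form a chain separated by the coordinates. The
      independence result for chains then says that a polynomial with a nonzero coefficient is not
      the zero function.\<close>
    define D :: "nat \<Rightarrow> ('k^'n) set" where "D i = {x. \<forall>j\<le>r. i < j \<longrightarrow> x $ \<beta> j = 0}" for i
    have "c a = 0" if "a \<in> E" for a
    proof (rule chain_monomials_independent[of r 1 "\<lambda>i x. x $ \<beta> i" D E t c a])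
      fix i assume i: "i \<le> r"
      show "hfun 1 (\<lambda>x::'k^'n. x $ \<beta> i)" by (rule hfun_nth)
      show "hirreducible (D i)"
        by (rule hirreducible_subspace) (auto simp: D_def intro!: vec.subspaceI)
      have "axis (\<beta> i) 1 \<in> D i" using i by (auto simp: D_def axis_def inj)
      then show "\<exists>x\<in>D i. x $ \<beta> i \<noteq> 0" by (intro bexI[of _ "axis (\<beta> i) 1"]) auto
    next
      fix i assume "i < r"
      then show "\<forall>x\<in>D i. x $ \<beta> (Suc i) = 0" "D i \<subseteq> D (Suc i)" by (auto simp: D_def)
    next
      fix v assume "v \<in> D r"
      show "?G v = 0" by (rule zero)
    qed (use E that in auto)
    then show False using E(3) by blast
  qed
  moreover have "peval g (gradient f v) = 0" for v
  proof (cases "gradient f v = 0")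
    case True
    have "peval g (gradient f 0) = 0"
      by (rule gS) (use S in \<open>simp add: complementary_def vec.subspace_0\<close>)
    then show ?thesis using True hmap_scale[OF hmap_gradient_f, of 0 0] by simp
  next
    case False
    then have "pt (gradient f v) \<in> image_closure (gradient f) S"
      using kernel_minimal_dim(2)[OF v1 S] pt_in_image_closure[of v UNIV "gradient f"] by auto
    then show ?thesis
      by (rule image_closureD[OF _ g(1)]) (use gS in blast)
  qed
  ultimately show ?thesis using that g(1) by blast
qed

text \<open>For \<open>g\<close> of minimal degree some partial derivative is not the zero function
  and has smaller degree, so it cannot vanish on \<open>Z\<close>. Degree 1 is impossible: a linear
  relation among the partial derivatives of \<open>f\<close> contradicts nondegeneracy.\<close>

lemma separating_relation_exists:
  obtains d g where "d \<ge> 2" "homogeneous d g" "\<And>v. peval g (gradient f v) = 0"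
    "\<exists>v. gradient g (gradient f v) \<noteq> 0"
proof -
  define P where "P d g \<longleftrightarrow> homogeneous d g \<and> (\<forall>v. peval g (gradient f v) = 0) \<and> (\<exists>x. peval g x \<noteq> 0)" for d g
  have "\<exists>d. \<exists>g. P d g" using relation_exists unfolding P_def by metis
  then obtain d where d: "\<exists>g. P d g" "\<And>e. e < d \<Longrightarrow> \<nexists>g. P e g" using exists_least_iff[of "\<lambda>d. \<exists>g. P d g"] by blast
  then obtain g where g: "homogeneous d g" "\<And>v. peval g (gradient f v) = 0" "\<exists>x. peval g x \<noteq> 0"
    unfolding P_def by blast
  have "d \<noteq> 0"
    using g hfun_degree_0[OF hfun_peval, of g] by metis
  obtain x where "peval g x \<noteq> 0" using g(3) by blast
  then have "gradient g x \<noteq> 0" using euler[OF g(1), of x] \<open>d \<noteq> 0\<close> by auto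
  then obtain i where "peval (pd i g) x \<noteq> 0" by (auto simp: gradient_def vec_eq_iff)
  then have "\<not> (\<forall>v. peval (pd i g) (gradient f v) = 0)"
    using d(2)[of "d - 1"] homogeneous_pd[OF g(1), of i] \<open>d \<noteq> 0\<close> unfolding P_def by auto
  then have nz: "\<exists>v. gradient g (gradient f v) \<noteq> 0" by (auto simp: gradient_def vec_eq_iff)
  have "d \<noteq> 1"
  proof
    assume d1: "d = 1"
    define a where "a = gradient g 0"
    have a: "gradient g x = a" for x
    proof -
      have "homogeneous 0 (pd i g)" for i using homogeneous_pd[OF g(1), of i] d1 by simp
      then have "peval (pd i g) x = peval (pd i g) 0" for i by (rule homogeneous_0D)
      then show ?thesis by (simp add: a_def gradient_def vec_eq_iff)
    qed
    have "dotp a (gradient f v) = 0" for v using euler[OF g(1), of "gradient f v"] g(2) by (simp add: a)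
    then have "dotp (B v v) a = 0" for v by (simp add: gradient_eq[symmetric] dotp_simps dotp_commute)
    then have "a = 0" by (rule nondegenerate[OF polarization])
    then show False using nz a by simp
  qed
  then show ?thesis using that[OF _ g(1,2) nz] \<open>d \<noteq> 0\<close> by simp
qed

end


section \<open>The Perazzo map and its image\<close>

text \<open>\<open>d2\<close> gives \<open>gradient g\<close> positive degree, so \<open>w\<close>
  vanishes wherever the gradient of \<open>f\<close> does; \<open>relation_smooth\<close> says that
  \<open>w\<close> is not identically zero.\<close>

locale polar_relation = polar_hypersurface f for f :: "('n::finite, 'k::field_char_0) mpoly" +
  fixes g :: "('n, 'k) mpoly" and d :: nat
  assumes d2: "d \<ge> 2" and g: "homogeneous d g" and relation: "peval g (gradient f v) = 0"
    and relation_smooth: "\<exists>v. gradient g (gradient f v) \<noteq> 0"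
begin

definition w :: "'k^'n \<Rightarrow> 'k^'n" where
  "w v = gradient g (gradient f v)"

lemma hmap_w: "hmap ((d - 1) * 2) w"
  unfolding w_def by (rule hmap_compose[OF hmap_gradient[OF g] hmap_gradient_f])

lemma w_0: "w 0 = 0"
  using hmap_scale[OF hmap_w, of 0 0] d2 by (simp add: power_0_left)

definition polar_ideal :: "nat \<Rightarrow> ('n, 'k) mpoly \<Rightarrow> bool" where
  "polar_ideal e F \<longleftrightarrow> homogeneous e F \<and> (\<forall>v. peval F (gradient f v) = 0)"

lemma polar_ideal_g: "polar_ideal d g"
  by (simp add: polar_ideal_def g relation)

lemma polar_ideal_iff: "polar_ideal e F \<longleftrightarrow> homogeneous e F \<and> (\<forall>p\<in>polar_image f. vanishes_at F p)"
proof
  assume "polar_ideal e F"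
  then show "homogeneous e F \<and> (\<forall>p\<in>polar_image f. vanishes_at F p)"
    by (auto simp: polar_ideal_def polar_image_eq image_closure_def)
next
  assume F: "homogeneous e F \<and> (\<forall>p\<in>polar_image f. vanishes_at F p)"
  have 1: "peval F (gradient f v) = 0" if "gradient f v \<noteq> 0" for v
  proof -
    have "pt (gradient f v) \<in> polar_image f"
      unfolding polar_image_eq by (rule pt_in_image_closure[of v UNIV "gradient f"]) (use that in auto)
    then show ?thesis using F vanishes_at_pt[of e F] by blast
  qed
  have "peval F (gradient f v) = 0" for v
  proof (cases "gradient f v = 0")
    case True
    show ?thesis
    proof (cases "e = 0")
      case True
      obtain u where "gradient f u \<noteq> 0" using gradient_nonzero by blast
      then show ?thesis
        using 1[of u] homogeneous_0D[of F "gradient f v"] homogeneous_0D[of F "gradient f u"] F True by simp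
    next
      case False
      then show ?thesis using True hfun_at_0[OF hfun_peval, of e F] F by simp
    qed
  qed (rule 1)
  then show "polar_ideal e F" using F by (simp add: polar_ideal_def)
qed

text \<open>The derivative of the polar map is the Hessian. Differentiating \<open>F\<close> along
  the polar map makes the gradient of \<open>F\<close> orthogonal to the range of a symmetric
  matrix, hence a kernel vector.\<close>

lemma B_gradient_ideal:
  assumes "polar_ideal e F"
  shows "B v (gradient F (gradient f v)) = 0"
proof (rule dotp_nondegenerate)
  fix u
  have "jet (\<lambda>t. peval F (gradient f (v + t *s u))) (peval F (gradient f v))
      (dotp (gradient F (gradient f v)) (B v u))"
    by (rule jet_peval[OF vjet_gradient[OF vjet_line]])
  then have "jet (\<lambda>t. 0) (peval F (gradient f v)) (dotp (gradient F (gradient f v)) (B v u))"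
    using assms by (simp add: polar_ideal_def)
  then have "dotp (gradient F (gradient f v)) (B v u) = 0" by (rule jet_zero)
  then show "dotp (B v (gradient F (gradient f v))) u = 0"
    using dotp_B_commute[of v u] by (simp add: dotp_commute)
qed

lemma B_w: "B v (w v) = 0"
  unfolding w_def by (rule B_gradient_ideal[OF polar_ideal_g])

text \<open>The points at which the single vector \<open>w v\<close> accounts for the whole kernel
  of the Hessian.\<close>

definition good :: "'k^'n \<Rightarrow> bool" where
  "good v \<longleftrightarrow> vec.dim (Vert (H v)) = 1 \<and> w v \<noteq> 0"

lemma good_nonzero: "good v \<Longrightarrow> v \<noteq> 0"
  using w_0 by (auto simp: good_def)

lemma Vert_good:
  assumes "good v"
  shows "Vert (H v) = pt (w v)"
proof -
  have "w v \<in> Vert (H v)" using B_w by (simp add: Vert_iff)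
  then have "pt (w v) \<subseteq> Vert (H v)" by (intro vec.span_minimal subspace_Vert) auto
  moreover have "vec.dim (Vert (H v)) \<le> vec.dim (pt (w v))" using assms by (simp add: good_def)
  ultimately show ?thesis using vec.subspace_dim_equal[OF vec.subspace_span subspace_Vert] by blast
qed

lemma good_gradient: "good v \<Longrightarrow> gradient f v \<noteq> 0"
proof
  assume "good v" "gradient f v = 0"
  then have "w v = 0"
    using hmap_scale[OF hmap_gradient[OF g], of 0 0] d2 by (simp add: w_def power_0_left)
  then show False using \<open>good v\<close> by (simp add: good_def)
qed

text \<open>Corank one and \<open>w \<noteq> 0\<close> may be known at different points; the product
  of the two open conditions is still nonzero somewhere. The last clause serves the case of one
  given good point.\<close>

lemma good_open:
  assumes v0: "vec.dim (Vert (H v0)) = 1" "w v1 \<noteq> 0"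
  obtains m \<delta> where "hfun m \<delta>" "\<And>v. \<delta> v \<noteq> 0 \<Longrightarrow> good v" "\<exists>x. \<delta> x \<noteq> 0" "v0 = v1 \<Longrightarrow> \<delta> v0 \<noteq> 0"
proof -
  have km: "kernel_minimal v0"
    using dim_kernel_pos v0 by (simp add: kernel_minimal_def Suc_leI)
  obtain S where S: "complementary (Vert (H v0)) S" using complement_exists[OF subspace_Vert] by blast
  obtain \<delta> where \<delta>: "hfun CARD('n) \<delta>" "\<delta> v0 \<noteq> 0" "\<And>x. \<delta> x \<noteq> 0 \<Longrightarrow> Vert (H x) \<inter> S = {0}"
    using kernel_extension[of H, OF hfun_H kernel_minimal_nonzero[OF km] S] by metis
  obtain i where i: "w v1 $ i \<noteq> 0" using v0(2) by (auto simp: vec_eq_iff)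
  have h: "hfun (CARD('n) + (d - 1) * 2) (\<lambda>v. \<delta> v * w v $ i)" by (rule hfun_mult[OF \<delta>(1) hmapD[OF hmap_w]])
  show ?thesis
  proof (rule that[OF h])
    fix v assume v: "\<delta> v * w v $ i \<noteq> 0"
    then have "Vert (H v) \<inter> S = {0}" using \<delta>(3) by simp
    then have "vec.dim (Vert (H v)) + vec.dim S \<le> CARD('n)"
      using dim_direct_sum_le[OF subspace_Vert, of S "H v"] S
        vec_dim_le_card[of "{x + y |x y. x \<in> Vert (H v) \<and> y \<in> S}"]
      by (simp add: complementary_def)
    then have "vec.dim (Vert (H v)) = 1"
      using complementary_dim[OF S] v0(1) dim_kernel_pos[of v] by simp
    moreover have "w v \<noteq> 0" using v by auto
    ultimately show "good v" by (simp add: good_def)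
  next
    show "\<exists>x. \<delta> x * w x $ i \<noteq> 0"
    proof (rule ccontr)
      assume "\<nexists>x. \<delta> x * w x $ i \<noteq> 0"
      then have "\<forall>v\<in>UNIV. \<delta> v * w v $ i = 0" by blast
      from hfun_prod_zero[OF \<delta>(1) hmapD[OF hmap_w] vec.subspace_UNIV this] show False
        using \<delta>(2) i by blast
    qed
  next
    assume "v0 = v1"
    then show "\<delta> v0 * w v0 $ i \<noteq> 0" using \<delta>(2) i by simp
  qed
qed

lemma good_open_at:
  assumes "good v0"
  obtains m \<delta> where "hfun m \<delta>" "\<delta> v0 \<noteq> 0" "\<And>v. \<delta> v \<noteq> 0 \<Longrightarrow> good v"
  using good_open[of v0 v0] assms unfolding good_def by metis

lemma good_exists: "\<exists>v. good v"
proof -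
  obtain v0 where "kernel_minimal v0" using kernel_minimal_exists by blast
  moreover obtain v1 where "w v1 \<noteq> 0" using relation_smooth by (auto simp: w_def)
  ultimately show ?thesis using good_open[of v0 v1] kernel_minimal_dim(1) by metis
qed

lemma good_generic:
  assumes "hfun a F" "hfun b \<delta>" "\<delta> x \<noteq> 0" "\<And>v. good v \<Longrightarrow> \<delta> v \<noteq> 0 \<Longrightarrow> F v = 0"
  shows "F v = 0"
proof -
  obtain v0 where "good v0" using good_exists by blast
  then obtain m \<gamma> where \<gamma>: "hfun m \<gamma>" "\<gamma> v0 \<noteq> 0" "\<And>v. \<gamma> v \<noteq> 0 \<Longrightarrow> good v"
    using good_open_at by metis
  have prod: "\<delta> v * F v = 0" for v
    by (rule hfun_zero_generic[OF hfun_mult[OF assms(2,1)] \<gamma>(1) vec.subspace_UNIV UNIV_I \<gamma>(2)])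
      (use \<gamma>(3) assms(4) in auto)
  show ?thesis
  proof (rule hfun_zero_generic[OF assms(1,2) vec.subspace_UNIV UNIV_I assms(3) _ UNIV_I])
    show "F v = 0" if "\<delta> v \<noteq> 0" for v using prod[of v] that by simp
  qed
qed

lemma good_generic':
  assumes "hfun a F" "\<And>v. good v \<Longrightarrow> F v = 0"
  shows "F v = 0"
  by (rule good_generic[OF assms(1) hfun_const[of 1]]) (use assms(2) in auto)

lemma ideal_gradient_good:
  assumes "polar_ideal e F" "good v"
  obtains c where "gradient F (gradient f v) = c *s w v"
proof -
  have "gradient F (gradient f v) \<in> Vert (H v)" using B_gradient_ideal[OF assms(1)] by (simp add: Vert_iff)
  then show ?thesis using that Vert_good[OF assms(2)] by (auto simp: vec.span_singleton)
qed

text \<open>At polar images of good points both gradients lie in the line spanned by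
  \<open>w v\<close>, so the 2 by 2 minors vanish there. Minors are forms, and their vanishing
  passes to all of \<open>Z\<close>.\<close>

lemma ideal_gradients_parallel:
  assumes F: "polar_ideal e F" and G: "polar_ideal e' G" and x: "pt x \<in> polar_image f"
  shows "gradient F x $ i * gradient G x $ j = gradient F x $ j * gradient G x $ i"
proof -
  let ?m = "\<lambda>x. gradient F x $ i * gradient G x $ j - gradient F x $ j * gradient G x $ i"
  have hom: "hmap (e - 1) (gradient F)" "hmap (e' - 1) (gradient G)"
    using F G hmap_gradient by (auto simp: polar_ideal_def)
  have m: "hfun (e - 1 + (e' - 1)) ?m"
    by (intro hfun_diff hfun_mult hmapD[OF hom(1)] hmapD[OF hom(2)])
  have "?m (gradient f v) = 0" for v
  proof (rule good_generic'[OF hfun_compose[OF m hmap_gradient_f]])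
    fix v assume v: "good v"
    obtain a b where "gradient F (gradient f v) = a *s w v" "gradient G (gradient f v) = b *s w v"
      using ideal_gradient_good[OF F v] ideal_gradient_good[OF G v] by metis
    then show "?m (gradient f v) = 0" by simp
  qed
  then have "?m x = 0" by (rule image_closure_hfun[OF x[unfolded polar_image_eq] m])
  then show ?thesis by simp
qed

lemma tangent_space_polar:
  "tangent_space (polar_image f) (pt x) =
     {v. \<forall>F e. polar_ideal e F \<longrightarrow> dotp (gradient F x) v = 0}" (is "_ = ?T")
proof (intro subset_antisym subsetI)
  fix v assume "v \<in> tangent_space (polar_image f) (pt x)"
  then show "v \<in> ?T" unfolding tangent_space_def polar_ideal_iff using vec.span_base[of x "{x}"] by blast
next
  fix v assume v: "v \<in> ?T"
  have "dotp (gradient F u) v = 0" if F: "homogeneous e F" "\<forall>p\<in>polar_image f. vanishes_at F p" "u \<in> pt x" for F e u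
  proof -
    obtain c where "u = c *s x" using F(3) by (auto simp: vec.span_singleton)
    moreover have "dotp (gradient F x) v = 0" using v F polar_ideal_iff by blast
    ultimately show ?thesis by (simp add: hmap_scale[OF hmap_gradient[OF F(1)]] dotp_simps)
  qed
  then show "v \<in> tangent_space (polar_image f) (pt x)" unfolding tangent_space_def by blast
qed

lemma annihilator_hyperplane:
  assumes "a \<noteq> 0"
  shows "annihilator {v. dotp a v = 0} = pt a"
proof (intro subset_antisym subsetI)
  fix u assume "u \<in> annihilator {v. dotp a v = 0}"
  then show "u \<in> pt a"
    using orthogonal_hyperplane[OF assms, of u] by (auto simp: annihilator_def dotp_commute)
next
  fix u assume "u \<in> pt a"
  then show "u \<in> annihilator {v. dotp a v = 0}"
    by (auto simp: annihilator_def vec.span_singleton dotp_simps dotp_commute)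
qed

lemma tangent_space_smooth:
  assumes F: "polar_ideal e F" "gradient F x \<noteq> 0" and x: "pt x \<in> polar_image f"
  shows "tangent_space (polar_image f) (pt x) = {v. dotp (gradient F x) v = 0}"
proof -
  obtain j where j: "gradient F x $ j \<noteq> 0" using F(2) by (auto simp: vec_eq_iff)
  have "dotp (gradient G x) v = 0" if G: "polar_ideal e' G" and v: "dotp (gradient F x) v = 0" for G e' v
  proof -
    have "gradient G x = (gradient G x $ j / gradient F x $ j) *s gradient F x"
      using ideal_gradients_parallel[OF F(1) G x, of _ j] j by (simp add: vec_eq_iff field_simps)
    then show ?thesis using v by (metis dotp_scale_left mult_zero_right)
  qed
  then show ?thesis unfolding tangent_space_polar using F(1) by blast
qed

text \<open>Since gradients of equations of \<open>Z\<close> are parallel, the tangent space is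
  either everything or the hyperplane cut out by any single nonzero gradient. Only the latter has
  the dimension of \<open>Z\<close>.\<close>

lemma smooth_polar:
  assumes x: "pt x \<in> polar_image f"
  shows "pt x \<in> smooth_locus (polar_image f) \<longleftrightarrow> (\<exists>F e. polar_ideal e F \<and> gradient F x \<noteq> 0)"
proof
  assume smooth: "pt x \<in> smooth_locus (polar_image f)"
  show "\<exists>F e. polar_ideal e F \<and> gradient F x \<noteq> 0"
  proof (rule ccontr)
    assume "\<not> ?thesis"
    then have "tangent_space (polar_image f) (pt x) = UNIV" unfolding tangent_space_polar by auto
    then show False using smooth codim_one by (simp add: smooth_locus_def proj_dim_def card_cart_basis)
  qed
next
  assume "\<exists>F e. polar_ideal e F \<and> gradient F x \<noteq> 0"
  then obtain F e where F: "polar_ideal e F" "gradient F x \<noteq> 0" by blast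
  have "vec.dim (tangent_space (polar_image f) (pt x)) = CARD('n) - 1"
    unfolding tangent_space_smooth[OF F x] by (rule hyperplane_dim[OF F(2)])
  then show "pt x \<in> smooth_locus (polar_image f)"
    using x codim_one by (simp add: smooth_locus_def proj_dim_def)
qed

lemma conormal_polar:
  assumes "polar_ideal e F" "gradient F x \<noteq> 0" "pt x \<in> polar_image f"
  shows "annihilator (tangent_space (polar_image f) (pt x)) = pt (gradient F x)"
  unfolding tangent_space_smooth[OF assms] by (rule annihilator_hyperplane[OF assms(2)])

lemma pt_gradient_in_polar_image: "gradient f v \<noteq> 0 \<Longrightarrow> pt (gradient f v) \<in> polar_image f"
  unfolding polar_image_eq by (rule pt_in_image_closure[of v UNIV "gradient f"]) auto

lemma perazzo_dom_good: "good v \<Longrightarrow> pt v \<in> perazzo_dom f"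
  unfolding perazzo_dom_def using good_nonzero[of v] good_gradient[of v] polar_ideal_g
  by (auto simp: polar_map_pt smooth_polar pt_gradient_in_polar_image good_def w_def)

lemma perazzo_map_good:
  assumes "good v"
  shows "perazzo_map f (pt v) = pt (w v)"
  unfolding perazzo_map_def polar_map_pt w_def
  by (rule conormal_polar[OF polar_ideal_g])
    (use assms good_gradient pt_gradient_in_polar_image in \<open>auto simp: good_def w_def\<close>)

lemma perazzo_domE:
  assumes "p \<in> perazzo_dom f"
  obtains v F e where "v \<noteq> 0" "p = pt v" "polar_ideal e F" "gradient F (gradient f v) \<noteq> 0"
    "pt (gradient f v) \<in> polar_image f" "perazzo_map f p = pt (gradient F (gradient f v))"
proof -
  have p: "p \<in> PN" "polar_map f p \<in> smooth_locus (polar_image f)"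
    using assms by (auto simp: perazzo_dom_def)
  obtain v where v: "v \<noteq> 0" "p = pt v" using p(1) by (rule PN_cases)
  have Z: "pt (gradient f v) \<in> polar_image f" using p(2) v by (simp add: polar_map_pt smooth_locus_def)
  then obtain F e where F: "polar_ideal e F" "gradient F (gradient f v) \<noteq> 0"
    using smooth_polar[OF Z] p(2) v by (auto simp: polar_map_pt)
  show ?thesis
    using that[OF v F Z] conormal_polar[OF F Z] by (simp add: perazzo_map_def v polar_map_pt)
qed

text \<open>At a smooth point of \<open>Z\<close> the gradient of \<open>g\<close> itself may
  vanish, and another \<open>F\<close> describes the tangent space. Its gradient is parallel to
  \<open>w\<close> at good points, and the equations of \<open>W\<close> extend from there to
  \<open>Z\<close>.\<close>

lemma conormal_in_image_closure:
  assumes F: "polar_ideal e F" "gradient F x \<noteq> 0" and x: "pt x \<in> polar_image f"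
  shows "pt (gradient F x) \<in> image_closure w UNIV"
proof -
  have "peval G (gradient F x) = 0" if G: "homogeneous e' G" "\<forall>s\<in>UNIV. peval G (w s) = 0" for G e'
  proof (rule image_closure_hfun[OF x[unfolded polar_image_eq]])
    have hF: "hmap (e - 1) (gradient F)" using F(1) hmap_gradient by (auto simp: polar_ideal_def)
    show h: "hfun (e' * (e - 1)) (\<lambda>x. peval G (gradient F x))" by (rule hfun_compose[OF hfun_peval[OF G(1)] hF])
    show "peval G (gradient F (gradient f s)) = 0" for s
    proof (rule good_generic'[OF hfun_compose[OF h hmap_gradient_f]])
      fix v assume "good v"
      then obtain c where "gradient F (gradient f v) = c *s w v" using ideal_gradient_good[OF F(1)] by blast
      then show "peval G (gradient F (gradient f v)) = 0" using G by (simp add: peval_scale)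
    qed
  qed
  then show ?thesis using F(2) by (auto simp: image_closure_def vanishes_at_pt)
qed

lemma proj_pts_pt: "a \<noteq> 0 \<Longrightarrow> proj_pts (pt a) = {pt a}"
  by (auto simp: proj_pts_def dest: pt_memD intro: vec.span_base)

lemma
  shows perazzo_image_eq: "perazzo_image f = image_closure w UNIV"
    and dual_variety_eq: "dual_variety (polar_image f) = image_closure w UNIV"
proof -
  obtain v0 where v0: "good v0" using good_exists by blast
  then obtain m \<delta> where \<delta>: "hfun m \<delta>" "\<delta> v0 \<noteq> 0" "\<And>v. \<delta> v \<noteq> 0 \<Longrightarrow> good v" using good_open_at by metis
  have w0: "w v0 \<noteq> 0" using v0 by (simp add: good_def)
  show "perazzo_image f = image_closure w UNIV"
    unfolding perazzo_image_def
  proof (rule closure_eq_image_closure[OF hmap_w vec.subspace_UNIV \<delta>(1) UNIV_I \<delta>(2) w0])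
    show "perazzo_map f ` perazzo_dom f \<subseteq> image_closure w UNIV"
    proof (rule image_subsetI)
      fix p assume "p \<in> perazzo_dom f"
      then show "perazzo_map f p \<in> image_closure w UNIV"
        by (rule perazzo_domE) (simp add: conormal_in_image_closure)
    qed
    fix s assume "\<delta> s \<noteq> 0"
    then have "good s" by (rule \<delta>(3))
    then show "pt (w s) \<in> perazzo_map f ` perazzo_dom f"
      using perazzo_dom_good perazzo_map_good by (metis imageI)
  qed
  show "dual_variety (polar_image f) = image_closure w UNIV"
    unfolding dual_variety_def
  proof (rule closure_eq_image_closure[OF hmap_w vec.subspace_UNIV \<delta>(1) UNIV_I \<delta>(2) w0])
    show "(\<Union>z\<in>smooth_locus (polar_image f). proj_pts (annihilator (tangent_space (polar_image f) z)))
        \<subseteq> image_closure w UNIV"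
    proof (rule UN_least)
      fix z assume z: "z \<in> smooth_locus (polar_image f)"
      then have "z \<in> polar_image f" by (simp add: smooth_locus_def)
      then have "z \<in> PN" using polar_image_eq image_closure_subset_PN by blast
      then obtain x where x: "z = pt x" by (rule PN_cases)
      then obtain F e where F: "polar_ideal e F" "gradient F x \<noteq> 0"
        using z \<open>z \<in> polar_image f\<close> smooth_polar by blast
      show "proj_pts (annihilator (tangent_space (polar_image f) z)) \<subseteq> image_closure w UNIV"
        using conormal_polar[OF F] conormal_in_image_closure[OF F] \<open>z \<in> polar_image f\<close> F(2)
        by (simp add: x proj_pts_pt)
    qed
    fix s assume "\<delta> s \<noteq> 0"
    then have s: "good s" by (rule \<delta>(3))
    have gs: "gradient g (gradient f s) \<noteq> 0" using s by (simp add: good_def w_def)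
    have Z: "pt (gradient f s) \<in> polar_image f" using pt_gradient_in_polar_image good_gradient[OF s] by blast
    have "pt (gradient f s) \<in> smooth_locus (polar_image f)" using smooth_polar[OF Z] polar_ideal_g gs by blast
    moreover have "pt (w s) \<in> proj_pts (annihilator (tangent_space (polar_image f) (pt (gradient f s))))"
      unfolding conormal_polar[OF polar_ideal_g gs Z] using gs by (simp add: w_def proj_pts_pt)
    ultimately show "pt (w s) \<in> (\<Union>z\<in>smooth_locus (polar_image f). proj_pts (annihilator (tangent_space (polar_image f) z)))"
      by blast
  qed
qed


subsection \<open>Dimension of the dual variety\<close>

definition fiber_minimal :: "'k^'n \<Rightarrow> bool" where
  "fiber_minimal v \<longleftrightarrow> good v \<and> (\<forall>u. good u \<longrightarrow> vec.dim (Vert (H (w v))) \<le> vec.dim (Vert (H (w u))))"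

lemma fiber_minimal_exists: "\<exists>v. fiber_minimal v"
  unfolding fiber_minimal_def
  using good_exists ex_has_least_nat[of good _ "\<lambda>v. vec.dim (Vert (H (w v)))"] by blast

lemma mem_Vert_commute: "x \<in> Vert (H y) \<longleftrightarrow> y \<in> Vert (H x)"
  using B_commute[of x y] by (simp add: Vert_iff)

lemma v_in_fiber: "v \<in> Vert (H (w v))"
  using B_w[of v] mem_Vert_commute[of v] by (simp add: Vert_iff)

text \<open>Symmetry of \<open>B\<close> puts \<open>x\<close> in the kernel of the Hessian at
  \<open>p\<close>, which is the line of \<open>w p\<close>. For \<open>x \<noteq> 0\<close>, all
  good points of \<open>Vert (H x)\<close> thus have the same Perazzo image.\<close>

lemma good_fiber:
  assumes "good p" "p \<in> Vert (H x)"
  obtains c where "x = c *s w p"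
  using assms Vert_good[OF assms(1)] mem_Vert_commute[of p x] by (auto simp: vec.span_singleton)

text \<open>
  A rational section of the family of fibres, through \<open>v0\<close>, with values in \<open>k v0 + S\<close>.
\<close>

lemma fiber_section:
  assumes v0: "fiber_minimal v0" and S: "complementary (Vert (H (w v0))) S"
  obtains \<gamma> Y where "hfun CARD('n) \<gamma>" "hmap CARD('n) Y" "\<gamma> (w v0) \<noteq> 0" "Y (w v0) = \<gamma> (w v0) *s v0"
    "\<And>v. B (w v) (Y (w v)) = 0"
    "\<And>v. good v \<Longrightarrow> \<gamma> (w v) \<noteq> 0 \<Longrightarrow> Vert (H (w v)) \<inter> S = {0} \<and> Y (w v) - \<gamma> (w v) *s v0 \<in> S"
proof -
  have good: "good v0" using v0 by (simp add: fiber_minimal_def)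
  then have w0: "w v0 \<noteq> 0" by (simp add: good_def)
  obtain \<gamma> where \<gamma>: "hfun CARD('n) \<gamma>" "\<gamma> (w v0) \<noteq> 0" "\<And>x. \<gamma> x \<noteq> 0 \<Longrightarrow> Vert (H x) \<inter> S = {0}"
    and ext: "\<And>p. \<exists>Y. hmap CARD('n) Y \<and>
      (\<forall>x. \<gamma> x \<noteq> 0 \<and> vec.dim (Vert (H (w v0))) \<le> vec.dim (Vert (H x)) \<longrightarrow>
        B x (Y x) = 0 \<and> Y x - \<gamma> x *s p \<in> S)"
    using kernel_extension[of H, OF hfun_H w0 S] by metis
  obtain Y where Y: "hmap CARD('n) Y"
    "\<And>x. \<gamma> x \<noteq> 0 \<Longrightarrow> vec.dim (Vert (H (w v0))) \<le> vec.dim (Vert (H x)) \<Longrightarrow>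
        B x (Y x) = 0 \<and> Y x - \<gamma> x *s v0 \<in> S"
    using ext[of v0] by blast
  have Yw: "B (w v) (Y (w v)) = 0 \<and> Y (w v) - \<gamma> (w v) *s v0 \<in> S" if "good v" "\<gamma> (w v) \<noteq> 0" for v
    using Y(2)[of "w v"] that v0 by (simp add: fiber_minimal_def)
  have BY: "B (w v) (Y (w v)) = 0" for v
  proof -
    have "B (w v) (Y (w v)) $ i = 0" for i
      by (rule good_generic[OF hmapD[OF hmap_B[OF hmap_w hmap_compose[OF Y(1) hmap_w]]]
            hfun_compose[OF \<gamma>(1) hmap_w] \<gamma>(2)]) (use Yw in auto)
    then show ?thesis by (simp add: vec_eq_iff)
  qed
  have "Y (w v0) - \<gamma> (w v0) *s v0 \<in> Vert (H (w v0))"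
    using BY[of v0] v_in_fiber[of v0] by (simp add: Vert_iff B_simps)
  then have "Y (w v0) - \<gamma> (w v0) *s v0 \<in> Vert (H (w v0)) \<inter> S" using Yw[OF good \<gamma>(2)] by blast
  then have "Y (w v0) - \<gamma> (w v0) *s v0 \<in> {0}" using \<gamma>(3)[OF \<gamma>(2)] by (simp only:)
  then have "Y (w v0) = \<gamma> (w v0) *s v0" by simp
  then show ?thesis using that[OF \<gamma>(1) Y(1) \<gamma>(2) _ BY] \<gamma>(3) Yw by blast
qed

lemma flag_exists:
  fixes S :: "('a::field^'m::finite) set"
  assumes "vec.subspace S" "v0 \<in> S" "v0 \<noteq> 0" "Suc r \<le> vec.dim S"
  shows "\<exists>T. (\<forall>i\<le>r. vec.subspace (T i) \<and> v0 \<in> T i \<and> T i \<subseteq> S \<and> vec.dim (T i) = Suc i) \<and> (\<forall>i<r. T i \<subset> T (Suc i))"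
  using assms(4)
proof (induction r)
  case 0
  have "pt v0 \<subseteq> S" using assms(1,2) by (intro vec.span_minimal) auto
  then show ?case using assms(3) by (intro exI[of _ "\<lambda>_. pt v0"]) (auto simp: vec.span_base)
next
  case (Suc r)
  then obtain T where T: "\<And>i. i \<le> r \<Longrightarrow> vec.subspace (T i) \<and> v0 \<in> T i \<and> T i \<subseteq> S \<and> vec.dim (T i) = Suc i"
    "\<And>i. i < r \<Longrightarrow> T i \<subset> T (Suc i)" by (metis Suc_leD)
  have Tr: "vec.subspace (T r)" "v0 \<in> T r" "T r \<subseteq> S" "vec.dim (T r) = Suc r" using T(1)[of r] by simp_all
  have "\<not> S \<subseteq> T r" using vec.dim_subset[of S "T r"] Tr Suc.prems by auto
  then obtain x where x: "x \<in> S" "x \<notin> T r" by blast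
  let ?U = "vec.span (insert x (T r))"
  have "T r \<subset> ?U" using x(2) vec.span_base[of _ "insert x (T r)"] by blast
  moreover have "?U \<subseteq> S" using assms(1) x Tr by (intro vec.span_minimal) auto
  moreover have "vec.dim ?U = Suc (Suc r)"
    using x(2) Tr(4) vec.dim_insert[of x "T r"] vec.span_eq_iff[THEN iffD2, OF Tr(1)] by simp
  ultimately show ?case
    using T Tr by (intro exI[of _ "T(Suc r := ?U)"]) (auto simp: le_Suc_eq less_Suc_eq vec.span_base)
qed

text \<open>\<open>T\<close>, spanned by \<open>v0\<close> and a complement \<open>S\<close> of the
  fibre, meets a general fibre in one projective point, found by the section \<open>Y\<close>. So
  \<open>T\<close> sweeps out \<open>W\<close>, which gives the upper bound, and a flag in
  \<open>T\<close> has strictly increasing images, which gives the lower one.\<close>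

lemma dim_dual_variety:
  assumes v0: "fiber_minimal v0"
  shows "variety_dim (image_closure w UNIV) + vec.dim (Vert (H (w v0))) = CARD('n)"
proof -
  have good: "good v0" using v0 by (simp add: fiber_minimal_def)
  then have w0: "w v0 \<noteq> 0" and v0_nz: "v0 \<noteq> 0" using good_nonzero by (simp_all add: good_def)
  obtain m \<delta> where \<delta>: "hfun m \<delta>" "\<delta> v0 \<noteq> 0" "\<And>v. \<delta> v \<noteq> 0 \<Longrightarrow> good v" using good good_open_at by metis
  obtain S where S: "complementary (Vert (H (w v0))) S" using complement_exists[OF subspace_Vert] by blast
  then have S': "vec.subspace S" by (simp add: complementary_def)
  obtain \<gamma> Y where \<gamma>: "hfun CARD('n) \<gamma>" "\<gamma> (w v0) \<noteq> 0"
    and Y: "hmap CARD('n) Y" "Y (w v0) = \<gamma> (w v0) *s v0" "\<And>v. B (w v) (Y (w v)) = 0"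
    "\<And>v. good v \<Longrightarrow> \<gamma> (w v) \<noteq> 0 \<Longrightarrow> Vert (H (w v)) \<inter> S = {0} \<and> Y (w v) - \<gamma> (w v) *s v0 \<in> S"
    using fiber_section[OF v0 S] by metis
  define T where "T = vec.span (insert v0 S)"
  have T: "vec.subspace T" unfolding T_def by (rule vec.subspace_span)
  have T_iff: "x \<in> T \<longleftrightarrow> (\<exists>k. x - k *s v0 \<in> S)" for x
    unfolding T_def vec.span_breakdown_eq vec.span_eq_iff[THEN iffD2, OF S'] ..
  have v0T: "v0 \<in> T" by (simp add: T_def vec.span_base)
  have v0S: "v0 \<notin> S"
  proof
    assume "v0 \<in> S"
    then have "v0 \<in> Vert (H (w v0)) \<inter> S" using v_in_fiber by blast
    then show False using S v0_nz unfolding complementary_def by blast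
  qed
  have dimT: "vec.dim T = Suc (vec.dim S)"
    using v0S vec.dim_insert[of v0 S] vec.span_eq_iff[THEN iffD2, OF S'] by (simp add: T_def)
  have sub: "image_closure w UNIV \<subseteq> image_closure w T"
  proof
    fix p assume p: "p \<in> image_closure w UNIV"
    have "vanishes_at F p" if F: "homogeneous e F" "\<forall>s\<in>T. peval F (w s) = 0" for F e
    proof -
      have "peval F (w v) = 0" for v
      proof (rule good_generic[OF hfun_compose[OF hfun_peval[OF F(1)] hmap_w]
            hfun_mult[OF hfun_compose[OF \<gamma>(1) hmap_w]
              hfun_compose[OF \<delta>(1) hmap_compose[OF Y(1) hmap_w]]]])
        show "\<gamma> (w v0) * \<delta> (Y (w v0)) \<noteq> 0" using \<gamma>(2) \<delta>(2) hfun_scale[OF \<delta>(1)] by (simp add: Y(2))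
        fix v assume v: "good v" "\<gamma> (w v) * \<delta> (Y (w v)) \<noteq> 0"
        \<comment> \<open>\<open>Y (w v)\<close> is a good point of the fibre through
          \<open>v\<close>, so \<open>w\<close> takes the same value there up to a scalar; and it
          lies in \<open>T\<close>.\<close>
        then have "good (Y (w v))" using \<delta>(3) by simp
        moreover have "Y (w v) \<in> Vert (H (w v))" using Y(3) by (simp add: Vert_iff)
        ultimately obtain c where c: "w v = c *s w (Y (w v))" using good_fiber by blast
        have "Y (w v) \<in> T" using Y(4)[OF v(1)] v(2) T_iff by auto
        then have "peval F (w (Y (w v))) = 0" using F(2) by blast
        then show "peval F (w v) = 0" by (subst c) (simp add: peval_scale[OF F(1)])
      qed
      then show ?thesis using p F(1) by (auto simp: image_closure_def)
    qed
    then show "p \<in> image_closure w T" using p by (auto simp: image_closure_def)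
  qed
  have upper: "variety_dim (image_closure w UNIV) < Suc (vec.dim S)"
    using variety_dim_le[OF hmap_w T _ sub] dimT by simp
  \<comment> \<open>Both \<open>s\<close> and \<open>Y (w s)\<close> lie in the fibre and in
    \<open>T\<close>. The combination that cancels \<open>v0\<close> lies in \<open>S\<close> as
    well as in the fibre, hence is 0; so \<open>Y\<close> inverts \<open>w\<close> on
    \<open>T\<close> up to scalars.\<close>
  have parallel: "\<gamma> (w s) *s s = k *s Y (w s)" if "good s" "\<gamma> (w s) \<noteq> 0" "s - k *s v0 \<in> S" for s k
  proof -
    have "k *s (Y (w s) - \<gamma> (w s) *s v0) - \<gamma> (w s) *s (s - k *s v0) \<in> S"
      by (intro vec.subspace_diff[OF S'] vec.subspace_scale[OF S'] conjunct2[OF Y(4)[OF that(1,2)]] that(3))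
    then have "k *s Y (w s) - \<gamma> (w s) *s s \<in> S"
      by (simp add: vec.scale_right_diff_distrib mult.commute)
    moreover have "k *s Y (w s) - \<gamma> (w s) *s s \<in> Vert (H (w s))"
      using Y(3)[of s] v_in_fiber[of s] by (simp add: Vert_iff B_simps)
    ultimately have "k *s Y (w s) - \<gamma> (w s) *s s \<in> Vert (H (w s)) \<inter> S" by blast
    then have "k *s Y (w s) - \<gamma> (w s) *s s \<in> {0}" using Y(4)[OF that(1,2)] by (simp only:)
    then show ?thesis by simp
  qed
  \<comment> \<open>A linear form \<open>a\<close> that vanishes on \<open>A\<close>, composed with
    \<open>Y\<close>, vanishes on the image of \<open>A\<close>. If it also vanished on the image of
    \<open>A'\<close>, then \<open>a\<close> would vanish on \<open>A'\<close>, again because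
    \<open>Y\<close> inverts \<open>w\<close>.\<close>
  have strict: "image_closure w A \<subset> image_closure w A'"
    if A: "vec.subspace A" "v0 \<in> A" "A \<subset> A'" "vec.subspace A'" "A' \<subseteq> T" for A A'
  proof -
    obtain x where x: "x \<in> A'" "x \<notin> A" using A(3) by blast
    obtain a where a: "\<And>u. u \<in> A \<Longrightarrow> dotp a u = 0" "dotp a x = 1" using separating_form[OF A(1) x(2)] by blast
    let ?G = "\<lambda>y. dotp a (Y y)"
    have G: "hfun CARD('n) ?G" by (rule hfun_dotp_const[OF Y(1)])
    note gen = hfun_mult[OF \<delta>(1) hfun_compose[OF \<gamma>(1) hmap_w]]
    have nz: "\<delta> v0 * \<gamma> (w v0) \<noteq> 0" using \<gamma>(2) \<delta>(2) by simp
    have GA: "?G (w s) = 0" if "s \<in> A" for s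
    proof (rule hfun_zero_generic[OF hfun_compose[OF G hmap_w] gen A(1,2) nz _ that])
      fix s assume s: "s \<in> A" "\<delta> s * \<gamma> (w s) \<noteq> 0"
      then have gs: "good s" "\<gamma> (w s) \<noteq> 0" using \<delta>(3) by auto
      obtain k where k: "s - k *s v0 \<in> S" using s(1) A T_iff by blast
      have par: "\<gamma> (w s) *s s = k *s Y (w s)" by (rule parallel[OF gs k])
      then have "k \<noteq> 0" using gs good_nonzero[OF gs(1)] by auto
      moreover have "k * dotp a (Y (w s)) = 0"
        using a(1)[OF s(1)] arg_cong[OF par, of "dotp a"] by (simp add: dotp_simps)
      ultimately show "?G (w s) = 0" by simp
    qed
    have "\<not> image_closure w A' \<subseteq> image_closure w A"
    proof
      assume le: "image_closure w A' \<subseteq> image_closure w A"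
      have "dotp a s = 0" if "s \<in> A'" for s
      proof (rule hfun_zero_generic[OF hfun_dotp_const[OF hmap_ident] gen A(4) _ nz _ that])
        show "v0 \<in> A'" using A by blast
        fix s assume s: "s \<in> A'" "\<delta> s * \<gamma> (w s) \<noteq> 0"
        then have gs: "good s" "\<gamma> (w s) \<noteq> 0" using \<delta>(3) by auto
        obtain k where k: "s - k *s v0 \<in> S" using s(1) A T_iff by blast
        have "pt (w s) \<in> image_closure w A"
          using le pt_in_image_closure[of s A' w] s(1) gs(1) by (auto simp: good_def)
        then have "?G (w s) = 0" by (rule image_closure_hfun[OF _ G GA])
        then have "\<gamma> (w s) * dotp a s = 0"
          using arg_cong[OF parallel[OF gs k], of "dotp a"] by (simp add: dotp_simps)
        then show "dotp a s = 0" using gs(2) by simp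
      qed
      then show False using x(1) a(2) by simp
    qed
    then show ?thesis using image_closure_mono[of A A' w] A(3) by blast
  qed
  obtain Tf where Tf: "\<And>i. i \<le> vec.dim S \<Longrightarrow> vec.subspace (Tf i) \<and> v0 \<in> Tf i \<and> Tf i \<subseteq> T"
    "\<And>i. i < vec.dim S \<Longrightarrow> Tf i \<subset> Tf (Suc i)"
    using flag_exists[OF T v0T v0_nz, of "vec.dim S"] dimT by auto
  have "variety_chain (image_closure w UNIV) (vec.dim S) (\<lambda>i. image_closure w (Tf i))"
    unfolding variety_chain_def
  proof (intro conjI allI impI)
    fix i assume "i \<le> vec.dim S"
    then have i: "vec.subspace (Tf i)" "v0 \<in> Tf i" using Tf(1) by auto
    show "closedin zariski (image_closure w (Tf i))" by (rule closedin_image_closure)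
    show "irreducible_set zariski (image_closure w (Tf i))" by (rule irreducible_image_closure[OF hmap_w i w0])
    show "image_closure w (Tf i) \<subseteq> image_closure w UNIV" by (rule image_closure_mono) simp
  next
    fix i assume "i < vec.dim S"
    then show "image_closure w (Tf i) \<subset> image_closure w (Tf (Suc i))"
      using Tf(1)[of i] Tf(1)[of "Suc i"] Tf(2)[of i] by (intro strict) auto
  qed
  then have "vec.dim S \<le> variety_dim (image_closure w UNIV)"
    using variety_dim_ge[OF hmap_w T _ sub] dimT by simp
  then show ?thesis using upper complementary_dim[OF S] by simp
qed

end


section \<open>General fibres of the Perazzo map\<close>

lemma closedin_proj_pts:
  assumes "vec.subspace U"
  shows "closedin zariski (proj_pts U)"
proof -
  have "\<exists>F e. homogeneous e F \<and> (\<forall>q\<in>proj_pts U. vanishes_at F q) \<and> \<not> vanishes_at F p"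
    if p: "p \<in> PN - proj_pts U" for p
  proof -
    obtain v where v: "v \<noteq> 0" "p = pt v" using p by (meson DiffD1 PN_cases)
    then have "v \<notin> U" using p pt_in_proj_pts[OF assms v(1)] by blast
    then obtain a where a: "\<And>u. u \<in> U \<Longrightarrow> dotp a u = 0" "dotp a v = 1" using separating_form[OF assms] by blast
    obtain F where F: "homogeneous 1 F" "(\<lambda>x. dotp a x) = peval F"
      using hfun_dotp_const[OF hmap_ident, of a] by (auto simp: hfun_def)
    have F': "peval F x = dotp a x" for x using fun_cong[OF F(2), of x] by simp
    have "\<forall>q\<in>proj_pts U. vanishes_at F q"
      using a(1) F' vanishes_at_pt[OF F(1)] by (auto simp: proj_pts_def)
    moreover have "\<not> vanishes_at F p" using a(2) F' vanishes_at_pt[OF F(1), of v] v by simp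
    ultimately show ?thesis using F(1) by blast
  qed
  then show ?thesis unfolding closedin_zariski using proj_pts_subset_PN by blast
qed

lemma proj_pts_mono_iff:
  assumes "vec.subspace A" "vec.subspace A'"
  shows "proj_pts A \<subseteq> proj_pts A' \<longleftrightarrow> A \<subseteq> A'"
proof
  assume le: "proj_pts A \<subseteq> proj_pts A'"
  show "A \<subseteq> A'"
  proof
    fix v assume "v \<in> A"
    then show "v \<in> A'"
      using le pt_in_proj_pts[OF assms(1)] pt_in_proj_pts[OF assms(2)] vec.subspace_0[OF assms(2)]
      by (cases "v = 0") auto
  qed
qed (auto simp: proj_pts_def)

lemma rank_symmetric_ge:
  fixes A :: "'k::field^'n^'n::finite"
  assumes "transpose A = A"
  shows "vec.dim (range ((*v) A)) \<le> rank A"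
proof -
  have "range ((*v) A) \<subseteq> vec.span (columns A)"
  proof (rule image_subsetI)
    fix x
    have "A *v x = (\<Sum>i\<in>UNIV. x $ i *s column i A)" by (rule matrix_mult_sum)
    also have "\<dots> \<in> vec.span (columns A)"
      by (intro vec.span_sum vec.span_scale vec.span_base) (auto simp: columns_def)
    finally show "A *v x \<in> vec.span (columns A)" .
  qed
  then have "vec.dim (range ((*v) A)) \<le> vec.dim (columns A)" by (rule vec.dim_mono)
  also have "columns A = rows A" using columns_transpose[of A] assms by simp
  finally show ?thesis by (simp add: row_rank_def_gen)
qed

context cubic
begin

lemma transpose_H: "transpose (H v) = H v"
proof -
  have "H v $ i $ j = H v $ j $ i" for i j unfolding H_nth using tc_commute(1)[of i j] by simp
  then show ?thesis by (simp add: transpose_def vec_eq_iff)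
qed

end

context polar_relation
begin

definition common_kernel :: "('k^'n) set" where
  "common_kernel = {u. \<forall>v. B u (w v) = 0}"

definition image_span :: "('k^'n) set" where
  "image_span = vec.span (range w)"

abbreviation W :: "('k^'n) set set" where
  "W \<equiv> image_closure w UNIV"

lemma subspace_common_kernel: "vec.subspace common_kernel"
  unfolding common_kernel_def by (rule vec.subspaceI) (auto simp: B_simps)

lemma common_kernel_subset: "common_kernel \<subseteq> Vert (H (w v))"
  using B_commute by (auto simp: common_kernel_def Vert_iff)

lemma subspace_image_span: "vec.subspace image_span"
  unfolding image_span_def by (rule vec.subspace_span)

lemma w_in_image_span: "w v \<in> image_span"
  unfolding image_span_def by (rule vec.span_base) simp

lemma B_kernel_span:
  assumes "u \<in> common_kernel" "m \<in> image_span"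
  shows "B u m = 0"
proof -
  have "image_span \<subseteq> Vert (H u)"
    unfolding image_span_def using assms(1)
    by (intro vec.span_minimal subspace_Vert) (auto simp: common_kernel_def Vert_iff)
  then show ?thesis using assms(2) by (auto simp: Vert_iff)
qed

lemma subspace_zero_generic:
  assumes U: "vec.subspace U" and \<delta>: "hfun b \<delta>" "\<delta> x \<noteq> 0"
    and gen: "\<And>v. good v \<Longrightarrow> \<delta> v \<noteq> 0 \<Longrightarrow> w v \<in> U"
  shows "w v \<in> U"
proof (rule ccontr)
  assume "w v \<notin> U"
  then obtain a where a: "\<And>u. u \<in> U \<Longrightarrow> dotp a u = 0" "dotp a (w v) = 1" using separating_form[OF U] by blast
  have "dotp a (w v) = 0"
    by (rule good_generic[OF hfun_dotp_const[OF hmap_w] \<delta>]) (use gen a(1) in blast)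
  then show False using a(2) by simp
qed

text \<open>Valid over every point, not only a general one: the value of the Perazzo map at
  \<open>v\<close> is always a kernel vector of the Hessian at \<open>v\<close>, and a linear space
  is closed.\<close>

lemma perazzo_fiber_subset:
  assumes "x \<noteq> 0"
  shows "perazzo_fiber f (pt x) \<subseteq> proj_pts (Vert (H x))"
  unfolding perazzo_fiber_def
proof (rule closure_of_minimal[OF _ closedin_proj_pts[OF subspace_Vert]], rule subsetI)
  fix p assume p: "p \<in> {p \<in> perazzo_dom f. perazzo_map f p = pt x}"
  then have "p \<in> perazzo_dom f" by simp
  then obtain v F e where v: "v \<noteq> 0" "p = pt v" "polar_ideal e F"
    "perazzo_map f p = pt (gradient F (gradient f v))" by (rule perazzo_domE)
  have "x \<in> pt (gradient F (gradient f v))" using p v(4) vec.span_base[of x "{x}"] by simp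
  then obtain c where "x = c *s gradient F (gradient f v)" by (auto simp: vec.span_singleton)
  then have "B v x = 0" using B_gradient_ideal[OF v(3)] by (simp add: B_simps)
  then have "v \<in> Vert (H x)" using B_commute[of v x] by (simp add: Vert_iff)
  then show "p \<in> proj_pts (Vert (H x))" using v by (auto simp: proj_pts_def)
qed

text \<open>Once the linear space contains a point with \<open>\<delta> \<noteq> 0\<close>, such
  points are dense in it, and being good they are all mapped to \<open>pt x\<close>.\<close>

lemma perazzo_fiber_eq:
  assumes x: "x \<noteq> 0" and \<delta>: "hfun m \<delta>" "\<And>v. \<delta> v \<noteq> 0 \<Longrightarrow> good v" and p: "p \<in> Vert (H x)" "\<delta> p \<noteq> 0"
  shows "perazzo_fiber f (pt x) = proj_pts (Vert (H x))"
proof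
  let ?A = "{p \<in> perazzo_dom f. perazzo_map f p = pt x}"
  have A: "?A \<subseteq> PN" by (auto simp: perazzo_dom_def)
  show "proj_pts (Vert (H x)) \<subseteq> perazzo_fiber f (pt x)"
    unfolding perazzo_fiber_def
  proof
    fix q assume "q \<in> proj_pts (Vert (H x))"
    then obtain u where u: "q = pt u" "u \<in> Vert (H x)" "u \<noteq> 0" by (auto simp: proj_pts_def)
    have "vanishes_at F q" if F: "homogeneous e F" "\<forall>a\<in>?A. vanishes_at F a" for F e
    proof -
      have "peval F u = 0"
      proof (rule hfun_zero_generic[OF hfun_peval[OF F(1)] \<delta>(1) subspace_Vert p _ u(2)])
        fix v assume v: "v \<in> Vert (H x)" "\<delta> v \<noteq> 0"
        then have gv: "good v" by (intro \<delta>(2))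
        obtain c where c: "x = c *s w v" using good_fiber[OF gv v(1)] .
        then have "pt x = pt (w v)" using x pt_scale[of c "w v"] by auto
        then have "pt v \<in> ?A" using perazzo_dom_good[OF gv] perazzo_map_good[OF gv] by simp
        then show "peval F v = 0" using F by (auto simp: vanishes_at_pt)
      qed
      then show ?thesis using u(1) F(1) by (simp add: vanishes_at_pt)
    qed
    then show "q \<in> zariski closure_of ?A"
      unfolding in_closure_zariski[OF A] using u by auto
  qed
qed (rule perazzo_fiber_subset[OF x])

text \<open>The section provides a point \<open>Y x\<close> of \<open>Vert (H x)\<close> also for
  those \<open>x\<close> in \<open>W\<close> that are not values of \<open>w\<close>, since
  \<open>B x (Y x) = 0\<close> extends to the closure. Hence
  \<open>\<delta> (Y x) \<noteq> 0\<close> is a suitable open condition on \<open>x\<close>.\<close>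

lemma general_perazzo_fiber:
  obtains e \<Delta> v where "hfun e \<Delta>" "\<Delta> (w v) \<noteq> 0" "w v \<noteq> 0"
    "\<And>x. x \<noteq> 0 \<Longrightarrow> pt x \<in> W \<Longrightarrow> \<Delta> x \<noteq> 0 \<Longrightarrow> perazzo_fiber f (pt x) = proj_pts (Vert (H x))"
proof -
  obtain v0 where v0: "fiber_minimal v0" using fiber_minimal_exists by blast
  then have good: "good v0" by (simp add: fiber_minimal_def)
  obtain m \<delta> where \<delta>: "hfun m \<delta>" "\<delta> v0 \<noteq> 0" "\<And>v. \<delta> v \<noteq> 0 \<Longrightarrow> good v" using good_open_at[OF good] by metis
  obtain S where S: "complementary (Vert (H (w v0))) S" using complement_exists[OF subspace_Vert] by blast
  obtain \<gamma> Y where Y: "hmap CARD('n) Y" "\<gamma> (w v0) \<noteq> 0" "Y (w v0) = \<gamma> (w v0) *s v0" "\<And>v. B (w v) (Y (w v)) = 0"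
    using fiber_section[OF v0 S] by metis
  show ?thesis
  proof (rule that[of "m * CARD('n)" "\<lambda>x. \<delta> (Y x)" v0])
    show "hfun (m * CARD('n)) (\<lambda>x. \<delta> (Y x))" by (rule hfun_compose[OF \<delta>(1) Y(1)])
    show "\<delta> (Y (w v0)) \<noteq> 0" using \<delta>(2) Y(2) hfun_scale[OF \<delta>(1)] by (simp add: Y(3))
    show "w v0 \<noteq> 0" using good by (simp add: good_def)
    fix x assume x: "x \<noteq> 0" "pt x \<in> W" "\<delta> (Y x) \<noteq> 0"
    have "B x (Y x) $ i = 0" for i
      by (rule image_closure_hfun[OF x(2) hmapD[OF hmap_B[OF hmap_ident Y(1)]]]) (simp add: Y(4))
    then have "Y x \<in> Vert (H x)" by (simp add: Vert_iff vec_eq_iff)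
    then show "perazzo_fiber f (pt x) = proj_pts (Vert (H x))"
      using perazzo_fiber_eq[OF x(1) \<delta>(1,3) _ x(3)] by blast
  qed
qed

text \<open>An open set that meets the closure \<open>W\<close> pulls back along \<open>w\<close> to
  a nonempty open set of parameters. Positive degree takes care of the zeros of
  \<open>w\<close>.\<close>

lemma zero_on_open_image:
  assumes U: "openin zariski U" "z \<in> U" "z \<in> W" and G: "hfun e G" "e \<noteq> 0"
    and zero: "\<And>v. w v \<noteq> 0 \<Longrightarrow> pt (w v) \<in> U \<Longrightarrow> G (w v) = 0"
  shows "G (w v) = 0"
proof -
  obtain F a where F: "homogeneous a F" "\<not> vanishes_at F z" "\<And>q. q \<in> PN \<Longrightarrow> \<not> vanishes_at F q \<Longrightarrow> q \<in> U"
    using U unfolding openin_zariski by blast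
  have "\<exists>u. peval F (w u) \<noteq> 0"
    using F(1,2) U(3) by (auto simp: image_closure_def)
  then obtain u where u: "peval F (w u) \<noteq> 0" by blast
  show ?thesis
  proof (rule hfun_zero_generic[OF hfun_compose[OF G(1) hmap_w] hfun_compose[OF hfun_peval[OF F(1)] hmap_w]
        vec.subspace_UNIV UNIV_I u _ UNIV_I])
    fix v assume v: "peval F (w v) \<noteq> 0"
    show "G (w v) = 0"
    proof (cases "w v = 0")
      case True
      then show ?thesis using hfun_at_0[OF G] by simp
    next
      case False
      then show ?thesis using zero[OF False] F(3)[of "pt (w v)"] v by (simp add: vanishes_at_pt[OF F(1)])
    qed
  qed
qed

lemma common_kernelI_open:
  assumes U: "openin zariski U" "z \<in> U" "z \<in> W"
    and u: "\<And>x. x \<noteq> 0 \<Longrightarrow> pt x \<in> U \<inter> W \<Longrightarrow> u \<in> Vert (H x)"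
  shows "u \<in> common_kernel"
proof -
  have "B u (w v) $ i = 0" for v i
  proof (rule zero_on_open_image[OF U])
    show "hfun 1 (\<lambda>x. B u x $ i)"
      unfolding B_nth by (intro hfun_sum hfun_cmult hfun_nth)
    fix v assume v: "w v \<noteq> 0" "pt (w v) \<in> U"
    have "pt (w v) \<in> W" using pt_in_image_closure[of v UNIV w] v by simp
    then have "u \<in> Vert (H (w v))" using u[OF v(1)] v(2) by blast
    then show "B u (w v) $ i = 0" using B_commute[of u "w v"] by (simp add: Vert_iff)
  qed simp
  then show ?thesis by (simp add: common_kernel_def vec_eq_iff)
qed

text \<open>Over a suitable open set the fibres are the linear spaces \<open>Vert (H x)\<close>. The
  equations \<open>B u x = 0\<close> are linear in \<open>x\<close>, so holding on any nonempty open
  part of \<open>W\<close> means holding on all of \<open>W\<close>; the intersection cannot grow on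
  smaller open sets.\<close>

lemma general_Inter_common_kernel: "is_general_Inter W (perazzo_fiber f) (proj_pts common_kernel)"
proof -
  obtain e \<Delta> v where \<Delta>: "hfun e \<Delta>" "\<Delta> (w v) \<noteq> 0" "w v \<noteq> 0"
    "\<And>x. x \<noteq> 0 \<Longrightarrow> pt x \<in> W \<Longrightarrow> \<Delta> x \<noteq> 0 \<Longrightarrow> perazzo_fiber f (pt x) = proj_pts (Vert (H x))"
    using general_perazzo_fiber by metis
  obtain F where F: "homogeneous e F" "\<Delta> = peval F" using \<Delta>(1) by (auto simp: hfun_def)
  let ?U = "{p \<in> PN. \<not> vanishes_at F p}"
  have "pt (w v) \<in> ?U \<inter> W"
    using \<Delta>(2,3) F pt_in_image_closure[of v UNIV w] by (simp add: vanishes_at_pt)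
  moreover have "(\<Inter>z\<in>U' \<inter> W. perazzo_fiber f z) = proj_pts common_kernel"
    if U': "openin zariski U'" "U' \<subseteq> ?U" "U' \<inter> W \<noteq> {}" for U'
  proof
    have fib: "perazzo_fiber f (pt x) = proj_pts (Vert (H x))" if "x \<noteq> 0" "pt x \<in> U' \<inter> W" for x
      using \<Delta>(4)[of x] that U'(2) F by (auto simp: vanishes_at_pt)
    have PN: "U' \<inter> W \<subseteq> PN" using image_closure_subset_PN by blast
    show "proj_pts common_kernel \<subseteq> (\<Inter>z\<in>U' \<inter> W. perazzo_fiber f z)"
    proof (rule INT_greatest)
      fix z assume z: "z \<in> U' \<inter> W"
      then obtain x where x: "x \<noteq> 0" "z = pt x" using PN by (meson PN_cases subsetD)
      have "common_kernel \<subseteq> Vert (H x)"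
      proof
        fix u assume u: "u \<in> common_kernel"
        have "B u x $ i = 0" for i
        proof (rule image_closure_hfun[where f = "\<lambda>x. B u x $ i" and \<phi> = w and S = UNIV])
          show "pt x \<in> W" using z x by simp
          show "hfun 1 (\<lambda>x. B u x $ i)" unfolding B_nth by (intro hfun_sum hfun_cmult hfun_nth)
        qed (use u in \<open>simp add: common_kernel_def\<close>)
        then show "u \<in> Vert (H x)" by (simp add: mem_Vert_commute[of u] Vert_iff vec_eq_iff B_commute[of x])
      qed
      then show "proj_pts common_kernel \<subseteq> perazzo_fiber f z"
        using fib[of x] x z proj_pts_mono_iff[OF subspace_common_kernel subspace_Vert] by simp
    qed
    obtain z0 where z0: "z0 \<in> U'" "z0 \<in> W" using U'(3) by blast
    show "(\<Inter>z\<in>U' \<inter> W. perazzo_fiber f z) \<subseteq> proj_pts common_kernel"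
    proof
      fix p assume p: "p \<in> (\<Inter>z\<in>U' \<inter> W. perazzo_fiber f z)"
      obtain x0 where x0: "x0 \<noteq> 0" "z0 = pt x0" using z0 PN by (meson IntI PN_cases subsetD)
      then have "p \<in> proj_pts (Vert (H x0))" using p z0 fib[of x0] by blast
      then obtain u where u: "p = pt u" "u \<noteq> 0" by (auto simp: proj_pts_def)
      have "u \<in> common_kernel"
      proof (rule common_kernelI_open[OF U'(1) z0])
        fix x assume x: "x \<noteq> 0" "pt x \<in> U' \<inter> W"
        then have "pt u \<in> proj_pts (Vert (H x))" using p u fib[OF x] by blast
        then show "u \<in> Vert (H x)" using pt_in_proj_pts[OF subspace_Vert u(2)] by blast
      qed
      then show "p \<in> proj_pts common_kernel" using u by (auto simp: proj_pts_def)
    qed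
  qed
  ultimately show ?thesis
    unfolding is_general_Inter_def using openin_nonvanishing[OF F(1)] by blast
qed

lemma general_Inter_subset:
  assumes L: "vec.subspace L" and I: "is_general_Inter W (perazzo_fiber f) (proj_pts L)"
  shows "L \<subseteq> common_kernel"
proof
  fix u assume u: "u \<in> L"
  obtain U where U: "openin zariski U" "U \<inter> W \<noteq> {}"
    and Inter: "\<forall>U'. openin zariski U' \<and> U' \<subseteq> U \<and> U' \<inter> W \<noteq> {} \<longrightarrow>
      (\<Inter>z\<in>U' \<inter> W. perazzo_fiber f z) = proj_pts L"
    using I unfolding is_general_Inter_def by (elim exE conjE)
  have Inter: "(\<Inter>z\<in>U \<inter> W. perazzo_fiber f z) = proj_pts L"
    by (rule Inter[rule_format]) (intro conjI U order_refl)
  obtain z where z: "z \<in> U" "z \<in> W" using U(2) by blast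
  show "u \<in> common_kernel"
  proof (rule common_kernelI_open[OF U(1) z])
    fix x assume x: "x \<noteq> 0" "pt x \<in> U \<inter> W"
    then have "proj_pts L \<subseteq> proj_pts (Vert (H x))" using Inter perazzo_fiber_subset[OF x(1)] by blast
    then show "u \<in> Vert (H x)" using u proj_pts_mono_iff[OF L subspace_Vert] by blast
  qed
qed

text \<open>Semicontinuity: the minimal choice of \<open>v0\<close> bounds the fibre dimension from
  below, and meeting \<open>S\<close> only in 0 bounds it from above.\<close>

lemma fiber_dim_generic:
  obtains e \<gamma> v where "hfun e \<gamma>" "\<gamma> v \<noteq> 0"
    "\<And>v. good v \<Longrightarrow> \<gamma> v \<noteq> 0 \<Longrightarrow> vec.dim (Vert (H (w v))) + variety_dim W = CARD('n)"
proof -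
  obtain v0 where v0: "fiber_minimal v0" using fiber_minimal_exists by blast
  obtain S where S: "complementary (Vert (H (w v0))) S" using complement_exists[OF subspace_Vert] by blast
  obtain \<gamma> Y where \<gamma>: "hfun CARD('n) \<gamma>" "\<gamma> (w v0) \<noteq> 0"
    "\<And>v. good v \<Longrightarrow> \<gamma> (w v) \<noteq> 0 \<Longrightarrow> Vert (H (w v)) \<inter> S = {0} \<and> Y (w v) - \<gamma> (w v) *s v0 \<in> S"
    using fiber_section[OF v0 S] by metis
  show ?thesis
  proof (rule that[OF hfun_compose[OF \<gamma>(1) hmap_w] \<gamma>(2)])
    fix v assume v: "good v" "\<gamma> (w v) \<noteq> 0"
    have "vec.dim (Vert (H (w v))) + vec.dim S \<le> CARD('n)"
      using dim_direct_sum_le[OF subspace_Vert, of S "H (w v)"] S \<gamma>(3)[OF v]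
        vec_dim_le_card[of "{x + y |x y. x \<in> Vert (H (w v)) \<and> y \<in> S}"]
      by (simp add: complementary_def)
    moreover have "vec.dim (Vert (H (w v0))) \<le> vec.dim (Vert (H (w v)))"
      using v0 v(1) by (simp add: fiber_minimal_def)
    ultimately show "vec.dim (Vert (H (w v))) + variety_dim W = CARD('n)"
      using complementary_dim[OF S] dim_dual_variety[OF v0] by simp
  qed
qed

text \<open>Otherwise a general fibre equals the common kernel. As \<open>v\<close> lies in its own
  fibre, \<open>B v (w u) = 0\<close> for general and then all \<open>v\<close>, so every
  \<open>w u\<close> is in the radical and vanishes.\<close>

lemma dim_common_kernel: "vec.dim common_kernel + variety_dim W < CARD('n)"
proof (rule ccontr)
  assume big: "\<not> ?thesis"
  obtain e \<gamma> x where \<gamma>: "hfun e \<gamma>" "\<gamma> x \<noteq> 0"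
    "\<And>v. good v \<Longrightarrow> \<gamma> v \<noteq> 0 \<Longrightarrow> vec.dim (Vert (H (w v))) + variety_dim W = CARD('n)"
    using fiber_dim_generic by metis
  have "B v (w u) = 0" for u v
  proof -
    have "B v (w u) $ i = 0" for i
    proof (rule good_generic[where F = "\<lambda>v. B v (w u) $ i", OF _ \<gamma>(1,2)])
      show "hfun 1 (\<lambda>v. B v (w u) $ i)"
        unfolding B_nth by (intro hfun_sum hfun_multc[OF hfun_cmult] hfun_nth)
      fix v assume v: "good v" "\<gamma> v \<noteq> 0"
      have "common_kernel = Vert (H (w v))"
        using vec.subspace_dim_equal[OF subspace_common_kernel subspace_Vert common_kernel_subset] \<gamma>(3)[OF v] big
        by simp
      then have "v \<in> common_kernel" using v_in_fiber by blast
      then show "B v (w u) $ i = 0" by (simp add: common_kernel_def)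
    qed
    then show ?thesis by (simp add: vec_eq_iff)
  qed
  then have "w u = 0" for u using nondegenerate[of "w u"] B_commute by metis
  moreover obtain v where "good v" using good_exists by blast
  ultimately show False by (simp add: good_def)
qed

text \<open>If \<open>W\<close> had dimension 0, the fibre would be the whole space and
  \<open>w v0\<close> would lie in the radical.\<close>

lemma dim_dual_pos: "variety_dim W > 0"
proof (rule ccontr)
  assume 0: "\<not> ?thesis"
  obtain v0 where v0: "fiber_minimal v0" using fiber_minimal_exists by blast
  have "vec.dim (UNIV :: ('k^'n) set) \<le> vec.dim (Vert (H (w v0)))"
    using dim_dual_variety[OF v0] 0 by (simp add: card_cart_basis)
  then have "Vert (H (w v0)) = UNIV"
    using vec.subspace_dim_equal[OF subspace_Vert vec.subspace_UNIV] by blast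
  then have "w v0 = 0" using nondegenerate[of "w v0"] Vert_iff by blast
  then show False using v0 by (simp add: fiber_minimal_def good_def)
qed

text \<open>Differentiate \<open>B v (w v) = 0\<close> in direction \<open>u\<close> and pair with
  \<open>w v\<close>, which kills the derivative term. So \<open>w v\<close> lies in the fibre
  through \<open>v\<close>.\<close>

lemma B_w_w: "B (w v) (w v) = 0"
proof (rule dotp_nondegenerate)
  fix u
  obtain b where b: "vjet (\<lambda>t. w (v + t *s u)) (w v) b"
    using vjet_hmap[OF hmap_w vjet_line] by blast
  have "B v b + B u (w v) = 0"
    using vjet_B[OF vjet_line[of v u] b] unfolding B_w by (rule vjet_zero)
  then have "dotp (B v b) (w v) + dotp (B u (w v)) (w v) = 0" by (simp add: dotp_add_left[symmetric])
  moreover have "dotp (B v b) (w v) = 0" by (simp add: dotp_B_commute[of v b] B_w)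
  ultimately show "dotp (B (w v) (w v)) u = 0"
    using dotp_B_commute[of "w v" "w v" u] B_commute[of u "w v"] by simp
qed

text \<open>\<open>b\<close> is the derivative of \<open>w\<close> at \<open>v\<close> in direction
  \<open>u\<close>. Differentiating \<open>B v (w v) = 0\<close> and
  \<open>B (w v) (w v) = 0\<close> gives the two relations; a derivative of a curve in a linear
  space stays in that space.\<close>

lemma w_jet:
  obtains b where "vjet (\<lambda>t. w (v + t *s u)) (w v) b" "B u (w v) = - B v b" "B (w v) b = 0" "b \<in> image_span"
proof -
  obtain b where b: "vjet (\<lambda>t. w (v + t *s u)) (w v) b"
    using vjet_hmap[OF hmap_w vjet_line] by blast
  have "B v b + B u (w v) = 0"
    using vjet_B[OF vjet_line[of v u] b] unfolding B_w by (rule vjet_zero)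
  then have 1: "B u (w v) = - B v b" by (simp add: eq_neg_iff_add_eq_0 add.commute)
  have "B (w v) b + B b (w v) = 0" using vjet_B[OF b b] unfolding B_w_w by (rule vjet_zero)
  then have 2: "B (w v) b = 0" by (simp add: B_commute[of b] vec_eq_iff)
  have 3: "b \<in> image_span"
  proof (rule ccontr)
    assume "b \<notin> image_span"
    then obtain a where a: "\<And>m. m \<in> image_span \<Longrightarrow> dotp a m = 0" "dotp a b = 1"
      using separating_form[OF subspace_image_span] by blast
    have "jet (\<lambda>t. dotp a (w (v + t *s u))) (dotp a (w v)) (dotp a b)" by (rule jet_dotp_const[OF b])
    then have "jet (\<lambda>t. 0) (dotp a (w v)) (dotp a b)" using a(1) w_in_image_span by simp
    then have "dotp a b = 0" by (rule jet_zero)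
    then show False using a(2) by simp
  qed
  show ?thesis by (rule that[OF b 1 2 3])
qed

section \<open>Fibres exactly one dimension larger than their common part\<close>

context
  assumes dim_kernel: "vec.dim common_kernel + variety_dim W + 1 = CARD('n)"
begin

text \<open>For \<open>v\<close> outside the common kernel, \<open>v\<close> and the common kernel
  together already span a space of the dimension of the fibre. A linear form vanishing on the common
  kernel makes this an open condition.\<close>

lemma general_fiber_span:
  obtains e \<delta> x where "hfun e \<delta>" "\<delta> x \<noteq> 0"
    "\<And>v y. good v \<Longrightarrow> \<delta> v \<noteq> 0 \<Longrightarrow> y \<in> Vert (H (w v)) \<Longrightarrow> \<exists>k. y - k *s v \<in> common_kernel"
proof -
  obtain e \<gamma> x where \<gamma>: "hfun e \<gamma>" "\<gamma> x \<noteq> 0"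
    "\<And>v. good v \<Longrightarrow> \<gamma> v \<noteq> 0 \<Longrightarrow> vec.dim (Vert (H (w v))) + variety_dim W = CARD('n)"
    using fiber_dim_generic by metis
  have "common_kernel \<noteq> UNIV" using dim_kernel by (auto simp: card_cart_basis)
  then obtain x1 where "x1 \<notin> common_kernel" by blast
  then obtain a where a: "\<And>u. u \<in> common_kernel \<Longrightarrow> dotp a u = 0" "dotp a x1 = 1"
    using separating_form[OF subspace_common_kernel] by blast
  note ha = hfun_dotp_const[OF hmap_ident, of a]
  have "\<exists>x. \<gamma> x * dotp a x \<noteq> 0"
  proof (rule ccontr)
    assume "\<nexists>x. \<gamma> x * dotp a x \<noteq> 0"
    then have "\<forall>x\<in>UNIV. \<gamma> x * dotp a x = 0" by blast
    from hfun_prod_zero[OF \<gamma>(1) ha vec.subspace_UNIV this] show False using \<gamma>(2) a(2) by auto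
  qed
  then obtain x where x: "\<gamma> x * dotp a x \<noteq> 0" by blast
  show ?thesis
  proof (rule that[of _ "\<lambda>x. \<gamma> x * dotp a x", OF hfun_mult[OF \<gamma>(1) ha] x])
    fix v y assume v: "good v" "\<gamma> v * dotp a v \<noteq> 0" and y: "y \<in> Vert (H (w v))"
    have vk: "v \<notin> common_kernel" using a(1) v(2) by auto
    let ?U = "vec.span (insert v common_kernel)"
    have sp: "vec.span common_kernel = common_kernel"
      by (rule vec.span_eq_iff[THEN iffD2, OF subspace_common_kernel])
    have "vec.dim ?U = Suc (vec.dim common_kernel)"
      using vk vec.dim_insert[of v common_kernel] sp by simp
    moreover have "?U \<subseteq> Vert (H (w v))"
      using v_in_fiber common_kernel_subset by (intro vec.span_minimal subspace_Vert) auto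
    moreover have "vec.dim (Vert (H (w v))) + variety_dim W = CARD('n)" using \<gamma>(3) v by simp
    ultimately have "?U = Vert (H (w v))"
      using vec.subspace_dim_equal[OF vec.subspace_span subspace_Vert, of "insert v common_kernel" "H (w v)"]
        dim_kernel by simp
    then have "y \<in> ?U" using y by simp
    then show "\<exists>k. y - k *s v \<in> common_kernel"
      unfolding vec.span_breakdown_eq sp .
  qed
qed

text \<open>
  Modulo the common kernel \<open>L\<close>, the vectors \<open>w v\<close> and \<open>v\<close> are parallel. Differentiating this relation
  shows that \<open>w v\<close> is parallel to every vector, so it is zero modulo \<open>L\<close>.
\<close>

lemma image_span_subset: "image_span \<subseteq> common_kernel"
proof -
  obtain e \<delta> x where \<delta>: "hfun e \<delta>" "\<delta> x \<noteq> 0"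
    "\<And>v y. good v \<Longrightarrow> \<delta> v \<noteq> 0 \<Longrightarrow> y \<in> Vert (H (w v)) \<Longrightarrow> \<exists>k. y - k *s v \<in> common_kernel"
    using general_fiber_span by metis
  have wv: "w v \<in> Vert (H (w v))" for v by (simp add: Vert_iff B_w_w)
  \<comment> \<open>Forms \<open>\<alpha>\<close>, \<open>\<beta>\<close> that vanish on the common
    kernel are coordinates modulo it; the identity is the vanishing of a 2 by 2 minor of
    \<open>w v\<close> and \<open>v\<close>.\<close>
  have par: "dotp \<alpha> (w v) * dotp \<beta> v - dotp \<alpha> v * dotp \<beta> (w v) = 0"
    if \<alpha>: "\<And>u. u \<in> common_kernel \<Longrightarrow> dotp \<alpha> u = 0" and \<beta>: "\<And>u. u \<in> common_kernel \<Longrightarrow> dotp \<beta> u = 0" for \<alpha> \<beta> v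
  proof (rule good_generic[where F = "\<lambda>v. dotp \<alpha> (w v) * dotp \<beta> v - dotp \<alpha> v * dotp \<beta> (w v)", OF _ \<delta>(1,2)])
    show "hfun ((d - 1) * 2 + 1) (\<lambda>v. dotp \<alpha> (w v) * dotp \<beta> v - dotp \<alpha> v * dotp \<beta> (w v))"
      using hfun_diff[OF hfun_mult[OF hfun_dotp_const[OF hmap_w] hfun_dotp_const[OF hmap_ident]]
          hfun_mult[OF hfun_dotp_const[OF hmap_w] hfun_dotp_const[OF hmap_ident]], of \<alpha> \<beta> \<beta> \<alpha>]
      by (simp add: mult.commute)
    fix v assume v: "good v" "\<delta> v \<noteq> 0"
    obtain k where k: "w v - k *s v \<in> common_kernel" using \<delta>(3)[OF v wv] by blast
    then show "dotp \<alpha> (w v) * dotp \<beta> v - dotp \<alpha> v * dotp \<beta> (w v) = 0"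
      using \<alpha>[OF k] \<beta>[OF k] by (simp add: dotp_simps)
  qed
  have "w v \<in> common_kernel" for v
  proof (rule subspace_zero_generic[OF subspace_common_kernel \<delta>(1,2)])
    fix v assume v: "good v" "\<delta> v \<noteq> 0"
    \<comment> \<open>The derivative of \<open>par\<close> in direction \<open>u\<close>: since
      \<open>b\<close> lies in the fibre it is a multiple of \<open>v\<close> modulo the common
      kernel, so both terms with \<open>b\<close> cancel and \<open>u\<close> stays
      arbitrary.\<close>
    have key: "dotp \<alpha> (w v) * dotp \<beta> u = dotp \<alpha> u * dotp \<beta> (w v)"
      if \<alpha>: "\<And>u. u \<in> common_kernel \<Longrightarrow> dotp \<alpha> u = 0" and \<beta>: "\<And>u. u \<in> common_kernel \<Longrightarrow> dotp \<beta> u = 0" for \<alpha> \<beta> u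
    proof -
      obtain b where b: "vjet (\<lambda>t. w (v + t *s u)) (w v) b" "B (w v) b = 0" using w_jet[of v u] by metis
      have j: "jet (\<lambda>t. dotp \<alpha> (w (v + t *s u)) * dotp \<beta> (v + t *s u) +
           (- 1) * (dotp \<alpha> (v + t *s u) * dotp \<beta> (w (v + t *s u))))
         (dotp \<alpha> (w v) * dotp \<beta> v + (- 1) * (dotp \<alpha> v * dotp \<beta> (w v)))
         ((dotp \<alpha> (w v) * dotp \<beta> u + dotp \<alpha> b * dotp \<beta> v) +
          ((- 1) * (dotp \<alpha> v * dotp \<beta> b + dotp \<alpha> u * dotp \<beta> (w v)) + 0 * (dotp \<alpha> v * dotp \<beta> (w v))))"
        by (intro jet_add jet_mult jet_const jet_dotp_const b(1) vjet_line)
      have zero: "dotp \<alpha> (w (v + t *s u)) * dotp \<beta> (v + t *s u) +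
           (- 1) * (dotp \<alpha> (v + t *s u) * dotp \<beta> (w (v + t *s u))) = 0" for t
        using par[OF \<alpha> \<beta>, of "v + t *s u"] by simp
      have eq: "(dotp \<alpha> (w v) * dotp \<beta> u + dotp \<alpha> b * dotp \<beta> v) +
          ((- 1) * (dotp \<alpha> v * dotp \<beta> b + dotp \<alpha> u * dotp \<beta> (w v)) + 0 * (dotp \<alpha> v * dotp \<beta> (w v))) = 0"
        using j unfolding zero by (rule jet_zero)
      have "b \<in> Vert (H (w v))" using b(2) by (simp add: Vert_iff)
      then obtain k where k: "b - k *s v \<in> common_kernel" using \<delta>(3)[OF v] by blast
      then have "dotp \<alpha> b = k * dotp \<alpha> v" "dotp \<beta> b = k * dotp \<beta> v"
        using \<alpha>[OF k] \<beta>[OF k] by (simp_all add: dotp_simps)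
      then show ?thesis using eq by simp
    qed
    show "w v \<in> common_kernel"
    proof (rule ccontr)
      assume "w v \<notin> common_kernel"
      then obtain \<alpha> where \<alpha>: "\<And>u. u \<in> common_kernel \<Longrightarrow> dotp \<alpha> u = 0" "dotp \<alpha> (w v) = 1"
        using separating_form[OF subspace_common_kernel] by blast
      have dec: "u - dotp \<alpha> u *s w v \<in> common_kernel" for u
      proof (rule ccontr)
        assume "u - dotp \<alpha> u *s w v \<notin> common_kernel"
        then obtain \<beta> where \<beta>: "\<And>u. u \<in> common_kernel \<Longrightarrow> dotp \<beta> u = 0" "dotp \<beta> (u - dotp \<alpha> u *s w v) = 1"
          using separating_form[OF subspace_common_kernel] by blast
        then show False using key[OF \<alpha>(1) \<beta>(1), of u] \<alpha>(2) by (simp add: dotp_simps)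
      qed
      have sp: "vec.span common_kernel = common_kernel"
        by (rule vec.span_eq_iff[THEN iffD2, OF subspace_common_kernel])
      have "u \<in> vec.span (insert (w v) common_kernel)" for u
        unfolding vec.span_breakdown_eq sp using dec[of u] by blast
      \<comment> \<open>Then the common kernel has codimension at most 1, while its codimension is
        \<open>variety_dim W + 1\<close>, hence at least 2.\<close>
      then have "vec.span (insert (w v) common_kernel) = UNIV" by blast
      then have "CARD('n) \<le> Suc (vec.dim common_kernel)"
        using vec.dim_insert[of "w v" common_kernel] vec.dim_span[of "insert (w v) common_kernel"]
        by (simp add: card_cart_basis split: if_splits)
      then show False using dim_kernel dim_dual_pos by simp
    qed
  qed
  then show ?thesis
    unfolding image_span_def by (intro vec.span_minimal subspace_common_kernel) auto
qed

text \<open>As \<open>B\<close> vanishes between the two spaces, the Hessian at \<open>v\<close>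
  maps the common kernel into the orthogonal space of \<open>image_span\<close>, and it kills at
  most a line.\<close>

lemma dim_image_span_le: "vec.dim image_span \<le> variety_dim W + 2"
proof -
  obtain v where v: "good v" using good_exists by blast
  have "vec.dim ((*v) (H v) ` common_kernel) + vec.dim image_span \<le> CARD('n)"
  proof (rule dim_orthogonal_le)
    fix a m assume "a \<in> (*v) (H v) ` common_kernel" "m \<in> image_span"
    then obtain u where u: "a = B v u" "B u m = 0" using B_kernel_span by blast
    have "dotp (B v u) m = dotp (B u m) v" using dotp_B_commute[of u v m] B_commute[of v u] by simp
    then show "dotp a m = 0" using u by simp
  qed
  moreover have "vec.dim (common_kernel \<inter> Vert (H v)) \<le> 1"
    using vec.dim_subset[of "common_kernel \<inter> Vert (H v)" "Vert (H v)"] v by (simp add: good_def)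
  ultimately show ?thesis
    using rank_nullity[OF subspace_common_kernel, of "H v"] dim_kernel by simp
qed

lemma dim_H_image_span:
  assumes "good v"
  shows "vec.dim ((*v) (H v) ` image_span) + 1 = vec.dim image_span"
proof -
  have "Vert (H v) \<subseteq> image_span"
    unfolding Vert_good[OF assms] using w_in_image_span by (intro vec.span_minimal subspace_image_span) auto
  then have "image_span \<inter> Vert (H v) = Vert (H v)" by blast
  then show ?thesis
    using rank_nullity[OF subspace_image_span, of "H v"] assms by (simp add: good_def)
qed

text \<open>If \<open>image_span\<close> were smaller, the inclusion of the range of
  \<open>H (w v)\<close> in the image of \<open>image_span\<close> under \<open>H v\<close> would be
  an equality by dimension. Then \<open>B v m = B (w v) u\<close>, and pairing with \<open>v\<close>
  gives \<open>dotp (B v v) m = 0\<close> since \<open>B (w v) v = 0\<close>. So every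
  \<open>m\<close> would be in the radical.\<close>

lemma dim_image_span: "vec.dim image_span = variety_dim W + 2"
proof (rule ccontr)
  assume "vec.dim image_span \<noteq> variety_dim W + 2"
  then have small: "vec.dim image_span \<le> variety_dim W + 1" using dim_image_span_le by simp
  obtain e \<gamma> x where \<gamma>: "hfun e \<gamma>" "\<gamma> x \<noteq> 0"
    "\<And>v. good v \<Longrightarrow> \<gamma> v \<noteq> 0 \<Longrightarrow> vec.dim (Vert (H (w v))) + variety_dim W = CARD('n)"
    using fiber_dim_generic by metis
  have zero: "dotp (B v v) m = 0" if m: "m \<in> image_span" for m v
  proof (rule good_generic[where F = "\<lambda>v. dotp (B v v) m", OF _ \<gamma>(1,2)])
    have "hfun (1 + 1) (\<lambda>v. dotp m (B v v))" by (intro hfun_dotp_const hmap_B hmap_ident)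
    then show "hfun (1 + 1) (\<lambda>v. dotp (B v v) m)" by (simp add: dotp_commute)
    fix v assume v: "good v" "\<gamma> v \<noteq> 0"
    let ?A = "range ((*v) (H (w v)))" and ?C = "(*v) (H v) ` image_span"
    \<comment> \<open>The first relation of \<open>w_jet\<close> rewrites \<open>B (w v) u\<close>
      as the Hessian at \<open>v\<close> applied to minus the derivative of
      \<open>w\<close>.\<close>
    have sub: "?A \<subseteq> ?C"
    proof (rule image_subsetI)
      fix u
      obtain b where b: "B u (w v) = - B v b" "b \<in> image_span" using w_jet[of v u] by metis
      have "B (w v) u = B v (- 1 *s b)" 
        by (simp only: B_scale_right B_commute[of "w v"] b(1) vector_sneg_minus1)
      moreover have "- 1 *s b \<in> image_span" using b(2) subspace_image_span vec.subspace_scale by blast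
      ultimately show "B (w v) u \<in> ?C" by blast
    qed
    have "vec.dim ?A = variety_dim W"
      using rank_nullity[OF vec.subspace_UNIV, of "H (w v)"] \<gamma>(3)[OF v] by (simp add: card_cart_basis)
    moreover have "vec.subspace ?A" "vec.subspace ?C"
      by (rule vec.linear_subspace_image[OF matrix_vector_mul_linear_gen], rule vec.subspace_UNIV)
        (rule vec.linear_subspace_image[OF matrix_vector_mul_linear_gen subspace_image_span])
    ultimately have "?A = ?C"
      using vec.subspace_dim_equal[OF _ _ sub] dim_H_image_span[OF v(1)] small by simp
    then have "B v m \<in> ?A" using m by blast
    then obtain u where u: "B v m = B (w v) u" by blast
    have "dotp (B v v) m = dotp (B (w v) u) v" using dotp_B_commute[of v v m] u by simp
    also have "\<dots> = dotp (B (w v) v) u" by (rule dotp_B_commute)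
    also have "\<dots> = 0" using v_in_fiber[of v] by (simp add: Vert_iff)
    finally show "dotp (B v v) m = 0" .
  qed
  obtain v where v: "good v" using good_exists by blast
  have "w v = 0" by (rule nondegenerate[OF polarization]) (rule zero[OF w_in_image_span])
  then show False using v by (simp add: good_def)
qed

text \<open>Tangency and isotropy both express that \<open>B\<close> vanishes between the two
  spaces. For the intersection, the image of \<open>image_span\<close> under \<open>H v\<close> has
  dimension \<open>variety_dim W + 1\<close>, which leaves exactly the dimension of the common
  kernel for its orthogonal space.\<close>

lemma tangent_along_good:
  assumes v: "good v"
  shows "tangent_along (H v) common_kernel image_span"
    and "(\<Inter>m\<in>image_span - Vert (H v). quadric_tangent (H v) m) = common_kernel"
proof -
  have ortho: "dotp (B v m) l = 0" if "m \<in> image_span" "l \<in> common_kernel" for m l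
    using B_kernel_span[OF that(2,1)] dotp_B_commute[of m v l] B_commute[of v m] B_commute[of l m] by simp
  have Vert: "Vert (H v) \<subseteq> image_span"
    unfolding Vert_good[OF v] using w_in_image_span by (intro vec.span_minimal subspace_image_span) auto
  show "tangent_along (H v) common_kernel image_span"
    unfolding tangent_along_def generator_def
  proof (intro conjI ballI)
    have "vec.dim image_span \<le> vec.dim common_kernel" using image_span_subset by (rule vec.dim_subset)
    \<comment> \<open>Since \<open>W\<close> has positive dimension, \<open>image_span\<close> and
      hence the common kernel have dimension at least 3. The Hessian has corank 1, so its rank is at
      least 4.\<close>
    then have "CARD('n) \<ge> 5" using dim_image_span dim_kernel dim_dual_pos by simp
    moreover have "CARD('n) = vec.dim (range ((*v) (H v))) + 1"
      using rank_nullity[OF vec.subspace_UNIV, of "H v"] v by (simp add: good_def card_cart_basis)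
    ultimately show "3 \<le> rank (H v)" using rank_symmetric_ge[OF transpose_H, of v] by simp
    show "proj_dim image_span > 0" using dim_image_span by (simp add: proj_dim_def)
    have "vec.dim (Vert (H v)) \<noteq> vec.dim image_span" using v dim_image_span by (simp add: good_def)
    then show "Vert (H v) \<subset> image_span" using Vert by (metis psubsetI)
    show "image_span \<subseteq> quadric_cone (H v)"
      using ortho image_span_subset by (auto simp: quadric_cone_def dotp_commute)
    show "common_kernel \<subseteq> quadric_tangent (H v) m" if "m \<in> image_span" for m
      using ortho that by (auto simp: quadric_tangent_def)
  qed (use subspace_common_kernel subspace_image_span image_span_subset in auto)
  let ?X = "{u. \<forall>m\<in>image_span. dotp (B v m) u = 0}"
  \<comment> \<open>Points of the vertex impose no condition, so they may be included among the
    \<open>m\<close>.\<close>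
  have "(\<Inter>m\<in>image_span - Vert (H v). quadric_tangent (H v) m) = ?X"
    by (auto simp: quadric_tangent_def Vert_iff)
  moreover have "common_kernel = ?X"
  proof (rule vec.subspace_dim_equal[OF subspace_common_kernel])
    show "vec.subspace ?X" by (rule vec.subspaceI) (auto simp: dotp_simps)
    show "common_kernel \<subseteq> ?X" using ortho by blast
    have "vec.dim ((*v) (H v) ` image_span) + vec.dim ?X \<le> CARD('n)"
      by (rule dim_orthogonal_le) auto
    then show "vec.dim ?X \<le> vec.dim common_kernel"
      using dim_H_image_span[OF v] dim_image_span dim_kernel by simp
  qed
  ultimately show "(\<Inter>m\<in>image_span - Vert (H v). quadric_tangent (H v) m) = common_kernel" by simp
qed

end

text \<open>The inclusion of the vertex in \<open>M\<close> gives \<open>w v \<in> M\<close> for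
  general and thus for all \<open>v\<close>. Because \<open>M\<close> is fixed, tangency may now be
  used at \<open>w u\<close> for the quadric of an unrelated \<open>v\<close>, which decouples the
  two parameters and yields \<open>B l (w u) = 0\<close>.\<close>

lemma tangent_along_subset:
  assumes gen: "generally PN (\<lambda>p. \<forall>v\<in>p - {0}. tangent_along (H v) L M \<and> Q v)"
  shows "L \<subseteq> common_kernel"
proof -
  obtain U where U: "openin zariski U" "U \<inter> PN \<noteq> {}"
    and U3: "\<forall>p\<in>U \<inter> PN. \<forall>v\<in>p - {0}. tangent_along (H v) L M \<and> Q v"
    using gen unfolding generally_def by (elim exE conjE)
  obtain p where "p \<in> U" using U(2) by blast
  then obtain F e where F: "homogeneous e F" "\<not> vanishes_at F p" "\<And>q. q \<in> PN \<Longrightarrow> \<not> vanishes_at F q \<Longrightarrow> q \<in> U"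
    using U(1) unfolding openin_zariski by blast
  then obtain x where x: "peval F x \<noteq> 0" by (auto simp: vanishes_at_def)
  have tan: "tangent_along (H v) L M" if "good v" "peval F v \<noteq> 0" for v
  proof (rule conjunct1[OF U3[rule_format, of "pt v"]])
    show "pt v \<in> U \<inter> PN" using F(3)[of "pt v"] that good_nonzero by (simp add: vanishes_at_pt[OF F(1)])
    show "v \<in> pt v - {0}" using good_nonzero[OF that(1)] by (simp add: vec.span_base)
  qed
  obtain v0 where "good v0" using good_exists by blast
  \<comment> \<open>This is part of \<open>generator\<close> at any good point with \<open>F\<close>
    nonzero. If it failed there would be no such point, and \<open>w\<close> would vanish
    identically.\<close>
  have "vec.subspace M"
  proof (rule ccontr)
    assume M: "\<not> vec.subspace M"
    have "w v = 0" for v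
    proof -
      have "w v $ i = 0" for i
        by (rule good_generic[OF hmapD[OF hmap_w] hfun_peval[OF F(1)] x])
          (use tan M in \<open>auto simp: tangent_along_def generator_def\<close>)
      then show ?thesis by (simp add: vec_eq_iff)
    qed
    then show False using \<open>good v0\<close> by (simp add: good_def)
  qed
  have wM: "w v \<in> M" for v
  proof (rule subspace_zero_generic[OF \<open>vec.subspace M\<close> hfun_peval[OF F(1)] x])
    fix v assume "good v" "peval F v \<noteq> 0"
    then have "tangent_along (H v) L M" by (rule tan)
    then have "Vert (H v) \<subseteq> M" by (auto simp only: tangent_along_def generator_def)
    then show "w v \<in> M" using B_w[of v] by (auto simp: Vert_iff)
  qed
  show "L \<subseteq> common_kernel"
  proof
    fix l assume l: "l \<in> L"
    have "B l (w u) = 0" for u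
    proof (rule dotp_nondegenerate)
      fix v
      have "dotp (B v (w u)) l = 0"
      proof (rule good_generic[where F = "\<lambda>v. dotp (B v (w u)) l", OF _ hfun_peval[OF F(1)] x])
        have "hfun 1 (\<lambda>v. dotp l (B v (w u)))"
          unfolding dotp_def B_nth by (intro hfun_sum hfun_cmult hfun_multc hfun_nth)
        then show "hfun 1 (\<lambda>v. dotp (B v (w u)) l)" by (simp add: dotp_commute)
        fix v assume "good v" "peval F v \<noteq> 0"
        then have "L \<subseteq> quadric_tangent (H v) (w u)" using tan wM by (simp add: tangent_along_def)
        then show "dotp (B v (w u)) l = 0" using l by (auto simp: quadric_tangent_def)
      qed
      then show "dotp (B l (w u)) v = 0"
        using dotp_B_commute[of "w u" v l] B_commute[of v "w u"] B_commute[of l "w u"] by simp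
    qed
    then show "l \<in> common_kernel" by (simp add: common_kernel_def)
  qed
qed

end


context polar_relation
begin

lemma is_general_Inter_generally:
  assumes "is_general_Inter W (perazzo_fiber f) I"
  shows "generally W (\<lambda>z. I \<subseteq> perazzo_fiber f z)"
proof -
  obtain U where U: "openin zariski U" "U \<inter> W \<noteq> {}"
    and Inter: "\<forall>U'. openin zariski U' \<and> U' \<subseteq> U \<and> U' \<inter> W \<noteq> {} \<longrightarrow>
      (\<Inter>z\<in>U' \<inter> W. perazzo_fiber f z) = I"
    using assms unfolding is_general_Inter_def by (elim exE conjE)
  have "(\<Inter>z\<in>U \<inter> W. perazzo_fiber f z) = I"
    by (rule Inter[rule_format]) (intro conjI U order_refl)
  then have "I \<subseteq> perazzo_fiber f z" if "z \<in> U \<inter> W" for z using that by blast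
  then show ?thesis unfolding generally_def using U by blast
qed

lemma generally_tangent_along:
  assumes "vec.dim common_kernel + variety_dim W + 1 = CARD('n)"
  shows "generally PN (\<lambda>p. \<forall>v\<in>p - {0}. tangent_along (H v) common_kernel image_span \<and>
    (\<Inter>m\<in>image_span - Vert (H v). quadric_tangent (H v) m) = common_kernel)"
proof -
  obtain v0 where "good v0" using good_exists by blast
  then obtain m \<delta> where \<delta>: "hfun m \<delta>" "\<delta> v0 \<noteq> 0" "\<And>v. \<delta> v \<noteq> 0 \<Longrightarrow> good v" using good_open_at by metis
  obtain F where F: "homogeneous m F" "\<delta> = peval F" using \<delta>(1) by (auto simp: hfun_def)
  let ?U = "{p \<in> PN. \<not> vanishes_at F p}"
  have "pt v0 \<in> ?U" using \<delta>(2) good_nonzero[OF \<open>good v0\<close>] F by (simp add: vanishes_at_pt)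
  then have nonempty: "?U \<inter> PN \<noteq> {}" by blast
  have good: "good v" if "p \<in> ?U \<inter> PN" "v \<in> p - {0}" for p v
  proof (rule \<delta>(3))
    have "p \<in> PN" using that(1) by blast
    then obtain u where "u \<noteq> 0" "p = pt u" by (rule PN_cases)
    then have "p = pt v" using pt_memD[of v u] that(2) by simp
    then show "\<delta> v \<noteq> 0" using that(1) F by (simp add: vanishes_at_pt)
  qed
  show ?thesis
    unfolding generally_def
  proof (intro exI[of _ ?U] conjI ballI openin_nonvanishing[OF F(1)] nonempty)
    fix p v assume "p \<in> ?U \<inter> PN" "v \<in> p - {0}"
    then have "good v" by (rule good)
    then show "tangent_along (H v) common_kernel image_span"
      and "(\<Inter>m\<in>image_span - Vert (H v). quadric_tangent (H v) m) = common_kernel"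
      by (rule tangent_along_good[OF assms])+
  qed
qed

text \<open>The prescribed dimension of \<open>L\<close> is the largest possible for the common
  kernel. Both implications between (i) and (ii) reduce to the inclusion alone.\<close>

lemma eq_common_kernel:
  assumes "vec.subspace L" "vec.dim L + variety_dim W + 1 = CARD('n)" "L \<subseteq> common_kernel"
  shows "L = common_kernel"
  using vec.subspace_dim_equal[OF assms(1) subspace_common_kernel assms(3)] assms(2) dim_common_kernel by simp

end


section \<open>The normal form\<close>

lemma form_in_sum: "(\<And>a. a \<in> A \<Longrightarrow> form_in S e (F a)) \<Longrightarrow> form_in S e (\<Sum>a\<in>A. F a)"
proof (induction A rule: infinite_finite_induct)
  case (insert a A)
  have "Poly_Mapping.keys (F a + sum F A) \<subseteq> Poly_Mapping.keys (F a) \<union> Poly_Mapping.keys (sum F A)"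
    by (rule keys_add)
  moreover have "form_in S e (F a)" "form_in S e (sum F A)" using insert by auto
  ultimately have "form_in S e (F a + sum F A)"
    using homogeneous_add[of e "F a" "sum F A"] unfolding form_in_def by blast
  then show ?case using insert.hyps by simp
qed (simp_all add: form_in_def)

lemma form_in_mult:
  assumes "form_in S d F" "form_in S e G"
  shows "form_in S (d + e) (F * G)"
  unfolding form_in_def
proof (intro conjI ballI)
  show "homogeneous (d + e) (F * G)" using assms homogeneous_mult by (auto simp: form_in_def)
  fix m assume m: "m \<in> Poly_Mapping.keys (F * G)"
  obtain a b where "m = a + b" "a \<in> Poly_Mapping.keys F" "b \<in> Poly_Mapping.keys G"
    using m keys_mult[of F G] by fast
  then show "Poly_Mapping.keys m \<subseteq> S" using assms keys_add[of a b] by (auto simp: form_in_def)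
qed

lemma form_in_const: "form_in S 0 (Poly_Mapping.single 0 c)"
  by (simp add: form_in_def homogeneous_const)

lemma form_in_Var: "i \<in> S \<Longrightarrow> form_in S 1 (Var i)"
  using homogeneous_Var[of i] by (simp add: form_in_def Var_def)

lemma dotp_sum_left: "dotp (\<Sum>a\<in>A. x a) y = (\<Sum>a\<in>A. dotp (x a) y)"
  by (induction A rule: infinite_finite_induct) (simp_all add: dotp_add_left)

lemma dotp_sum_right: "dotp y (\<Sum>a\<in>A. x a) = (\<Sum>a\<in>A. dotp y (x a))"
  by (induction A rule: infinite_finite_induct) (simp_all add: dotp_add_right)

lemma adapted_coordinates:
  fixes M L :: "('k::field^'n::finite) set"
  assumes "vec.subspace M" "vec.subspace L" "M \<subseteq> L" "I \<subseteq> J" "card I = vec.dim M" "card J = vec.dim L"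
  obtains A :: "'k^'n^'n" where "invertible A" "\<And>i. i \<in> I \<Longrightarrow> column i A \<in> M" "\<And>j. j \<in> J \<Longrightarrow> column j A \<in> L"
proof -
  obtain B1 where B1: "B1 \<subseteq> M" "vec.independent B1" "M \<subseteq> vec.span B1" "card B1 = vec.dim M"
    using vec.basis_exists[of M] by blast
  obtain B2 where B2: "B1 \<subseteq> B2" "B2 \<subseteq> L" "vec.independent B2" "L \<subseteq> vec.span B2"
    using vec.maximal_independent_subset_extend[of B1 L] B1(1,2) assms(3) by (metis subset_trans)
  obtain B3 where B3: "B2 \<subseteq> B3" "vec.independent B3" "UNIV \<subseteq> vec.span B3"
    using vec.maximal_independent_subset_extend[OF subset_UNIV B2(3)] by metis
  have fin: "finite B3" "finite B2" "finite B1" using B1 B2 B3 vec.finiteI_independent by blast+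
  have c2: "card B2 = card J"
    using vec.basis_card_eq_dim[OF B2(2,4,3)] assms(6) by simp
  have c3: "card B3 = CARD('n)"
    using vec.basis_card_eq_dim[OF subset_UNIV B3(3,2)] by (simp add: card_cart_basis)
  obtain b1 where b1: "bij_betw b1 I B1" using finite_same_card_bij[of I B1] fin B1(4) assms(5) by auto
  have "card (J - I) = card (B2 - B1)"
    using B2(1) fin c2 B1(4) assms(4,5) by (simp add: card_Diff_subset)
  then obtain b2 where b2: "bij_betw b2 (J - I) (B2 - B1)"
    using finite_same_card_bij[of "J - I" "B2 - B1"] fin by auto
  have "card (- J) = card (B3 - B2)"
    using B3(1) fin c2 c3 by (simp add: card_Diff_subset Compl_eq_Diff_UNIV)
  then obtain b3 where b3: "bij_betw b3 (- J) (B3 - B2)"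
    using finite_same_card_bij[of "- J" "B3 - B2"] fin by auto
  define \<beta> where "\<beta> i = (if i \<in> I then b1 i else if i \<in> J then b2 i else b3 i)" for i
  define A :: "'k^'n^'n" where "A = (\<chi> i j. \<beta> j $ i)"
  have col: "column j A = \<beta> j" for j by (simp add: column_def A_def vec_eq_iff)
  have "B3 \<subseteq> range \<beta>"
  proof
    fix b assume b: "b \<in> B3"
    consider "b \<in> b1 ` I" | "b \<in> b2 ` (J - I)" | "b \<in> b3 ` (- J)"
      using b b1 b2 b3 unfolding bij_betw_def by blast
    then show "b \<in> range \<beta>"
    proof cases
      case 1
      then show ?thesis by (auto simp: \<beta>_def image_iff intro: exI)
    next
      case 2
      then obtain j where "j \<in> J - I" "b = b2 j" by blast
      then show ?thesis by (intro range_eqI[of _ _ j]) (simp add: \<beta>_def)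
    next
      case 3
      then obtain j where "j \<notin> J" "b = b3 j" by blast
      then show ?thesis using assms(4) by (intro range_eqI[of _ _ j]) (auto simp: \<beta>_def)
    qed
  qed
  moreover have "columns A = range \<beta>" by (auto simp: columns_def col)
  ultimately have "vec.span (columns A) = UNIV" using B3(3) vec.span_mono[of B3 "range \<beta>"] by auto
  then have "invertible A"
    using matrix_right_invertible_span_columns[of A] by (simp add: invertible_right_inverse)
  moreover have "column i A \<in> M" if "i \<in> I" for i
    using that b1 B1(1) by (auto simp: col \<beta>_def bij_betw_def)
  moreover have "column j A \<in> L" if "j \<in> J" for j
    using that b1 b2 B1(1) B2(2) assms(3) by (auto simp: col \<beta>_def bij_betw_def)
  ultimately show ?thesis by (rule that)
qed

lemma proj_equivalent_hypersurface:
  fixes F G :: "('n::finite, 'k::field) mpoly"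
  assumes A: "invertible A" and eq: "\<And>v. peval G v = peval F (A *v v)"
  shows "proj_equivalent (hypersurface F) (hypersurface G)"
proof -
  obtain A' where A': "A ** A' = mat 1" "A' ** A = mat 1" using A by (auto simp: invertible_def)
  have inv: "A *v (A' *v v) = v" "A' *v (A *v v) = v" for v
    by (simp_all add: matrix_vector_mul_assoc A')
  have img: "(*v) Q ` pt v = pt (Q *v v)" for Q :: "'k^'n^'n" and v
    using vec.linear_span_image[OF matrix_vector_mul_linear_gen, of Q "{v}"] by simp
  have nz: "A' *v v \<noteq> 0" "A *v v \<noteq> 0" if "v \<noteq> 0" for v
    using inv[of v] that by (metis matrix_vector_mult_0_right)+
  \<comment> \<open>\<open>A\<close> pulls the form \<open>F\<close> back to \<open>G\<close>, so
    the points of the hypersurface move by the inverse \<open>A'\<close>.\<close>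
  have "(\<lambda>p. (*v) A' ` p) ` hypersurface F = hypersurface G"
  proof (intro subset_antisym image_subsetI subsetI)
    fix p assume "p \<in> hypersurface F"
    then have p: "p \<in> PN" "\<forall>v\<in>p. peval F v = 0" by (auto simp: hypersurface_def vanishes_at_def)
    obtain v where v: "v \<noteq> 0" "p = pt v" using p(1) by (rule PN_cases)
    have "(*v) A' ` p \<in> PN" using nz(1)[OF v(1)] by (simp add: v(2) img)
    moreover have "vanishes_at G ((*v) A' ` p)" using p(2) by (auto simp: vanishes_at_def eq inv)
    ultimately show "(*v) A' ` p \<in> hypersurface G" by (simp add: hypersurface_def)
  next
    fix q assume "q \<in> hypersurface G"
    then have q: "q \<in> PN" "\<forall>v\<in>q. peval F (A *v v) = 0" by (auto simp: hypersurface_def vanishes_at_def eq)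
    obtain v where v: "v \<noteq> 0" "q = pt v" using q(1) by (rule PN_cases)
    have "(*v) A ` q \<in> PN" using nz(2)[OF v(1)] by (simp add: v(2) img)
    moreover have "vanishes_at F ((*v) A ` q)" using q(2) by (auto simp: vanishes_at_def)
    ultimately have "(*v) A ` q \<in> hypersurface F" by (simp add: hypersurface_def)
    moreover have "q = (*v) A' ` ((*v) A ` q)" by (simp add: image_image inv)
    ultimately show "q \<in> (\<lambda>p. (*v) A' ` p) ` hypersurface F" by blast
  qed
  moreover have "invertible A'" using A' by (auto simp: invertible_def)
  ultimately show ?thesis unfolding proj_equivalent_def by blast
qed

context cubic
begin

lemma trilinear_sum:
  "dotp (B (\<Sum>i\<in>I. a i *s x i) (\<Sum>j\<in>J. b j *s y j)) (\<Sum>k\<in>K. c k *s z k) =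
    (\<Sum>i\<in>I. \<Sum>j\<in>J. \<Sum>k\<in>K. a i * b j * c k * dotp (B (x i) (y j)) (z k))"
proof -
  have right: "B u (\<Sum>j\<in>J. b j *s y j) = (\<Sum>j\<in>J. b j *s B u (y j))" for u J b and y :: "'z \<Rightarrow> 'k^'n"
    by (induction J rule: infinite_finite_induct) (simp_all add: B_simps)
  have left: "B (\<Sum>i\<in>I. a i *s x i) u = (\<Sum>i\<in>I. a i *s B (x i) u)" for u I a and x :: "'y \<Rightarrow> 'k^'n"
    by (induction I rule: infinite_finite_induct) (simp_all add: B_simps)
  show ?thesis
    unfolding left
    unfolding right dotp_sum_left dotp_scale_left
    unfolding dotp_sum_right dotp_scale_right sum_distrib_left
    by (simp only: mult.assoc)
qed

text \<open>In a basis adapted to \<open>M\<close>, \<open>L\<close> and the whole space, every term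
  of the cubic with a factor from \<open>M\<close> and another from \<open>L\<close> vanishes. The
  only terms left with a factor from \<open>M\<close> have their other two factors outside
  \<open>L\<close>.\<close>

lemma normal_form:
  assumes sub: "vec.subspace M" "vec.subspace L" "M \<subseteq> L" and B0: "\<And>m l. m \<in> M \<Longrightarrow> l \<in> L \<Longrightarrow> B m l = 0"
    and IJ: "I \<subseteq> J" "card I = vec.dim M" "card J = vec.dim L"
  obtains C :: "'n \<Rightarrow> ('n, 'k) mpoly" and D :: "('n, 'k) mpoly"
  where "\<And>i. form_in (- J) 2 (C i)" "form_in (- I) 3 D"
    "proj_equivalent (hypersurface f) (hypersurface ((\<Sum>i\<in>I. Var i * C i) + D))"
proof -
  obtain A :: "'k^'n^'n" where A: "invertible A" "\<And>i. i \<in> I \<Longrightarrow> column i A \<in> M" "\<And>j. j \<in> J \<Longrightarrow> column j A \<in> L"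
    using adapted_coordinates[OF sub IJ] by metis
  define \<beta> where "\<beta> i = column i A" for i
  define \<tau> where "\<tau> i j k = dotp (B (\<beta> i) (\<beta> j)) (\<beta> k)" for i j k
  define C :: "'n \<Rightarrow> ('n, 'k) mpoly" where
    "C i = (\<Sum>j\<in>- J. \<Sum>k\<in>- J. Poly_Mapping.single 0 (\<tau> i j k / 2) * (Var j * Var k))" for i
  define D :: "('n, 'k) mpoly" where
    "D = (\<Sum>i\<in>- I. \<Sum>j\<in>- I. \<Sum>k\<in>- I. Poly_Mapping.single 0 (\<tau> i j k / 6) * (Var i * (Var j * Var k)))"
  show ?thesis
  proof (rule that[of C D])
    show "form_in (- J) 2 (C i)" for i
    proof -
      have "form_in (- J) (0 + (1 + 1)) (C i)"
        unfolding C_def by (intro form_in_sum form_in_mult form_in_const form_in_Var)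
      then show ?thesis by (simp add: numeral_2_eq_2)
    qed
    have "form_in (- I) (0 + (1 + (1 + 1))) D"
      unfolding D_def by (intro form_in_sum form_in_mult form_in_const form_in_Var)
    then show "form_in (- I) 3 D" by (simp add: numeral_3_eq_3)
    show "proj_equivalent (hypersurface f) (hypersurface ((\<Sum>i\<in>I. Var i * C i) + D))"
    proof (rule proj_equivalent_hypersurface[OF A(1)])
      fix v
      define m where "m = (\<Sum>i\<in>I. v $ i *s \<beta> i)"
      define l where "l = (\<Sum>i\<in>J - I. v $ i *s \<beta> i)"
      define r where "r = (\<Sum>i\<in>- J. v $ i *s \<beta> i)"
      define z where "z = (\<Sum>i\<in>- I. v $ i *s \<beta> i)"
      have m: "m \<in> M" unfolding m_def \<beta>_def by (intro vec.subspace_sum[OF sub(1)] vec.subspace_scale[OF sub(1)] A(2))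
      have l: "l \<in> L" unfolding l_def \<beta>_def
        by (intro vec.subspace_sum[OF sub(2)] vec.subspace_scale[OF sub(2)] A(3)) simp
      have "- I = (J - I) \<union> - J" using IJ(1) by auto
      then have z: "z = l + r" unfolding z_def l_def r_def
        by (simp only:) (rule sum.union_disjoint; auto)
      have "A *v v = (\<Sum>i\<in>UNIV. v $ i *s \<beta> i)" unfolding \<beta>_def by (rule matrix_mult_sum)
      also have "\<dots> = m + z"
        unfolding m_def z_def by (subst sum.union_disjoint[symmetric]) auto
      finally have Av: "A *v v = m + z" .
      have mm: "B m m = 0" and ml: "B m l = 0" using B0 m l sub(3) by blast+
      have "dotp (B m z) z = dotp (B m r) z" by (simp add: z B_simps ml)
      also have "\<dots> = dotp (B m z) r" by (rule dotp_B_commute)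
      also have "\<dots> = dotp (B m r) r" by (simp add: z B_simps ml)
      finally have mz: "dotp (B m z) z = dotp (B m r) r" .
      have zm: "dotp (B z z) m = dotp (B m r) r"
        using dotp_B_commute[of z z m] B_commute[of z m] mz by simp
      have mzm: "dotp (B m z) m = 0" using dotp_B_commute[of m z m] mm by simp
      \<comment> \<open>The three positions of \<open>m\<close> among the arguments each contribute
        the same term; division by 6 explains the factors 1/2 in \<open>C\<close> and 1/6 in
        \<open>D\<close>.\<close>
      have "6 * peval f (A *v v) = 3 * dotp (B m r) r + dotp (B z z) z"
        unfolding peval_eq Av B_add_left B_add_right dotp_add_left dotp_add_right B_commute[of z m]
        by (simp add: mm mz zm mzm)
      then have fA: "peval f (A *v v) = (1 / 2) * dotp (B m r) r + (1 / 6) * dotp (B z z) z"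
        by (simp add: field_simps)
      have "peval (\<Sum>i\<in>I. Var i * C i) v = (1 / 2) * dotp (B m r) r"
        unfolding m_def r_def trilinear_sum \<tau>_def[symmetric]
        by (simp add: C_def sum_distrib_left mult_ac)
      moreover have "peval D v = (1 / 6) * dotp (B z z) z"
        unfolding z_def trilinear_sum \<tau>_def[symmetric]
        by (simp add: D_def sum_distrib_left mult_ac)
      ultimately show "peval ((\<Sum>i\<in>I. Var i * C i) + D) v = peval f (A *v v)"
        unfolding peval_add fA by (simp only:)
    qed
  qed
qed

end

lemma singular_if_vanishing_hessian:
  assumes "vanishing_hessian f"
  shows "\<exists>u. u \<noteq> 0 \<and> hessian_at f v *v u = 0"
proof -
  have "det (hessian_at f v) = peval (det (\<chi> i j. pd j (pd i f))) v"
    by (simp add: peval_det hessian_at_def)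
  then have "det (hessian_at f v) = 0" using assms by (simp add: vanishing_hessian_def)
  then show ?thesis
    using invertible_det_nz[of "hessian_at f v"] matrix_left_invertible_ker[of "hessian_at f v"]
    by (metis invertible_left_inverse)
qed

text \<open>A vector \<open>u\<close> in the radical leaves \<open>f\<close> unchanged under
  translation by its multiples, so a nonzero \<open>u\<close> would be a vertex of the
  hypersurface.\<close>

lemma (in cubic) nondegenerate_if_not_cone:
  assumes not_cone: "\<not> is_cone (hypersurface f)" and u: "\<And>v. B u v = 0"
  shows "u = 0"
proof (rule ccontr)
  assume "u \<noteq> 0"
  have inv: "peval f (a *s u + v) = peval f v" for a v
  proof -
    have "B (a *s u + v) (a *s u + v) = B v v"
      using u B_commute[of v u] by (simp add: B_simps)
    then have "6 * peval f (a *s u + v) = dotp (B v v) (a *s u + v)" by (simp only: peval_eq)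
    also have "\<dots> = 6 * peval f v"
      using dotp_B_commute[of v v u] u B_commute[of v u] by (simp add: dotp_simps peval_eq)
    finally show ?thesis by simp
  qed
  have vu: "vanishes_at f (pt u)"
    using inv[of 1 0] hfun_at_0[OF hfun_peval[OF cubic]] by (simp add: vanishes_at_pt[OF cubic])
  have "is_cone (hypersurface f)"
    unfolding is_cone_def
  proof (intro bexI[of _ "pt u"] ballI impI)
    show "pt u \<in> hypersurface f" using \<open>u \<noteq> 0\<close> vu by (simp add: hypersurface_def)
    fix q assume "q \<in> hypersurface f"
    then have q: "q \<in> PN" "\<forall>y\<in>q. peval f y = 0" by (auto simp: hypersurface_def vanishes_at_def)
    have "vec.subspace q" using q(1) by (auto elim: PN_cases)
    show "proj_pts (vec.span (pt u \<union> q)) \<subseteq> hypersurface f"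
    proof
      fix p assume "p \<in> proj_pts (vec.span (pt u \<union> q))"
      then obtain y where y: "p = pt y" "y \<in> vec.span (pt u \<union> q)" "y \<noteq> 0" by (auto simp: proj_pts_def)
      then obtain a b where "y = a + b" "a \<in> pt u" "b \<in> q"
        using vec.span_eq_iff[THEN iffD2, OF \<open>vec.subspace q\<close>] by (auto simp: vec.span_Un vec.span_span)
      then have "peval f y = 0" using inv q(2) by (auto simp: vec.span_singleton)
      then show "p \<in> hypersurface f" using y by (simp add: hypersurface_def vanishes_at_pt[OF cubic])
    qed
  qed
  then show False using not_cone by blast
qed

theorem theorem3p7:
  fixes f :: "('n::finite, 'k::{alg_closed_field, field_char_0}) mpoly"
    and N :: nat and \<sigma> :: int and L :: "('k^'n) set" and x :: "nat \<Rightarrow> 'n"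
  assumes N: "CARD('n) = N + 1"
    and x: "bij_betw x {0..N} UNIV"
    and cubic: "homogeneous 3 f"
    and irred: "irreducible f"
    and hess: "vanishing_hessian f"
    and not_cone: "\<not> is_cone (hypersurface f)"
    and codim: "int N - int (variety_dim (polar_image f)) = 1"
  defines "dimZdual \<equiv> int (variety_dim (dual_variety (polar_image f)))"
  defines "cond_i \<equiv>
      special_perazzo_cubic f \<and> dimZdual + 1 = \<sigma> \<and>
      vec.subspace L \<and> proj_dim L = int N - \<sigma> \<and>
      is_general_Inter (perazzo_image f) (perazzo_fiber f) (proj_pts L)"
  defines "cond_ii \<equiv>
      dimZdual = \<sigma> - 1 \<and> vec.subspace L \<and> proj_dim L = int N - \<sigma> \<and>
      (\<exists>M::('k^'n) set. vec.subspace M \<and> proj_dim M = \<sigma> \<and>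
         generally PN (\<lambda>p. \<forall>v\<in>p - {0}.
            tangent_along (hessian_at f v) L M \<and>
            (\<Inter>m\<in>M - Vert (hessian_at f v). quadric_tangent (hessian_at f v) m) = L))"
  shows "(cond_i \<longleftrightarrow> cond_ii) \<and>
    (cond_i \<longrightarrow>
      (\<exists>(C :: nat \<Rightarrow> ('n, 'k) mpoly) (D :: ('n, 'k) mpoly).
         (\<forall>i\<in>{0..nat \<sigma>}. form_in (x ` {j. int N - \<sigma> + 1 \<le> int j \<and> j \<le> N}) 2 (C i)) \<and>
         form_in (x ` {j. \<sigma> + 1 \<le> int j \<and> j \<le> N}) 3 D \<and>
         proj_equivalent (hypersurface f)
           (hypersurface ((\<Sum>i=0..nat \<sigma>. Var (x i) * C i) + D))))"
proof -
  interpret cubic f by unfold_locales (rule cubic)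
  interpret polar_hypersurface f
  proof unfold_locales
    show "u = 0" if "\<And>v. B u v = 0" for u using nondegenerate_if_not_cone[OF not_cone] that by blast
    show "\<exists>u. u \<noteq> 0 \<and> B v u = 0" for v by (rule singular_if_vanishing_hessian[OF hess])
    show "variety_dim (polar_image f) + 2 = CARD('n)" using codim N by simp
  qed
  obtain d g where dg: "d \<ge> 2" "homogeneous d g" "\<And>v. peval g (gradient f v) = 0"
    "\<exists>v. gradient g (gradient f v) \<noteq> 0"
    using separating_relation_exists by metis
  interpret polar_relation f g d by unfold_locales (use dg in auto)
  define \<mu> where "\<mu> = variety_dim W"
  have dual: "dimZdual = int \<mu>" unfolding dimZdual_def dual_variety_eq \<mu>_def ..
  \<comment> \<open>With \<open>\<sigma>\<close> one more than the dimension of \<open>W\<close>,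
    projective dimension \<open>N - \<sigma>\<close> means one less than the dimension of a general
    fibre.\<close>
  have dimL: "vec.dim L + variety_dim W + 1 = CARD('n)" if "proj_dim L = int N - \<sigma>" "dimZdual + 1 = \<sigma>"
    using that N dual unfolding proj_dim_def \<mu>_def by simp
  have i: "L = common_kernel \<and> vec.dim common_kernel + variety_dim W + 1 = CARD('n) \<and> \<sigma> = int \<mu> + 1" if cond_i
  proof -
    have c: "vec.subspace L" "dimZdual + 1 = \<sigma>" "proj_dim L = int N - \<sigma>"
      "is_general_Inter W (perazzo_fiber f) (proj_pts L)"
      using that unfolding cond_i_def perazzo_image_eq by auto
    then have "L = common_kernel" using eq_common_kernel dimL general_Inter_subset by blast
    then show ?thesis using c dimL dual by simp
  qed
  have "cond_ii" if cond_i
  proof -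
    have L: "L = common_kernel" and dk: "vec.dim common_kernel + variety_dim W + 1 = CARD('n)"
      and \<sigma>: "\<sigma> = int \<mu> + 1" using i[OF that] by auto
    have "proj_dim image_span = \<sigma>" using dim_image_span[OF dk] \<sigma> by (simp add: proj_dim_def \<mu>_def)
    then show ?thesis
      using that generally_tangent_along[OF dk] subspace_image_span
      unfolding cond_ii_def cond_i_def L by auto
  qed
  moreover have "cond_i" if ii: cond_ii
  proof -
    have c: "vec.subspace L" "dimZdual + 1 = \<sigma>" "proj_dim L = int N - \<sigma>"
      using ii unfolding cond_ii_def by auto
    obtain M where M: "generally PN (\<lambda>p. \<forall>v\<in>p - {0}. tangent_along (H v) L M \<and>
        (\<Inter>m\<in>M - Vert (H v). quadric_tangent (H v) m) = L)"
      using ii unfolding cond_ii_def by (elim exE conjE)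
    have "L = common_kernel"
      by (rule eq_common_kernel[OF c(1) dimL[OF c(3,2)] tangent_along_subset[OF M]])
    then have Inter: "is_general_Inter (perazzo_image f) (perazzo_fiber f) (proj_pts L)"
      unfolding perazzo_image_eq using general_Inter_common_kernel by simp
    have "proj_dim L = proj_dim (UNIV :: ('k^'n) set) - int (variety_dim (perazzo_image f)) - 1"
      using c(2,3) N dual unfolding perazzo_image_eq \<mu>_def proj_dim_def by (simp add: card_cart_basis)
    moreover have "generally (perazzo_image f) (\<lambda>z. proj_pts L \<subseteq> perazzo_fiber f z)"
      using is_general_Inter_generally Inter unfolding perazzo_image_eq by blast
    ultimately have "special_perazzo_cubic f"
      unfolding special_perazzo_cubic_def using cubic irred hess not_cone c(1) by blast
    then show ?thesis unfolding cond_i_def using c Inter by blast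
  qed
  moreover have "\<exists>(C :: nat \<Rightarrow> ('n, 'k) mpoly) (D :: ('n, 'k) mpoly).
         (\<forall>i\<in>{0..nat \<sigma>}. form_in (x ` {j. int N - \<sigma> + 1 \<le> int j \<and> j \<le> N}) 2 (C i)) \<and>
         form_in (x ` {j. \<sigma> + 1 \<le> int j \<and> j \<le> N}) 3 D \<and>
         proj_equivalent (hypersurface f)
           (hypersurface ((\<Sum>i=0..nat \<sigma>. Var (x i) * C i) + D))" if cond_i
  proof -
    have dk: "vec.dim common_kernel + variety_dim W + 1 = CARD('n)" and \<sigma>: "\<sigma> = int \<mu> + 1"
      using i[OF that] by auto
    define s where "s = nat \<sigma>"
    have s: "\<sigma> = int s" "s = \<mu> + 1" using \<sigma> by (simp_all add: s_def)
    have dims: "vec.dim image_span = s + 1" "vec.dim common_kernel + s = N + 1"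
      using dim_image_span[OF dk] dk N s(2) by (simp_all add: \<mu>_def)
    have "vec.dim image_span \<le> vec.dim common_kernel" using image_span_subset[OF dk] by (rule vec.dim_subset)
    \<comment> \<open>The inclusion of \<open>M\<close> in \<open>L\<close> compares their
      dimensions \<open>s + 1\<close> and \<open>N - s + 1\<close>. Hence the variables of
      \<open>M\<close> are among those of \<open>L\<close>, and the variables of the quadratic forms
      are disjoint from \<open>x 0\<close>, ..., \<open>x s\<close>.\<close>
    then have le: "s + s \<le> N" using dims by simp
    have injx: "inj_on x {0..N}" and surjx: "x ` {0..N} = UNIV" using x by (auto simp: bij_betw_def)
    \<comment> \<open>The first \<open>s + 1\<close> variables are coordinates on \<open>M\<close>
      and the first \<open>N - s + 1\<close> on \<open>L\<close>; the complementary variables are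
      those allowed in \<open>D\<close> and in the quadratic forms, respectively.\<close>
    let ?I = "x ` {0..s}" and ?J = "x ` {0..N - s}"
    have card: "card (x ` {0..k}) = k + 1" if "k \<le> N" for k
      using that injx by (subst card_image) (auto intro: inj_on_subset)
    have compl: "- (x ` {0..k}) = x ` {j. int k + 1 \<le> int j \<and> j \<le> N}" if "k \<le> N" for k
    proof -
      have "- (x ` {0..k}) = x ` {0..N} - x ` {0..k}" using surjx by blast
      also have "\<dots> = x ` ({0..N} - {0..k})" using injx that by (intro inj_on_image_set_diff[symmetric]) auto
      also have "{0..N} - {0..k} = {j. int k + 1 \<le> int j \<and> j \<le> N}" by auto
      finally show ?thesis .
    qed
    obtain C' D where CD: "\<And>i. form_in (- ?J) 2 (C' i)" "form_in (- ?I) 3 D"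
      "proj_equivalent (hypersurface f) (hypersurface ((\<Sum>i\<in>?I. Var i * C' i) + D))"
    proof (rule normal_form[OF subspace_image_span subspace_common_kernel image_span_subset[OF dk], of ?I ?J])
      show "B m l = 0" if "m \<in> image_span" "l \<in> common_kernel" for m l
        using B_kernel_span[OF that(2,1)] B_commute[of m l] by simp
      show "?I \<subseteq> ?J" using le by auto
      show "card ?I = vec.dim image_span" "card ?J = vec.dim common_kernel"
        using card[of s] card[of "N - s"] dims le by auto
    qed blast
    have "(\<Sum>i\<in>?I. Var i * C' i) = (\<Sum>i=0..nat \<sigma>. Var (x i) * C' (x i))"
      using le injx by (subst sum.reindex) (auto simp: s_def intro: inj_on_subset)
    moreover have "- ?J = x ` {j. int N - \<sigma> + 1 \<le> int j \<and> j \<le> N}"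
      using compl[of "N - s"] le s(1) by (simp add: of_nat_diff)
    moreover have "- ?I = x ` {j. \<sigma> + 1 \<le> int j \<and> j \<le> N}" using compl[of s] le s(1) by simp
    ultimately show ?thesis
      using CD by (intro exI[of _ "\<lambda>i. C' (x i)"] exI[of _ D]) simp
  qed
  ultimately show ?thesis by blast
qed

end
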